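(* Let $\Gamma$ be the skeleton of a map of type $\{6,3\}$ on the torus. If $\Gamma$ has no cycles of length less than $6$, then either $\Gamma$ is (isomorphic to) one of the graphs $\Psi_n$ with $n\ge 7$, $\Sigma_n$ with $n\ge 3$, or $\Delta_n$ with $n\ge 4$, or the only $6$-cycles of $\Gamma$ are the face cycles of the map.
   Context: Maps. Topologically, a map is an embedding of a finite connected graph in a closed surface such that the components of the complement (faces) are open disks whose closures are closed disks. Combinatorially, a map is a pair $(\Gamma,\mathcal T)$ where $\Gamma$ (the skeleton) is a finite connected graph and $\mathcal T$ (the face walks, called face cycles when they are cycles) is a set of closed walks in $\Gamma$ such that every edge belongs to precisely two walks of $\mathcal T$, every edge is traversed at most once by each walk of $\mathcal T$, and, at each vertex $u$, the relation on the arcs with tail $u$ given by "the underlying edges are consecutive on some walk in $\mathcal T$" arranges these arcs into a single cycle. The surface of the map is obtained by gluing a closed disk along each walk in $\mathcal T$; the map is on the torus if this surface is a torus. The map has type $\{\ell,k\}$ if $\Gamma$ is $k$-regular and all walks in $\mathcal T$ have length $\ell$. Cayley graphs. $\operatorname{Cay}(G,S)$, with $S=S^{-1}\subseteq G\setminus\{1\}$, has vertex-set $G$, with $g,h$ adjacent iff $gh^{-1}\in S$. $\mathbb D_n=\langle\rho,\tau\mid\rho^n,\tau^2,(\rho\tau)^2\rangle$ is the dihedral group of order $2n$; write $\rho_i=\rho^i$ and $\tau_i=\rho^i\tau$ (indices modulo $n$). $\mathbb Z_3$ is the (additive) cyclic group of order $3$. Define $\Psi_n=\operatorname{Cay}(\mathbb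 D_n,\{\tau_0,\tau_1,\tau_3\})$; $\Sigma_n=\operatorname{Cay}(\mathbb D_n\times\mathbb Z_3,\{(\tau_1,0),(\tau_0,1),(\tau_0,2)\})$; $\Delta_n=\operatorname{Cay}(\mathbb D_{3n},\{\tau_0,\tau_k,\tau_n\})$, where $k=3/\gcd(3,n)$. *)

theory Defs
  imports "HOL-Analysis.Analysis" "HOL-Algebra.Algebra"
begin

section \<open>Graphs\<close>

text \<open>A simple graph is a pair of its vertex set and its set of edges, an edge being the
  two-element set of its ends.\<close>

type_synonym 'a graph = "'a set \<times> 'a set set"

abbreviation verts :: "'a graph \<Rightarrow> 'a set" where "verts \<equiv> fst"
abbreviation edges :: "'a graph \<Rightarrow> 'a set set" where "edges \<equiv> snd"

definition finite_connected_graph :: "'a graph \<Rightarrow> bool" where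
  "finite_connected_graph G \<longleftrightarrow>
     finite (verts G) \<and> verts G \<noteq> {} \<and>
     (\<forall>e\<in>edges G. e \<subseteq> verts G \<and> card e = 2) \<and>
     (\<forall>u\<in>verts G. \<forall>v\<in>verts G. (u, v) \<in> {(x, y). {x, y} \<in> edges G}\<^sup>*)"

definition regular_graph :: "nat \<Rightarrow> 'a graph \<Rightarrow> bool" where
  "regular_graph k G \<longleftrightarrow> (\<forall>v\<in>verts G. card {w. {v, w} \<in> edges G} = k)"

definition graph_iso :: "'a graph \<Rightarrow> 'b graph \<Rightarrow> bool" where
  "graph_iso G H \<longleftrightarrow>
     (\<exists>f. bij_betw f (verts G) (verts H) \<and>
          (\<forall>u\<in>verts G. \<forall>v\<in>verts G. {u, v} \<in> edges G \<longleftrightarrow> {f u, f v} \<in> edges H))"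

text \<open>A closed walk is given by the cyclic list of its vertices; the starting vertex is not
  repeated at the end, so that the length of the walk is the length of the list.\<close>

definition walk_edges :: "'a list \<Rightarrow> 'a set list" where
  "walk_edges W = map (\<lambda>i. {W ! i, W ! (Suc i mod length W)}) [0..<length W]"

definition closed_walk :: "'a graph \<Rightarrow> 'a list \<Rightarrow> bool" where
  "closed_walk G W \<longleftrightarrow> W \<noteq> [] \<and> set W \<subseteq> verts G \<and> set (walk_edges W) \<subseteq> edges G"

definition is_cycle :: "'a graph \<Rightarrow> 'a list \<Rightarrow> bool" where
  "is_cycle G C \<longleftrightarrow> closed_walk G C \<and> distinct C \<and> length C \<ge> 3"

text \<open>Two lists describe the same closed walk if they differ by the choice of the starting
  vertex and of the direction.\<close>

definition same_closed_walk :: "'a list \<Rightarrow> 'a list \<Rightarrow> bool" where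
  "same_closed_walk W W' \<longleftrightarrow> (\<exists>k. W' = rotate k W \<or> W' = rotate k (rev W))"


section \<open>Maps\<close>

definition arcs_at :: "'a graph \<Rightarrow> 'a \<Rightarrow> ('a \<times> 'a) set" where
  "arcs_at G u = {(u, v) | v. {u, v} \<in> edges G}"

definition underlying_edge :: "'a \<times> 'a \<Rightarrow> 'a set" where
  "underlying_edge a = {fst a, snd a}"

definition consecutive_edges :: "'a list set \<Rightarrow> 'a set \<Rightarrow> 'a set \<Rightarrow> bool" where
  "consecutive_edges T e f \<longleftrightarrow>
     (\<exists>W\<in>T. \<exists>i<length W.
        {e, f} = {walk_edges W ! i, walk_edges W ! (Suc i mod length W)})"

definition arranges_in_cycle :: "('b \<Rightarrow> 'b \<Rightarrow> bool) \<Rightarrow> 'b set \<Rightarrow> bool" where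
  "arranges_in_cycle R A \<longleftrightarrow>
     (\<exists>c. distinct c \<and> set c = A \<and>
          (\<forall>i<length c. \<forall>j<length c.
             R (c ! i) (c ! j) \<longleftrightarrow> j = Suc i mod length c \<or> i = Suc j mod length c))"

text \<open>The third condition makes \<^term>\<open>T\<close> contain one list for each of its closed walks, so that
  counting lists in \<^term>\<open>T\<close> counts walks.\<close>

definition is_map :: "'a graph \<Rightarrow> 'a list set \<Rightarrow> bool" where
  "is_map G T \<longleftrightarrow>
     finite_connected_graph G \<and>
     (\<forall>W\<in>T. closed_walk G W) \<and>
     (\<forall>W\<in>T. \<forall>W'\<in>T. same_closed_walk W W' \<longrightarrow> W = W') \<and>
     (\<forall>e\<in>edges G. card {W\<in>T. e \<in> set (walk_edges W)} = 2) \<and>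
     (\<forall>W\<in>T. distinct (walk_edges W)) \<and>
     (\<forall>u\<in>verts G.
        arranges_in_cycle
          (\<lambda>a b. consecutive_edges T (underlying_edge a) (underlying_edge b)) (arcs_at G u))"

definition has_type :: "'a graph \<Rightarrow> 'a list set \<Rightarrow> nat \<Rightarrow> nat \<Rightarrow> bool" where
  "has_type G T l k \<longleftrightarrow> regular_graph k G \<and> (\<forall>W\<in>T. length W = l)"


section \<open>The surface of a map\<close>

text \<open>The graph is realized inside the space of real-valued functions on vertices (with the
  product topology): a vertex becomes its indicator function, an edge the segment between the
  indicator functions of its ends.\<close>

definition vertex_point :: "'a \<Rightarrow> 'a \<Rightarrow> real" where
  "vertex_point v = (\<lambda>x. of_bool (x = v))"

definition edge_point :: "'a \<Rightarrow> 'a \<Rightarrow> real \<Rightarrow> 'a \<Rightarrow> real" where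
  "edge_point u v t = (\<lambda>x. (1 - t) * vertex_point u x + t * vertex_point v x)"

definition graph_points :: "'a graph \<Rightarrow> ('a \<Rightarrow> real) set" where
  "graph_points G =
     vertex_point ` verts G \<union> {edge_point u v t | u v t. {u, v} \<in> edges G \<and> 0 \<le> t \<and> t \<le> 1}"

text \<open>The unit circle is divided into \<^term>\<open>length W\<close> equal arcs, starting at 1, and the
  \<open>i\<close>-th arc runs at constant speed along the \<open>i\<close>-th edge of \<^term>\<open>W\<close>.\<close>

definition attaching_map :: "'a list \<Rightarrow> complex \<Rightarrow> 'a \<Rightarrow> real" where
  "attaching_map W z =
     (let s = real (length W) * Arg2pi z / (2 * pi); i = nat \<lfloor>s\<rfloor>
      in edge_point (W ! i) (W ! (Suc i mod length W)) (frac s))"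

text \<open>The adjunction space of the realized graph and one closed unit disk for every walk: its
  points are those of the graph and of the open disks, and it carries the quotient (final)
  topology with respect to the inclusion of the graph and the characteristic maps of the closed
  disks.\<close>

type_synonym 'a surface_point = "('a \<Rightarrow> real) + ('a list \<times> complex)"

definition surface_points :: "'a graph \<Rightarrow> 'a list set \<Rightarrow> 'a surface_point set" where
  "surface_points G T = Inl ` graph_points G \<union> Inr ` (T \<times> ball 0 1)"

definition disk_map :: "'a list \<Rightarrow> complex \<Rightarrow> 'a surface_point" where
  "disk_map W z = (if norm z < 1 then Inr (W, z) else Inl (attaching_map W z))"

definition surface :: "'a graph \<Rightarrow> 'a list set \<Rightarrow> 'a surface_point topology" where
  "surface G T = topology (\<lambda>U.
     U \<subseteq> surface_points G T \<and>
     openin (top_of_set (graph_points G)) {p \<in> graph_points G. Inl p \<in> U} \<and>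
     (\<forall>W\<in>T. openin (top_of_set (cball 0 1)) {z \<in> cball 0 1. disk_map W z \<in> U}))"

definition torus :: "(complex \<times> complex) topology" where
  "torus = prod_topology (top_of_set (sphere 0 1)) (top_of_set (sphere 0 1))"

definition on_torus :: "'a graph \<Rightarrow> 'a list set \<Rightarrow> bool" where
  "on_torus G T \<longleftrightarrow> surface G T homeomorphic_space torus"

lemma openin_surface:
  "openin (surface G T) U \<longleftrightarrow>
     U \<subseteq> surface_points G T \<and>
     openin (top_of_set (graph_points G)) {p \<in> graph_points G. Inl p \<in> U} \<and>
     (\<forall>W\<in>T. openin (top_of_set (cball 0 1)) {z \<in> cball 0 1. disk_map W z \<in> U})"
proof -
  let ?P = "\<lambda>U. U \<subseteq> surface_points G T \<and>
     openin (top_of_set (graph_points G)) {p \<in> graph_points G. Inl p \<in> U} \<and>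
     (\<forall>W\<in>T. openin (top_of_set (cball 0 1)) {z \<in> cball 0 1. disk_map W z \<in> U})"
  have Int: "{x \<in> A. f x \<in> S \<inter> S'} = {x \<in> A. f x \<in> S} \<inter> {x \<in> A. f x \<in> S'}"
    for A :: "'x set" and f :: "'x \<Rightarrow> 'y" and S S' by blast
  have Un: "{x \<in> A. f x \<in> \<Union>K} = (\<Union>S\<in>K. {x \<in> A. f x \<in> S})"
    for A :: "'x set" and f :: "'x \<Rightarrow> 'y" and K by blast
  have "istopology ?P"
    unfolding istopology_def
  proof (intro conjI[of "\<forall>S S'. ?P S \<longrightarrow> ?P S' \<longrightarrow> ?P (S \<inter> S')"] allI impI)
    fix S S' assume "?P S" "?P S'"
    then show "?P (S \<inter> S')" unfolding Int by blast
  next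
    fix K assume K: "\<forall>S\<in>K. ?P S"
    then show "?P (\<Union>K)" unfolding Un by (auto intro!: openin_Union)
  qed
  then have "openin (topology ?P) = ?P" by (rule topology_inverse')
  then show ?thesis unfolding surface_def by (rule fun_cong)
qed

lemma attaching_map_in_graph_points:
  assumes "closed_walk G W"
  shows "attaching_map W z \<in> graph_points G"
proof -
  define s where "s = real (length W) * Arg2pi z / (2 * pi)"
  have pos: "length W > 0" using assms by (simp add: closed_walk_def)
  have "0 \<le> s" by (simp add: s_def Arg2pi_ge_0)
  moreover have "s < length W"
    using pos Arg2pi_lt_2pi[of z] by (simp add: s_def divide_less_eq)
  ultimately have "nat \<lfloor>s\<rfloor> < length W" by linarith
  then have "{W ! nat \<lfloor>s\<rfloor>, W ! (Suc (nat \<lfloor>s\<rfloor>) mod length W)} \<in> set (walk_edges W)"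
    by (auto simp: walk_edges_def)
  then have "{W ! nat \<lfloor>s\<rfloor>, W ! (Suc (nat \<lfloor>s\<rfloor>) mod length W)} \<in> edges G"
    using assms by (auto simp: closed_walk_def)
  moreover have "0 \<le> frac s" "frac s \<le> 1" using frac_lt_1[of s] by auto
  ultimately show ?thesis
    unfolding attaching_map_def graph_points_def Let_def s_def[symmetric] by blast
qed

lemma topspace_surface:
  assumes "is_map G T"
  shows "topspace (surface G T) = surface_points G T"
proof
  show "topspace (surface G T) \<subseteq> surface_points G T"
    using openin_surface openin_topspace by blast
  have "Inl p \<in> surface_points G T" if "p \<in> graph_points G" for p
    using that by (simp add: surface_points_def)
  then have 1: "{p \<in> graph_points G. Inl p \<in> surface_points G T} = graph_points G"
    by blast
  have "disk_map W z \<in> surface_points G T" if "W \<in> T" for W z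
    using that assms attaching_map_in_graph_points[of G W z]
    by (auto simp: disk_map_def surface_points_def is_map_def)
  then have 2: "{z \<in> cball 0 1. disk_map W z \<in> surface_points G T} = cball 0 1" if "W \<in> T" for W
    using that by blast
  have "openin (surface G T) (surface_points G T)"
    unfolding openin_surface using 1 2 by simp
  then show "surface_points G T \<subseteq> topspace (surface G T)"
    by (rule openin_subset)
qed


section \<open>Dihedral groups and Cayley graphs\<close>

definition cayley_graph :: "('g, 'm) monoid_scheme \<Rightarrow> 'g set \<Rightarrow> 'g graph" where
  "cayley_graph G S =
     (carrier G,
      {{g, h} | g h. g \<in> carrier G \<and> h \<in> carrier G \<and> g \<otimes>\<^bsub>G\<^esub> inv\<^bsub>G\<^esub> h \<in> S})"

text \<open>The pair \<open>(i, b)\<close> stands for \<open>\<rho>\<^sup>i\<close> if \<open>b\<close> is false and for \<open>\<rho>\<^sup>i \<tau>\<close> if \<open>b\<close> is true. The lemmas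
  below show that this is a group of order \<open>2n\<close> that is generated by \<open>\<rho>\<close> and \<open>\<tau>\<close> subject to the
  defining relations \<open>\<rho>\<^sup>n\<close>, \<open>\<tau>\<^sup>2\<close>, \<open>(\<rho>\<tau>)\<^sup>2\<close>, and is thus the group with this presentation.\<close>

definition dihedral :: "nat \<Rightarrow> (int \<times> bool) monoid" where
  "dihedral n =
     \<lparr>carrier = carrier (integer_mod_group n) \<times> UNIV,
      mult = (\<lambda>(i, a) (j, b). ((if a then i - j else i + j) mod int n, a \<noteq> b)),
      one = (0, False)\<rparr>"

definition dih_rho :: "nat \<Rightarrow> int \<times> bool" where "dih_rho n = (1 mod int n, False)"
definition dih_tau :: "nat \<Rightarrow> int \<times> bool" where "dih_tau n = (0, True)"

definition dih_refl :: "nat \<Rightarrow> nat \<Rightarrow> int \<times> bool" where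
  "dih_refl n i = dih_rho n [^]\<^bsub>dihedral n\<^esub> i \<otimes>\<^bsub>dihedral n\<^esub> dih_tau n"

lemma carrier_dihedral:
  "n > 0 \<Longrightarrow> carrier (dihedral n) = {0..<int n} \<times> UNIV"
  by (simp add: dihedral_def carrier_integer_mod_group)

lemma order_dihedral: "n > 0 \<Longrightarrow> order (dihedral n) = 2 * n"
  by (simp add: order_def carrier_dihedral card_cartesian_product)

lemma group_dihedral:
  assumes "n > 0"
  shows "group (dihedral n)"
proof (rule groupI)
  fix x assume "x \<in> carrier (dihedral n)"
  then obtain i b where x: "x = (i, b)" and i: "0 \<le> i" "i < int n"
    using assms by (auto simp: carrier_dihedral)
  show "\<one>\<^bsub>dihedral n\<^esub> \<otimes>\<^bsub>dihedral n\<^esub> x = x"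
    using i by (simp add: x dihedral_def)
  have "(if b then i else - i mod int n, b) \<in> carrier (dihedral n)"
    using assms i by (auto simp: carrier_dihedral)
  moreover have "(if b then i else - i mod int n, b) \<otimes>\<^bsub>dihedral n\<^esub> x = \<one>\<^bsub>dihedral n\<^esub>"
    by (simp add: x dihedral_def mod_simps)
  ultimately show "\<exists>y\<in>carrier (dihedral n). y \<otimes>\<^bsub>dihedral n\<^esub> x = \<one>\<^bsub>dihedral n\<^esub>"
    by blast
next
  fix x y z
  show "x \<otimes>\<^bsub>dihedral n\<^esub> y \<otimes>\<^bsub>dihedral n\<^esub> z = x \<otimes>\<^bsub>dihedral n\<^esub> (y \<otimes>\<^bsub>dihedral n\<^esub> z)"
    by (cases x; cases y; cases z) (auto simp: dihedral_def mod_simps algebra_simps)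
qed (use assms in \<open>auto simp: dihedral_def carrier_integer_mod_group\<close>)

lemma dih_rho_closed: "n > 0 \<Longrightarrow> dih_rho n \<in> carrier (dihedral n)"
  and dih_tau_closed: "n > 0 \<Longrightarrow> dih_tau n \<in> carrier (dihedral n)"
  by (auto simp: dih_rho_def dih_tau_def carrier_dihedral)

lemma dih_rho_pow: "dih_rho n [^]\<^bsub>dihedral n\<^esub> i = (int i mod int n, False)"
proof (induction i)
  case 0
  then show ?case by (simp add: nat_pow_def dihedral_def)
next
  case (Suc i)
  then show ?case by (simp add: nat_pow_def) (simp add: dihedral_def dih_rho_def mod_simps add.commute)
qed

lemma dih_refl_eq: "dih_refl n i = (int i mod int n, True)"
  unfolding dih_refl_def dih_rho_pow by (simp add: dihedral_def dih_tau_def)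

lemma dihedral_relations:
  shows "dih_rho n [^]\<^bsub>dihedral n\<^esub> n = \<one>\<^bsub>dihedral n\<^esub>"
    and "dih_tau n [^]\<^bsub>dihedral n\<^esub> (2::nat) = \<one>\<^bsub>dihedral n\<^esub>"
    and "(dih_rho n \<otimes>\<^bsub>dihedral n\<^esub> dih_tau n) [^]\<^bsub>dihedral n\<^esub> (2::nat) = \<one>\<^bsub>dihedral n\<^esub>"
  unfolding dih_rho_pow
  by (simp_all add: nat_pow_def numeral_2_eq_2) (simp_all add: dihedral_def dih_rho_def dih_tau_def)

lemma dihedral_generated:
  assumes "n > 0"
  shows "generate (dihedral n) {dih_rho n, dih_tau n} = carrier (dihedral n)"
proof
  interpret group "dihedral n" by (rule group_dihedral[OF assms])
  let ?H = "generate (dihedral n) {dih_rho n, dih_tau n}"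
  show "?H \<subseteq> carrier (dihedral n)"
    using generate_incl dih_rho_closed dih_tau_closed assms by simp
  have rho: "dih_rho n [^]\<^bsub>dihedral n\<^esub> (i::nat) \<in> ?H" for i
    by (induction i) (auto intro: generate.intros)
  show "carrier (dihedral n) \<subseteq> ?H"
  proof
    fix x assume "x \<in> carrier (dihedral n)"
    then obtain i b where x: "x = (i, b)" "0 \<le> i" "i < int n"
      using assms by (auto simp: carrier_dihedral)
    have "dih_refl n (nat i) \<in> ?H"
      unfolding dih_refl_def by (intro generate.eng rho) (auto intro: generate.intros)
    with x rho[of "nat i"] show "x \<in> ?H"
      by (cases b) (auto simp: dih_rho_pow dih_refl_eq)
  qed
qed

definition Psi_graph :: "nat \<Rightarrow> (int \<times> bool) graph" where
  "Psi_graph n = cayley_graph (dihedral n) {dih_refl n 0, dih_refl n 1, dih_refl n 3}"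

definition Sigma_graph :: "nat \<Rightarrow> ((int \<times> bool) \<times> int) graph" where
  "Sigma_graph n = cayley_graph (dihedral n \<times>\<times> integer_mod_group 3)
     {(dih_refl n 1, 0), (dih_refl n 0, 1), (dih_refl n 0, 2)}"

definition Delta_graph :: "nat \<Rightarrow> (int \<times> bool) graph" where
  "Delta_graph n = cayley_graph (dihedral (3 * n))
     {dih_refl (3 * n) 0, dih_refl (3 * n) (3 div gcd 3 n), dih_refl (3 * n) n}"

end

theory Submission
  imports Defs "HOL-Complex_Analysis.Complex_Analysis"
begin

text \<open>The disk of a face lifts to the universal cover of the torus, the complex plane, where the
  winding number of its boundary is 1 or -1. If two faces share an edge and their lifts are chosen
  to agree on it, the closed curve obtained by removing the edge from the two boundaries does not
  separate the two disks, so comparing winding numbers shows that the signs orient the map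
  coherently.

  The darts of the oriented map then carry a transitive action of the group of rotations of the
  honeycomb in which no proper rotation has a fixed point. Hence the stabilizer of a dart is a
  lattice \<open>L\<close> of translations and the skeleton is the quotient of the honeycomb by \<open>L\<close>: a bipartite
  graph on two copies of \<open>\<int>\<^sup>2 / L\<close> with connection set \<open>{a, b, c}\<close>. A 6-cycle that is not a
  hexagon gives, up to a permutation of \<open>a\<close>, \<open>b\<close>, \<open>c\<close>, a relation \<open>3 a = 3 c\<close> or \<open>3 a = 2 c + b\<close>
  modulo \<open>L\<close>. The second relation makes the quotient group cyclic and leads to \<open>\<Psi>\<^sub>n\<close>. Under the first
  one \<open>a - c\<close> has order 3; if \<open>n\<close> is the order of \<open>b - c\<close> modulo \<open>a - c\<close>, so that
  \<open>n (b - c) = e (a - c)\<close>, the graph is \<open>\<Sigma>\<^sub>n\<close> for \<open>e = - n\<close> modulo 3 and \<open>\<Delta>\<^sub>n\<close> otherwise, where \<open>\<Delta>\<^sub>3\<close> is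
  the graph \<open>\<Psi>\<^sub>9\<close>.\<close>

section \<open>The winding number of the boundary of a disk\<close>

text \<open>The hypothesis on the surface is a bare homeomorphism from a quotient space to the
  torus, so an orientation has to be read off from continuous disks. Girth 6 turns every face walk
  into a cycle, hence every closed disk is embedded and its lift is bounded by a Jordan curve, whose
  winding number inside is a sign. Signs are compared only for two faces with a common edge. There
  one translation of one lift is enough, and no lift of the whole map is constructed. From the signs
  on, the argument is combinatorial. The rotations of the honeycomb are generated by f and s with
  f^6 = s^2 = (f s)^3 = 1, and each proper rotation is about the centre of a face, a vertex or the
  midpoint of an edge. A dart fixed by it would be fixed by turning a face, by turning the darts at
  a vertex or by reversing an edge, which the distinct corners of the faces exclude.\<close>

text \<open>The direction \<open>\<epsilon>\<close> of the loop is 1 or -1.\<close>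

definition rim :: "(complex \<Rightarrow> complex) \<Rightarrow> real \<Rightarrow> real \<Rightarrow> real \<Rightarrow> complex" where
  "rim f \<theta> \<epsilon> t = f (cis (\<theta> + \<epsilon> * (2 * pi * t)))"

lemma cis_eq_int_iff: "cis a = cis b \<longleftrightarrow> (\<exists>n::int. a = b + 2 * pi * n)"
proof -
  have "cis a = cis b \<longleftrightarrow> sin a = sin b \<and> cos a = cos b"
    by (auto simp: complex_eq_iff)
  then show ?thesis using sin_cos_eq_iff[of a b] by (simp add: mult_ac)
qed

lemma cis_unit_inj:
  assumes "cis (\<theta> + \<epsilon> * (2 * pi * t)) = cis (\<theta> + \<epsilon> * (2 * pi * u))"
    and "\<epsilon> \<in> {1, -1}" "t \<in> {0..1}" "u \<in> {0..1}"
  shows "t = u \<or> t = 0 \<and> u = 1 \<or> t = 1 \<and> u = 0"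
proof -
  obtain n :: int where "\<theta> + \<epsilon> * (2 * pi * t) = \<theta> + \<epsilon> * (2 * pi * u) + 2 * pi * n"
    using assms(1) unfolding cis_eq_int_iff by blast
  then have "2 * pi * (\<epsilon> * t) = 2 * pi * (\<epsilon> * u + n)" by (simp add: algebra_simps)
  then have n: "\<epsilon> * t = \<epsilon> * u + n" using pi_gt_zero by simp
  then have "\<bar>real_of_int n\<bar> \<le> 1" using assms by auto
  then have "n = -1 \<or> n = 0 \<or> n = 1" by linarith
  then show ?thesis using n assms(2-) by auto
qed

lemma rim_loop: "\<epsilon> \<in> {1, -1} \<Longrightarrow> pathfinish (rim f \<theta> \<epsilon>) = pathstart (rim f \<theta> \<epsilon>)"
  unfolding pathfinish_def pathstart_def rim_def
  by (rule arg_cong[of _ _ f]) (auto simp: complex_eq_iff cos_diff sin_diff)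

lemma path_rim:
  assumes "continuous_on (cball 0 1) f"
  shows "path (rim f \<theta> \<epsilon>)"
  unfolding path_def rim_def
  by (rule continuous_on_compose2[OF assms]) (auto intro!: continuous_intros)

lemma path_image_rim: "path_image (rim f \<theta> \<epsilon>) \<subseteq> f ` sphere 0 1"
  by (auto simp: path_image_def rim_def)

lemma simple_path_rim:
  assumes "continuous_on (cball 0 1) f" "inj_on f (cball 0 1)" "\<epsilon> \<in> {1, -1}"
  shows "simple_path (rim f \<theta> \<epsilon>)"
  unfolding simple_path_def loop_free_def
proof (intro conjI ballI impI path_rim assms(1))
  fix t u :: real assume tu: "t \<in> {0..1}" "u \<in> {0..1}" and eq: "rim f \<theta> \<epsilon> t = rim f \<theta> \<epsilon> u"
  have "cis (\<theta> + \<epsilon> * (2 * pi * t)) = cis (\<theta> + \<epsilon> * (2 * pi * u))"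
    using inj_onD[OF assms(2) eq[unfolded rim_def]] by simp
  from cis_unit_inj[OF this assms(3) tu] show "t = u \<or> t = 0 \<and> u = 1 \<or> t = 1 \<and> u = 0" .
qed

lemma path_image_rim_eq:
  assumes "\<epsilon> \<in> {1, -1}"
  shows "path_image (rim f \<theta> \<epsilon>) = f ` sphere 0 1"
proof
  show "f ` sphere 0 1 \<subseteq> path_image (rim f \<theta> \<epsilon>)"
  proof
    fix y assume "y \<in> f ` sphere 0 1"
    then obtain z where z: "norm z = 1" "y = f z" by auto
    define s where "s = (Arg z - \<theta>) / (2 * pi * \<epsilon>)"
    have e: "\<epsilon> * \<epsilon> = 1" "\<epsilon> \<noteq> 0" using assms by auto
    have "cis (\<theta> + \<epsilon> * (2 * pi * frac s)) = cis (\<theta> + \<epsilon> * (2 * pi * s))"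
      unfolding cis_eq_int_iff
      by (rule exI[of _ "if \<epsilon> = 1 then - \<lfloor>s\<rfloor> else \<lfloor>s\<rfloor>"])
         (use assms in \<open>auto simp: frac_def algebra_simps\<close>)
    also have "\<theta> + \<epsilon> * (2 * pi * s) = Arg z" using e by (simp add: s_def)
    also have "cis (Arg z) = z" using z cis_Arg[of z] by (cases "z = 0") (auto simp: sgn_div_norm)
    finally have "rim f \<theta> \<epsilon> (frac s) = y" by (simp add: rim_def z)
    moreover have "frac s \<in> {0..1}" using frac_lt_1[of s] by (auto intro: less_imp_le)
    ultimately show "y \<in> path_image (rim f \<theta> \<epsilon>)" unfolding path_image_def by blast
  qed
qed (rule path_image_rim)

text \<open>The disk itself contracts the loop: shrinking the radius is a homotopy of loops inside
  the image of the closed disk, which avoids z.\<close>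

lemma winding_number_rim_outside:
  assumes f: "continuous_on (cball 0 1) f" and z: "z \<notin> f ` cball 0 1" and e: "\<epsilon> \<in> {1, -1}"
  shows "winding_number (rim f \<theta> \<epsilon>) z = 0"
proof -
  have "homotopic_loops (- {z}) (rim f \<theta> \<epsilon>) (\<lambda>t. f 0)"
    unfolding homotopic_loops
  proof (intro exI conjI ballI)
    let ?h = "\<lambda>x. f (complex_of_real (1 - fst x) * cis (\<theta> + \<epsilon> * (2 * pi * snd x)))"
    have in_cball: "norm (complex_of_real (1 - s) * cis a) \<le> 1" if "0 \<le> s" "s \<le> 1" for s a :: real
      unfolding norm_mult norm_of_real using that by simp
    show "continuous_on ({0..1} \<times> {0..1}) ?h"
      by (rule continuous_on_compose2[OF f])
        (auto intro!: continuous_intros in_cball simp del: of_real_diff)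
    show "?h \<in> {0..1} \<times> {0..1} \<rightarrow> - {z}"
      using z in_cball by (auto simp del: of_real_diff)
    show "pathfinish (?h \<circ> Pair t) = pathstart (?h \<circ> Pair t)" if "t \<in> {0..1}" for t
      using rim_loop[OF e, of "\<lambda>w. f (complex_of_real (1 - t) * w)" \<theta>]
      by (simp add: pathfinish_def pathstart_def rim_def)
  qed (auto simp: rim_def)
  then have "winding_number (rim f \<theta> \<epsilon>) z = winding_number (\<lambda>t. f 0) z"
    by (rule winding_number_homotopic_loops)
  also have "\<dots> = 0" using z by (intro winding_number_zero_const) auto
  finally show ?thesis .
qed

text \<open>Sliding the base point along the circle is a homotopy of loops on the image of the
  circle, and \<epsilon> = -1 reverses the loop.\<close>

lemma winding_number_rim_eq:
  assumes f: "continuous_on (cball 0 1) f" and z: "z \<notin> f ` sphere 0 1" and e: "\<epsilon> \<in> {1, -1}"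
  shows "winding_number (rim f \<theta> \<epsilon>) z = of_real \<epsilon> * winding_number (rim f 0 1) z"
proof -
  have "homotopic_loops (- {z}) (rim f 0 1) (rim f \<theta> 1)"
    unfolding homotopic_loops
  proof (intro exI conjI ballI)
    let ?h = "\<lambda>x. f (cis (fst x * \<theta> + 2 * pi * snd x))"
    show "continuous_on ({0..1} \<times> {0..1}) ?h"
      by (rule continuous_on_compose2[OF f]) (auto intro!: continuous_intros)
    show "?h \<in> {0..1} \<times> {0..1} \<rightarrow> - {z}" using z by auto
    show "pathfinish (?h \<circ> Pair t) = pathstart (?h \<circ> Pair t)" if "t \<in> {0..1}" for t
      using rim_loop[of 1 f "t * \<theta>"]
      by (simp add: pathfinish_def pathstart_def rim_def)
  qed (auto simp: rim_def)
  then have 1: "winding_number (rim f \<theta> 1) z = winding_number (rim f 0 1) z"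
    using winding_number_homotopic_loops by metis
  have "reversepath (rim f \<theta> 1) = rim f \<theta> (-1)"
  proof
    fix t
    have "cis (\<theta> + 2 * pi * (1 - t)) = cis (\<theta> - 2 * pi * t)"
      unfolding cis_eq_int_iff by (rule exI[of _ 1]) (simp add: algebra_simps)
    then show "reversepath (rim f \<theta> 1) t = rim f \<theta> (-1) t"
      by (simp add: reversepath_def rim_def algebra_simps)
  qed
  moreover have "z \<notin> path_image (rim f \<theta> 1)" using z path_image_rim by blast
  ultimately have "winding_number (rim f \<theta> (-1)) z = - winding_number (rim f \<theta> 1) z"
    using winding_number_reversepath[OF path_rim[OF f]] by metis
  with 1 e show ?thesis by auto
qed

text \<open>Points inside the Jordan curve have nonzero winding number, so by
  \<open>winding_number_rim_outside\<close> they lie in the image of the disk. The image of the open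
  disk is connected, misses the curve and meets its inside, so it lies wholly inside, where the
  winding number is constant and equal to 1 or -1.\<close>

lemma winding_number_rim_inside:
  assumes f: "continuous_on (cball 0 1) f" and inj: "inj_on f (cball 0 1)"
  obtains "\<And>z. z \<in> f ` ball 0 1 \<Longrightarrow> winding_number (rim f 0 1) z = 1"
        | "\<And>z. z \<in> f ` ball 0 1 \<Longrightarrow> winding_number (rim f 0 1) z = -1"
proof -
  let ?c = "rim f 0 1"
  have simple: "simple_path ?c" and loop: "pathfinish ?c = pathstart ?c" and image: "path_image ?c = f ` sphere 0 1"
    using simple_path_rim[OF assms, of 1 0] rim_loop[of 1 f 0] path_image_rim_eq[of 1 f 0] by auto
  have J: "inside (path_image ?c) \<noteq> {}" "open (inside (path_image ?c))" "open (outside (path_image ?c))"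
    "inside (path_image ?c) \<inter> outside (path_image ?c) = {}"
    "inside (path_image ?c) \<union> outside (path_image ?c) = - path_image ?c"
    using Jordan_inside_outside[OF simple loop] by simp_all
  have inside_f: "inside (path_image ?c) \<subseteq> f ` ball 0 1"
  proof
    fix w assume w: "w \<in> inside (path_image ?c)"
    then have "winding_number ?c w \<noteq> 0"
      by (metis norm_eq_zero simple simple_closed_path_norm_winding_number_inside zero_neq_one)
    then have "w \<in> f ` cball 0 1" using winding_number_rim_outside[OF f] by blast
    moreover have "w \<notin> f ` sphere 0 1"
      using w image inside_no_overlap[of "path_image ?c"] by blast
    ultimately show "w \<in> f ` ball 0 1" by (fastforce simp: less_le)
  qed
  have disj: "f ` ball 0 1 \<inter> path_image ?c = {}"
    using inj_on_image_Int[OF inj, of "ball 0 1" "sphere 0 1"] unfolding image by auto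
  have "connected (f ` ball 0 1)"
    by (intro connected_continuous_image continuous_on_subset[OF f] convex_connected convex_ball
        ball_subset_cball)
  moreover have "f ` ball 0 1 \<inter> inside (path_image ?c) \<noteq> {}"
    using J(1) inside_f by auto
  moreover have "f ` ball 0 1 \<subseteq> inside (path_image ?c) \<union> outside (path_image ?c)"
    using disj J(5) by auto
  ultimately have "f ` ball 0 1 \<inter> outside (path_image ?c) = {}"
    using J connectedD[of "f ` ball 0 1" "inside (path_image ?c)" "outside (path_image ?c)"] by auto
  then have "f ` ball 0 1 \<subseteq> inside (path_image ?c)"
    using disj J(5) by blast
  then show thesis
    using simple_closed_path_winding_number_inside[OF simple] that by (metis subsetD)
qed

text \<open>Needed for connectedness: an open disk stays connected when one boundary point is added,
  and two neighbouring disks can then be joined at a point of their common arc.\<close>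

lemma convex_ball_insert_sphere:
  fixes x :: "'a::euclidean_space"
  assumes "norm x = 1"
  shows "convex (insert x (ball 0 1))"
proof (rule convexI)
  fix y z :: 'a and u v :: real
  assume *: "y \<in> insert x (ball 0 1)" "z \<in> insert x (ball 0 1)" "0 \<le> u" "0 \<le> v" "u + v = 1"
  show "u *\<^sub>R y + v *\<^sub>R z \<in> insert x (ball 0 1)"
  proof (cases "u = 0 \<or> v = 0 \<or> y = x \<and> z = x")
    case True
    then show ?thesis using * by (auto simp: scaleR_left_distrib[symmetric])
  next
    case False
    then have "norm y \<le> 1" "norm z \<le> 1" "norm y < 1 \<or> norm z < 1" "u > 0" "v > 0"
      using * assms by auto
    moreover from this have "u * norm y \<le> u" "v * norm z \<le> v" "norm y < 1 \<Longrightarrow> u * norm y < u"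
      "norm z < 1 \<Longrightarrow> v * norm z < v"
      by (simp_all add: mult_left_le)
    ultimately have "u * norm y + v * norm z < u + v" by linarith
    then have "norm (u *\<^sub>R y + v *\<^sub>R z) < 1"
      using norm_triangle_ineq[of "u *\<^sub>R y" "v *\<^sub>R z"] * by auto
    then show ?thesis by simp
  qed
qed

text \<open>Removing the common arc from both loops leaves a closed curve that does not separate the
  two disks. Its winding number is the difference of those of the loops, so it is that of the
  first loop on the first disk and minus that of the second loop on the second disk.\<close>

lemma winding_number_rim_common_arc:
  assumes f: "continuous_on (cball 0 1) f" "inj_on f (cball 0 1)"
    and g: "continuous_on (cball 0 1) g" "inj_on g (cball 0 1)"
    and disj: "f ` ball 0 1 \<inter> g ` cball 0 1 = {}" "f ` cball 0 1 \<inter> g ` ball 0 1 = {}"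
    and \<epsilon>: "\<epsilon>\<^sub>1 \<in> {1, -1}" "\<epsilon>\<^sub>2 \<in> {1, -1}"
    and \<alpha>: "0 < \<alpha>" "\<alpha> < 1"
    and common: "\<And>t. t \<in> {0..\<alpha>} \<Longrightarrow> rim f \<theta>\<^sub>1 \<epsilon>\<^sub>1 t = rim g \<theta>\<^sub>2 \<epsilon>\<^sub>2 t"
    and z: "z\<^sub>1 \<in> f ` ball 0 1" "z\<^sub>2 \<in> g ` ball 0 1"
  shows "of_real \<epsilon>\<^sub>1 * winding_number (rim f 0 1) z\<^sub>1 = - of_real \<epsilon>\<^sub>2 * winding_number (rim g 0 1) z\<^sub>2"
proof -
  define c\<^sub>1 where "c\<^sub>1 = rim f \<theta>\<^sub>1 \<epsilon>\<^sub>1"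
  define c\<^sub>2 where "c\<^sub>2 = rim g \<theta>\<^sub>2 \<epsilon>\<^sub>2"
  \<comment> \<open>The rest of the first loop followed by the reversed rest of the second; the
    common arc [0, \<alpha>] is left out.\<close>
  define q where "q = subpath \<alpha> 1 c\<^sub>1 +++ reversepath (subpath \<alpha> 1 c\<^sub>2)"
  have c: "path c\<^sub>1" "path c\<^sub>2" "c\<^sub>1 1 = c\<^sub>1 0" "c\<^sub>2 1 = c\<^sub>2 0" "path_image c\<^sub>1 \<subseteq> f ` sphere 0 1"
    "path_image c\<^sub>2 \<subseteq> g ` sphere 0 1"
    using path_rim f g rim_loop[OF \<epsilon>(1)] rim_loop[OF \<epsilon>(2)] path_image_rim
    unfolding c\<^sub>1_def c\<^sub>2_def pathstart_def pathfinish_def by auto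
  have common: "c\<^sub>1 t = c\<^sub>2 t" if "0 \<le> t" "t \<le> \<alpha>" for t
    using common that by (simp add: c\<^sub>1_def c\<^sub>2_def)
  have sub: "f ` sphere 0 1 \<subseteq> f ` cball 0 1" "g ` sphere 0 1 \<subseteq> g ` cball 0 1" by auto
  have own: "f ` ball 0 1 \<inter> f ` sphere 0 1 = {}" "g ` ball 0 1 \<inter> g ` sphere 0 1 = {}"
    using inj_on_image_Int[OF f(2), of "ball 0 1" "sphere 0 1"]
      inj_on_image_Int[OF g(2), of "ball 0 1" "sphere 0 1"] by auto
  have q: "path q" "pathfinish q = pathstart q"
    using c \<alpha> common[of \<alpha>] common[of 0] by (auto simp: q_def)
  have wind: "winding_number q w = winding_number c\<^sub>1 w - winding_number c\<^sub>2 w"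
    if w: "w \<notin> f ` sphere 0 1" "w \<notin> g ` sphere 0 1" for w
  proof -
    have w': "w \<notin> path_image c\<^sub>1" "w \<notin> path_image c\<^sub>2" using w c by auto
    then have w'': "w \<notin> path_image (subpath \<alpha> 1 c\<^sub>1)" "w \<notin> path_image (subpath \<alpha> 1 c\<^sub>2)"
      using \<alpha> path_image_subpath_subset[of \<alpha> 1] by auto
    have "winding_number q w
        = winding_number (subpath \<alpha> 1 c\<^sub>1) w + winding_number (reversepath (subpath \<alpha> 1 c\<^sub>2)) w"
      unfolding q_def using w'' c \<alpha> common[of \<alpha>] common[of 0]
      by (intro winding_number_join) auto
    also have "winding_number (reversepath (subpath \<alpha> 1 c\<^sub>2)) w = - winding_number (subpath \<alpha> 1 c\<^sub>2) w"
      using w'' c \<alpha> by (intro winding_number_reversepath) auto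
    also have "winding_number (subpath \<alpha> 1 c\<^sub>1) w = winding_number c\<^sub>1 w - winding_number (subpath 0 \<alpha> c\<^sub>1) w"
      using winding_number_subpath_combine[OF c(1) w'(1), of 0 \<alpha> 1] \<alpha> by (simp add: algebra_simps)
    also have "winding_number (subpath \<alpha> 1 c\<^sub>2) w = winding_number c\<^sub>2 w - winding_number (subpath 0 \<alpha> c\<^sub>2) w"
      using winding_number_subpath_combine[OF c(2) w'(2), of 0 \<alpha> 1] \<alpha> by (simp add: algebra_simps)
    \<comment> \<open>The contributions of the common arc are equal and cancel in the
      difference.\<close>
    also have "winding_number (subpath 0 \<alpha> c\<^sub>1) w = winding_number (subpath 0 \<alpha> c\<^sub>2) w"
      using \<alpha> by (intro winding_number_cong) (auto simp: subpath_def mult_left_le intro!: common)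
    finally show ?thesis by simp
  qed
  \<comment> \<open>The midpoint of the removed arc lies on the boundary of both disks but off
    \<open>q\<close>, so it joins the two open disks to one connected set in the complement of
    \<open>q\<close>.\<close>
  define m where "m = c\<^sub>1 (\<alpha> / 2)"
  have m2: "m = c\<^sub>2 (\<alpha> / 2)" unfolding m_def using \<alpha> by (intro common) auto
  define S where "S = insert m (f ` ball 0 1) \<union> insert m (g ` ball 0 1)"
  have conn: "connected (insert (rim h \<theta> \<epsilon> (\<alpha> / 2)) (h ` ball 0 1))"
    if "continuous_on (cball 0 1) h" for h \<theta> \<epsilon>
  proof -
    have "connected (h ` insert (cis (\<theta> + \<epsilon> * (2 * pi * (\<alpha> / 2)))) (ball 0 1))"
      by (intro connected_continuous_image continuous_on_subset[OF that] convex_connected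
          convex_ball_insert_sphere) auto
    then show ?thesis by (simp add: rim_def)
  qed
  have "connected S"
    unfolding S_def using conn[OF f(1), of \<theta>\<^sub>1 \<epsilon>\<^sub>1] conn[OF g(1), of \<theta>\<^sub>2 \<epsilon>\<^sub>2]
    by (intro connected_Un) (simp_all add: m_def[unfolded c\<^sub>1_def] m2[unfolded c\<^sub>2_def] flip: m_def[unfolded c\<^sub>1_def] m2[unfolded c\<^sub>2_def])
  moreover have "S \<inter> path_image q = {}"
  proof -
    have image_q: "path_image q \<subseteq> c\<^sub>1 ` {\<alpha>..1} \<union> c\<^sub>2 ` {\<alpha>..1}"
      unfolding q_def using \<alpha> by (intro order.trans[OF path_image_join_subset]) (auto simp: path_image_subpath)
    have "m \<notin> rim h \<theta> \<epsilon> ` {\<alpha>..1}"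
      if h: "continuous_on (cball 0 1) h" "inj_on h (cball 0 1)" "\<epsilon> \<in> {1, -1}" "m = rim h \<theta> \<epsilon> (\<alpha> / 2)"
      for h \<theta> \<epsilon>
    proof
      assume "m \<in> rim h \<theta> \<epsilon> ` {\<alpha>..1}"
      then obtain t where t: "t \<in> {\<alpha>..1}" "rim h \<theta> \<epsilon> (\<alpha> / 2) = rim h \<theta> \<epsilon> t" using h by auto
      have "loop_free (rim h \<theta> \<epsilon>)" using simple_path_rim[OF h(1-3)] by (simp add: simple_path_def)
      from this[unfolded loop_free_def, rule_format, of "\<alpha> / 2" t] t \<alpha>
      have "\<alpha> / 2 = t \<or> \<alpha> / 2 = 0 \<and> t = 1 \<or> \<alpha> / 2 = 1 \<and> t = 0" by simp
      then show False using t \<alpha> by auto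
    qed
    from this[OF f \<epsilon>(1), of \<theta>\<^sub>1] this[OF g \<epsilon>(2), of \<theta>\<^sub>2] m2
    have "m \<notin> path_image q" using image_q by (auto simp: m_def c\<^sub>1_def c\<^sub>2_def)
    moreover have "f ` ball 0 1 \<inter> path_image c\<^sub>1 = {}" "g ` ball 0 1 \<inter> path_image c\<^sub>2 = {}"
      using c(5,6) own by fast+
    moreover have "f ` ball 0 1 \<inter> path_image c\<^sub>2 = {}" "g ` ball 0 1 \<inter> path_image c\<^sub>1 = {}"
      using c(5,6) disj sub by fast+
    moreover have "path_image q \<subseteq> path_image c\<^sub>1 \<union> path_image c\<^sub>2"
      using image_q image_mono[of "{\<alpha>..1}" "{0..1}" c\<^sub>1] image_mono[of "{\<alpha>..1}" "{0..1}" c\<^sub>2] \<alpha>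
      unfolding path_image_def[of c\<^sub>1] path_image_def[of c\<^sub>2] by auto
    ultimately show ?thesis unfolding S_def by blast
  qed
  moreover have "z\<^sub>1 \<in> S" "z\<^sub>2 \<in> S" using z by (auto simp: S_def)
  ultimately have "winding_number q z\<^sub>1 = winding_number q z\<^sub>2"
    using winding_number_eq[OF q, of z\<^sub>1 S z\<^sub>2] by blast
  moreover have notin: "z\<^sub>1 \<notin> f ` sphere 0 1" "z\<^sub>1 \<notin> g ` cball 0 1" "z\<^sub>2 \<notin> f ` cball 0 1" "z\<^sub>2 \<notin> g ` sphere 0 1"
    using z disj own by blast+
  moreover have "winding_number c\<^sub>1 z\<^sub>2 = 0" "winding_number c\<^sub>2 z\<^sub>1 = 0"
    unfolding c\<^sub>1_def c\<^sub>2_def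
    using winding_number_rim_outside[OF f(1) notin(3) \<epsilon>(1)] winding_number_rim_outside[OF g(1) notin(2) \<epsilon>(2)] by auto
  moreover have "z\<^sub>1 \<notin> g ` sphere 0 1" "z\<^sub>2 \<notin> f ` sphere 0 1"
    using notin(2,3) sub by fast+
  ultimately have "winding_number c\<^sub>1 z\<^sub>1 = - winding_number c\<^sub>2 z\<^sub>2"
    using wind[of z\<^sub>1] wind[of z\<^sub>2] by (metis diff_0 diff_zero)
  then show ?thesis
    unfolding c\<^sub>1_def c\<^sub>2_def
    using winding_number_rim_eq[OF f(1) notin(1) \<epsilon>(1)] winding_number_rim_eq[OF g(1) notin(4) \<epsilon>(2)] by simp
qed

section \<open>Maps on the torus are orientable\<close>

lemma continuous_map_disk_map:
  assumes "is_map G T" "W \<in> T"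
  shows "continuous_map (top_of_set (cball 0 1)) (surface G T) (disk_map W)"
  unfolding continuous_map_def
proof (intro conjI allI impI)
  show "disk_map W \<in> topspace (top_of_set (cball 0 1)) \<rightarrow> topspace (surface G T)"
    using assms attaching_map_in_graph_points[of G W]
    by (auto simp: topspace_surface disk_map_def surface_points_def is_map_def)
  show "openin (top_of_set (cball 0 1)) {x \<in> topspace (top_of_set (cball 0 1)). disk_map W x \<in> U}"
    if "openin (surface G T) U" for U
    using that assms(2) unfolding openin_surface by auto
qed

text \<open>For t < 1 the floor in \<open>attaching_map\<close> selects edge i; the far end of an
  edge is already handled as the start of the next one.\<close>

lemma attaching_map_cis:
  fixes t :: real
  assumes "i < length W" "0 \<le> t" "t < 1"
  shows "attaching_map W (cis (2 * pi * (i + t) / length W))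
    = edge_point (W ! i) (W ! (Suc i mod length W)) t"
proof -
  have "real i + t < length W" using assms by linarith
  then have "Arg2pi (cis (2 * pi * (i + t) / length W)) = 2 * pi * (i + t) / length W"
    using assms Arg2pi_exp[of "\<i> * complex_of_real (2 * pi * (i + t) / length W)"]
    by (simp add: cis_conv_exp divide_less_eq)
  moreover have "real (length W) \<noteq> 0" using assms by auto
  ultimately have *: "length W * Arg2pi (cis (2 * pi * (i + t) / length W)) / (2 * pi) = i + t"
    by simp
  have "\<lfloor>real i + t\<rfloor> = int i" using assms by linarith
  then have "nat \<lfloor>real i + t\<rfloor> = i" "frac (real i + t) = t" by (auto simp: frac_def)
  with * show ?thesis unfolding attaching_map_def by (simp only: Let_def)
qed

lemma sphere_eq_cis:
  assumes "norm z = 1" "L > 0"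
  obtains i :: nat and t :: real where "i < L" "0 \<le> t" "t < 1" "z = cis (2 * pi * (i + t) / L)"
proof
  define s where "s = L * Arg2pi z / (2 * pi)"
  have s: "0 \<le> s" "s < L" using assms Arg2pi_ge_0[of z] Arg2pi_lt_2pi[of z]
    by (auto simp: s_def divide_less_eq)
  have "real (nat \<lfloor>s\<rfloor>) + frac s = s" using s by (simp add: frac_def)
  then have "2 * pi * (real (nat \<lfloor>s\<rfloor>) + frac s) / L = Arg2pi z"
    using assms by (simp add: s_def)
  then show "z = cis (2 * pi * (nat \<lfloor>s\<rfloor> + frac s) / L)"
    using Arg2pi_eq[of z] assms by (simp add: cis_conv_exp)
  show "nat \<lfloor>s\<rfloor> < L" using s by linarith
qed (auto simp: frac_lt_1)

lemma edge_point_commute: "edge_point u v t = edge_point v u (1 - t)"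
  by (simp add: edge_point_def add.commute)

lemma Suc_mod_neq: "i < L \<Longrightarrow> L \<ge> 3 \<Longrightarrow> Suc i mod L \<noteq> i"
  "i < L \<Longrightarrow> L \<ge> 3 \<Longrightarrow> Suc (Suc i mod L) mod L \<noteq> i"
  by (auto simp: mod_Suc)

text \<open>Points are compared by their values at the vertices of the cycle. If i and j differ, the
  positive value at the start of each edge forces i to follow j and j to follow i, which is
  impossible on a cycle of length at least 3.\<close>

lemma edge_point_inj:
  assumes "distinct W" "length W \<ge> 3" "i < length W" "j < length W" "0 \<le> t" "t < 1" "0 \<le> s" "s < 1"
    and eq: "edge_point (W ! i) (W ! (Suc i mod length W)) t = edge_point (W ! j) (W ! (Suc j mod length W)) s"
  shows "i = j \<and> t = s"
proof -
  let ?L = "length W"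
  have lt: "Suc i mod ?L < ?L" "Suc j mod ?L < ?L"
    using assms(2) by (intro mod_less_divisor, linarith)+
  have val: "edge_point (W ! a) (W ! (Suc a mod ?L)) r (W ! k)
     = (1 - r) * of_bool (k = a) + r * of_bool (k = Suc a mod ?L)" if "a < ?L" "k < ?L" for a k r
  proof -
    have "Suc a mod ?L < ?L" using assms(2) by (intro mod_less_divisor) linarith
    then show ?thesis
      using that assms(1) by (simp add: edge_point_def vertex_point_def nth_eq_iff_index_eq)
  qed
  have neq: "Suc i mod ?L \<noteq> i" "Suc j mod ?L \<noteq> j" "Suc (Suc i mod ?L) mod ?L \<noteq> i"
    using assms Suc_mod_neq by auto
  have *: "(1 - t) * of_bool (k = i) + t * of_bool (k = Suc i mod ?L)
      = (1 - s) * of_bool (k = j) + s * of_bool (k = Suc j mod ?L)" if "k < ?L" for k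
    using fun_cong[OF eq, of "W ! k"] unfolding val[OF assms(3) that] val[OF assms(4) that] .
  have "i = j"
  proof (rule ccontr)
    assume "i \<noteq> j"
    with *[of i] *[of j] assms(3-8) neq have "i = Suc j mod ?L" "j = Suc i mod ?L"
      by (auto simp: of_bool_def split: if_splits)
    then have "Suc (Suc i mod ?L) mod ?L = i" by simp
    with neq(3) show False by simp
  qed
  with *[of i] neq(1) assms(3) show ?thesis by simp
qed

lemma inj_on_disk_map:
  assumes "distinct W" "length W \<ge> 3"
  shows "inj_on (disk_map W) (cball 0 1)"
proof (rule inj_onI)
  fix w z :: complex assume wz: "w \<in> cball 0 1" "z \<in> cball 0 1" and eq: "disk_map W w = disk_map W z"
  show "w = z"
  proof (cases "norm w < 1 \<or> norm z < 1")
    case True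
    then show ?thesis using eq by (auto simp: disk_map_def split: if_splits)
  next
    case False
    then have norm: "norm w = 1" "norm z = 1" using wz by auto
    have "length W > 0" using assms by linarith
    from sphere_eq_cis[OF norm(1) this] sphere_eq_cis[OF norm(2) this]
    obtain i t j s where i: "i < length W" "0 \<le> t" "t < 1" "w = cis (2 * pi * (real i + t) / length W)"
      and j: "j < length W" "0 \<le> s" "s < 1" "z = cis (2 * pi * (real j + s) / length W)"
      by metis
    have "attaching_map W w = attaching_map W z"
      using eq norm by (simp add: disk_map_def)
    then have "i = j \<and> t = s"
      unfolding i(4) j(4) attaching_map_cis[OF i(1-3)] attaching_map_cis[OF j(1-3)]
      using edge_point_inj[OF assms i(1) j(1)] i j by blast
    then show ?thesis using i j by simp
  qed
qed

lemma disk_map_disjoint: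
  assumes "W \<noteq> W'" "w \<in> ball 0 1" "z \<in> cball 0 1"
  shows "disk_map W w \<noteq> disk_map W' z"
  using assms by (auto simp: disk_map_def)

text \<open>Only the middle half of the common edge is used, in order to stay away from its ends, at which
  \<^const>\<open>attaching_map\<close> switches to another edge.\<close>

lemma attaching_map_common_edge:
  assumes len: "length W = L" "length W' = L" and ij: "i < L" "j < L"
    and dir: "\<epsilon> = 1 \<and> W ! i = W' ! j \<and> W ! (Suc i mod L) = W' ! (Suc j mod L) \<or>
      \<epsilon> = -1 \<and> W ! i = W' ! (Suc j mod L) \<and> W ! (Suc i mod L) = W' ! j"
    and t: "t \<in> {0..1 / (2 * L)}"
  shows "attaching_map W (cis (2 * pi * (i + 1/4) / L + 2 * pi * t)) =
    attaching_map W' (cis (2 * pi * (j + 1/2 - \<epsilon> / 4) / L + \<epsilon> * (2 * pi * t)))"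
proof -
  \<comment> \<open>The offset \<open>1/2 - \<epsilon> / 4\<close> is 1/4 for equal directions and
    3/4 for opposite ones: in the second case the middle half of the edge is entered from its far
    end and run through backwards.\<close>
  have tL: "0 \<le> t * L" "t * L \<le> 1/2" using t ij by (auto simp: field_simps)
  have 1: "2 * pi * (i + 1/4) / L + 2 * pi * t = 2 * pi * (i + (1/4 + t * L)) / length W"
    "2 * pi * (j + 1/2 - \<epsilon> / 4) / L + \<epsilon> * (2 * pi * t)
     = 2 * pi * (j + (1/2 - \<epsilon> / 4 + \<epsilon> * (t * L))) / length W'"
    using len ij by (auto simp: field_simps)
  have 2: "attaching_map W (cis (2 * pi * (i + 1/4) / L + 2 * pi * t))
    = edge_point (W ! i) (W ! (Suc i mod L)) (1/4 + t * L)"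
    unfolding 1 by (subst attaching_map_cis) (use tL len ij in auto)
  have 3: "attaching_map W' (cis (2 * pi * (j + 1/2 - \<epsilon> / 4) / L + \<epsilon> * (2 * pi * t)))
    = edge_point (W' ! j) (W' ! (Suc j mod L)) (1/2 - \<epsilon> / 4 + \<epsilon> * (t * L))"
    unfolding 1 by (subst attaching_map_cis) (use tL len ij dir in auto)
  from dir show ?thesis
  proof (elim disjE conjE)
    assume "\<epsilon> = 1" "W ! i = W' ! j" "W ! (Suc i mod L) = W' ! (Suc j mod L)"
    then show ?thesis unfolding 2 3 by simp
  next
    assume *: "\<epsilon> = -1" "W ! i = W' ! (Suc j mod L)" "W ! (Suc i mod L) = W' ! j"
    show ?thesis
      unfolding 2 3 edge_point_commute[of "W' ! j"] using * by (simp add: algebra_simps)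
  qed
qed

section \<open>Lifts to the universal cover of the torus and the orientation\<close>

definition torus_cover :: "complex \<Rightarrow> complex \<times> complex" where
  "torus_cover w = (cis (Re w), cis (Im w))"

text \<open>A nonvanishing continuous function on a closed disk has a continuous logarithm. For
  values of modulus 1 its imaginary part is an angle, and the angles of the two factors are the
  coordinates of the lift.\<close>

lemma torus_lift:
  fixes p :: "complex \<Rightarrow> complex \<times> complex"
  assumes p: "continuous_on (cball 0 1) p" "p ` cball 0 1 \<subseteq> sphere 0 1 \<times> sphere 0 1"
  obtains f where "continuous_on (cball 0 1) f" "\<And>z. z \<in> cball 0 1 \<Longrightarrow> p z = torus_cover (f z)"
proof -
  have ex: "\<exists>g. continuous_on (cball 0 1) g \<and> (\<forall>z\<in>cball 0 1. q z = cis (Im (g z)))"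
    if q: "continuous_on (cball 0 1) q" "q ` cball 0 1 \<subseteq> sphere 0 1" for q :: "complex \<Rightarrow> complex"
  proof -
    have norm: "norm (q z) = 1" if "z \<in> cball 0 1" for z using q(2) that by (auto simp: image_subset_iff)
    then have "q z \<noteq> 0" if "z \<in> cball 0 1" for z using that by fastforce
    from continuous_logarithm_on_cball[OF q(1) this]
    obtain g where g: "continuous_on (cball 0 1) g" "\<And>z. z \<in> cball 0 1 \<Longrightarrow> q z = exp (g z)" by blast
    moreover have "exp (g z) = cis (Im (g z))" if "z \<in> cball 0 1" for z
    proof -
      have "exp (Re (g z)) = 1" using norm[OF that] g(2)[OF that] by (metis norm_exp_eq_Re)
      then show ?thesis by (simp add: exp_eq_polar)
    qed
    ultimately show ?thesis by metis
  qed
  have "continuous_on (cball 0 1) (\<lambda>z. fst (p z))" "continuous_on (cball 0 1) (\<lambda>z. snd (p z))"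
    using p(1) by (auto intro!: continuous_intros)
  moreover have "(\<lambda>z. fst (p z)) ` cball 0 1 \<subseteq> sphere 0 1" "(\<lambda>z. snd (p z)) ` cball 0 1 \<subseteq> sphere 0 1"
    using p(2) by (fastforce simp: image_subset_iff mem_Times_iff)+
  ultimately obtain g h where gh: "continuous_on (cball 0 1) g" "continuous_on (cball 0 1) h"
      "\<And>z. z \<in> cball 0 1 \<Longrightarrow> fst (p z) = cis (Im (g z))"
      "\<And>z. z \<in> cball 0 1 \<Longrightarrow> snd (p z) = cis (Im (h z))"
    using ex by metis
  show thesis
  proof (rule that[of "\<lambda>z. Complex (Im (g z)) (Im (h z))"])
    show "continuous_on (cball 0 1) (\<lambda>z. Complex (Im (g z)) (Im (h z)))"
      unfolding Complex_eq by (intro continuous_intros gh)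
  qed (auto simp: torus_cover_def prod_eq_iff gh)
qed

text \<open>The difference is continuous with values in the discrete set of multiples of 2 pi.
  Applied to each coordinate, this shows that two lifts of a common arc differ by a deck
  transformation.\<close>

lemma cis_eq_cis_imp_constant_diff:
  fixes u v :: "'a::topological_space \<Rightarrow> real"
  assumes S: "connected S" and cont: "continuous_on S u" "continuous_on S v"
    and eq: "\<And>t. t \<in> S \<Longrightarrow> cis (u t) = cis (v t)"
  obtains n :: int where "\<And>t. t \<in> S \<Longrightarrow> u t = v t + 2 * pi * n"
proof (cases "S = {}")
  case False
  have int: "\<exists>n::int. u t - v t = 2 * pi * n" if "t \<in> S" for t
    using eq[OF that] unfolding cis_eq_int_iff by (auto simp: algebra_simps)
  have "(\<lambda>t. u t - v t) constant_on S"
  proof (rule continuous_discrete_range_constant[OF S])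
    show "\<exists>e>0. \<forall>s. s \<in> S \<and> u s - v s \<noteq> u t - v t \<longrightarrow> e \<le> norm (u s - v s - (u t - v t))"
      if t: "t \<in> S" for t
    proof (intro exI[of _ "2 * pi"] conjI allI impI)
      fix s assume s: "s \<in> S \<and> u s - v s \<noteq> u t - v t"
      obtain m n :: int where mn: "u s - v s = 2 * pi * m" "u t - v t = 2 * pi * n"
        using int s t by meson
      then have "m \<noteq> n" using s by auto
      then have "1 \<le> \<bar>real_of_int (m - n)\<bar>" by linarith
      then have "2 * pi * 1 \<le> 2 * pi * \<bar>real_of_int (m - n)\<bar>" by (intro mult_left_mono) auto
      also have "\<dots> = \<bar>2 * pi * real_of_int (m - n)\<bar>" by (simp add: abs_mult)
      finally show "2 * pi \<le> norm (u s - v s - (u t - v t))" by (simp add: mn algebra_simps)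
    qed simp
  qed (intro continuous_intros cont)
  then obtain c where "\<And>t. t \<in> S \<Longrightarrow> u t - v t = c" unfolding constant_on_def by blast
  with int False that show thesis by (metis add.commute diff_add_cancel ex_in_conv)
qed (use that in auto)

lemma winding_number_rim_translation:
  "winding_number (rim (\<lambda>z. g z + c) 0 1) (w + c) = winding_number (rim g 0 1) w"
  using winding_number_offset[of "rim (\<lambda>z. g z + c) 0 1" "w + c"] winding_number_offset[of "rim g 0 1" w]
  by (simp add: rim_def)

lemma torus_cover_translation:
  "torus_cover (w + Complex (2 * pi * of_int m) (2 * pi * of_int n)) = torus_cover w"
proof -
  have "cis (x + 2 * pi * of_int k) = cis x" for x :: real and k :: int
    unfolding cis_eq_int_iff by auto
  then show ?thesis by (simp add: torus_cover_def)
qed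

text \<open>A face gets the winding number of the boundary of a lift of its disk to the universal cover
  of the torus.\<close>

lemma torus_orientation:
  assumes map: "is_map G T" and torus: "on_torus G T"
    and T: "\<And>W. W \<in> T \<Longrightarrow> distinct W \<and> length W = L" and L: "L \<ge> 3"
  obtains \<sigma> :: "'a list \<Rightarrow> bool" where
    "\<And>W W' i j. \<lbrakk>W \<in> T; W' \<in> T; W \<noteq> W'; i < L; j < L; W ! i = W' ! j;
        W ! (Suc i mod L) = W' ! (Suc j mod L)\<rbrakk> \<Longrightarrow> \<sigma> W \<noteq> \<sigma> W'"
    "\<And>W W' i j. \<lbrakk>W \<in> T; W' \<in> T; W \<noteq> W'; i < L; j < L; W ! i = W' ! (Suc j mod L);
        W ! (Suc i mod L) = W' ! j\<rbrakk> \<Longrightarrow> \<sigma> W = \<sigma> W'"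
proof -
  obtain h where h: "homeomorphic_map (surface G T) Defs.torus h"
    using torus unfolding on_torus_def homeomorphic_space by blast
  define cell where "cell W z = h (disk_map W z)" for W z
  have torus_eq: "Defs.torus = top_of_set (sphere 0 1 \<times> sphere 0 1)"
    unfolding Defs.torus_def by (simp add: subtopology_Times)
  have cont: "continuous_on (cball 0 1) (cell W)" "cell W ` cball 0 1 \<subseteq> sphere 0 1 \<times> sphere 0 1" if "W \<in> T" for W
  proof -
    have "continuous_map (top_of_set (cball 0 1)) (top_of_set (sphere 0 1 \<times> sphere 0 1)) (h \<circ> disk_map W)"
      using continuous_map_compose[OF continuous_map_disk_map[OF map that]]
        homeomorphic_imp_continuous_map[OF h] unfolding torus_eq by blast
    then have "continuous_on (cball 0 1) (h \<circ> disk_map W)" "(h \<circ> disk_map W) \<in> cball 0 1 \<rightarrow> sphere 0 1 \<times> sphere 0 1"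
      unfolding continuous_map_in_subtopology by auto
    then show "continuous_on (cball 0 1) (cell W)" "cell W ` cball 0 1 \<subseteq> sphere 0 1 \<times> sphere 0 1"
      unfolding cell_def o_def by blast+
  qed
  have "inj_on h (surface_points G T)"
    using homeomorphic_imp_injective_map[OF h] topspace_surface[OF map] by simp
  moreover have "disk_map W z \<in> surface_points G T" if "W \<in> T" "z \<in> cball 0 1" for W z
    using continuous_map_disk_map[OF map that(1)] that(2) topspace_surface[OF map]
    unfolding continuous_map_def by auto
  ultimately have cell_eq: "cell W w = cell W' z \<longleftrightarrow> disk_map W w = disk_map W' z"
    if "W \<in> T" "W' \<in> T" "w \<in> cball 0 1" "z \<in> cball 0 1" for W W' w z
    using that unfolding cell_def by (simp add: inj_on_eq_iff)
  have "\<forall>W\<in>T. \<exists>f. continuous_on (cball 0 1) f \<and> (\<forall>z\<in>cball 0 1. cell W z = torus_cover (f z))"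
    using torus_lift[OF cont] by metis
  then obtain F where F: "\<And>W. W \<in> T \<Longrightarrow> continuous_on (cball 0 1) (F W)"
      "\<And>W z. W \<in> T \<Longrightarrow> z \<in> cball 0 1 \<Longrightarrow> cell W z = torus_cover (F W z)"
    by metis
  \<comment> \<open>The sign is read off at the image of the centre; by
    \<open>winding_number_rim_inside\<close> every other point of the open disk gives the same
    value.\<close>
  define \<sigma> where "\<sigma> W \<longleftrightarrow> winding_number (rim (F W) 0 1) (F W 0) = 1" for W
  have inj: "inj_on f (cball 0 1)"
    if "W \<in> T" "\<And>z. z \<in> cball 0 1 \<Longrightarrow> cell W z = torus_cover (f z)" for W and f :: "complex \<Rightarrow> complex"
  proof (rule inj_onI)
    fix w z :: complex assume wz: "w \<in> cball 0 1" "z \<in> cball 0 1" "f w = f z"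
    then have "disk_map W w = disk_map W z" using that cell_eq[of W W w z] by simp
    then show "w = z" using inj_on_disk_map[of W] T[OF that(1)] L wz by (auto dest: inj_onD)
  qed
  have \<sigma>: "winding_number (rim (F W) 0 1) (F W 0) = (if \<sigma> W then 1 else -1)" if "W \<in> T" for W
    using winding_number_rim_inside[OF F(1)[OF that] inj[OF that F(2)[OF that]]]
    unfolding \<sigma>_def by (smt (verit, best) centre_in_ball image_eqI zero_less_one)
  have main: "of_real \<epsilon> * (if \<sigma> W' then 1 else -1) = - (if \<sigma> W then 1 else (-1 :: complex))"
    if W: "W \<in> T" "W' \<in> T" "W \<noteq> W'" and ij: "i < L" "j < L"
      and dir: "\<epsilon> = 1 \<and> W ! i = W' ! j \<and> W ! (Suc i mod L) = W' ! (Suc j mod L) \<or>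
        \<epsilon> = -1 \<and> W ! i = W' ! (Suc j mod L) \<and> W ! (Suc i mod L) = W' ! j"
    for W W' i j \<epsilon>
  proof -
    define \<alpha> where "\<alpha> = 1 / (2 * real L)"
    have \<alpha>: "0 < \<alpha>" "\<alpha> < 1" using L by (auto simp: \<alpha>_def)
    define \<theta>\<^sub>1 where "\<theta>\<^sub>1 = 2 * pi * (i + 1/4) / L"
    define \<theta>\<^sub>2 where "\<theta>\<^sub>2 = 2 * pi * (j + 1/2 - \<epsilon> / 4) / L"
    have rim_cover: "torus_cover (rim (F W) \<theta>\<^sub>1 1 t) = torus_cover (rim (F W') \<theta>\<^sub>2 \<epsilon> t)" if "t \<in> {0..\<alpha>}" for t
    proof -
      have "disk_map W (cis (\<theta>\<^sub>1 + 2 * pi * t)) = disk_map W' (cis (\<theta>\<^sub>2 + \<epsilon> * (2 * pi * t)))"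
        using attaching_map_common_edge[of W L W' i j \<epsilon> t] T W ij dir that
        by (simp add: disk_map_def \<alpha>_def \<theta>\<^sub>1_def \<theta>\<^sub>2_def)
      then show ?thesis
        using cell_eq[OF W(1,2)] F(2) W by (simp add: rim_def)
    qed
    have rim_cont: "continuous_on {0..\<alpha>} (rim f \<theta> e)" if "continuous_on (cball 0 1) f" for f \<theta> e
      by (rule continuous_on_subset[OF path_rim[OF that, unfolded path_def]]) (use \<alpha> in auto)
    note rim_F_cont = rim_cont[OF F(1)[OF W(1)], of \<theta>\<^sub>1 1] rim_cont[OF F(1)[OF W(2)], of \<theta>\<^sub>2 \<epsilon>]
    obtain m :: int where m:
      "\<And>t. t \<in> {0..\<alpha>} \<Longrightarrow> Re (rim (F W) \<theta>\<^sub>1 1 t) = Re (rim (F W') \<theta>\<^sub>2 \<epsilon> t) + 2 * pi * m"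
      by (rule cis_eq_cis_imp_constant_diff[OF connected_Icc continuous_on_Re[OF rim_F_cont(1)]
            continuous_on_Re[OF rim_F_cont(2)]])
        (use rim_cover in \<open>auto simp: torus_cover_def\<close>)
    obtain n :: int where n:
      "\<And>t. t \<in> {0..\<alpha>} \<Longrightarrow> Im (rim (F W) \<theta>\<^sub>1 1 t) = Im (rim (F W') \<theta>\<^sub>2 \<epsilon> t) + 2 * pi * n"
      by (rule cis_eq_cis_imp_constant_diff[OF connected_Icc continuous_on_Im[OF rim_F_cont(1)]
            continuous_on_Im[OF rim_F_cont(2)]])
        (use rim_cover in \<open>auto simp: torus_cover_def\<close>)
    \<comment> \<open>The deck transformation that makes the second lift agree with the first one on
      the common arc; it changes no winding number.\<close>
    define d where "d = Complex (2 * pi * of_int m) (2 * pi * of_int n)"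
    define g where "g z = F W' z + d" for z
    have g: "continuous_on (cball 0 1) g" "\<And>z. z \<in> cball 0 1 \<Longrightarrow> cell W' z = torus_cover (g z)"
      using F W by (auto simp: g_def d_def torus_cover_translation intro!: continuous_intros)
    \<comment> \<open>A common point of the two lifts projects to a common point of the two cells on
      the torus, and there an open disk meets no other closed disk.\<close>
    have disj: "F W w \<noteq> g z" if "w \<in> ball 0 1 \<and> z \<in> cball 0 1 \<or> w \<in> cball 0 1 \<and> z \<in> ball 0 1" for w z
    proof
      assume eq: "F W w = g z"
      have "w \<in> cball 0 1" "z \<in> cball 0 1" using that by auto
      then have "cell W w = cell W' z" using F(2) W g(2) eq by simp
      then have "disk_map W w = disk_map W' z"
        using cell_eq W \<open>w \<in> cball 0 1\<close> \<open>z \<in> cball 0 1\<close> by blast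
      then show False
        using that disk_map_disjoint[of W W' w z] disk_map_disjoint[of W' W z w] W by auto
    qed
    have "of_real 1 * winding_number (rim (F W) 0 1) (F W 0) = - of_real \<epsilon> * winding_number (rim g 0 1) (g 0)"
    proof (rule winding_number_rim_common_arc)
      show "rim (F W) \<theta>\<^sub>1 1 t = rim g \<theta>\<^sub>2 \<epsilon> t" if "t \<in> {0..\<alpha>}" for t
        using m[OF that] n[OF that] by (simp add: rim_def g_def d_def complex_eq_iff)
      show "F W ` ball 0 1 \<inter> g ` cball 0 1 = {}" "F W ` cball 0 1 \<inter> g ` ball 0 1 = {}"
        using disj by blast+
    qed (use F W g inj \<alpha> dir in auto)
    also have "winding_number (rim g 0 1) (g 0) = winding_number (rim (F W') 0 1) (F W' 0)"
      unfolding g_def by (rule winding_number_rim_translation)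
    finally show ?thesis using \<sigma>[OF W(1)] \<sigma>[OF W(2)] by simp
  qed
  show thesis
  proof (rule that[of \<sigma>])
    show "\<sigma> W \<noteq> \<sigma> W'" if "W \<in> T" "W' \<in> T" "W \<noteq> W'" "i < L" "j < L" "W ! i = W' ! j"
      "W ! (Suc i mod L) = W' ! (Suc j mod L)" for W W' i j
      using main[OF that(1-5), of 1] that by (auto split: if_splits)
    show "\<sigma> W = \<sigma> W'" if "W \<in> T" "W' \<in> T" "W \<noteq> W'" "i < L" "j < L" "W ! i = W' ! (Suc j mod L)"
      "W ! (Suc i mod L) = W' ! j" for W W' i j
      using main[OF that(1-5), of "-1"] that by (auto split: if_splits)
  qed
qed

section \<open>Darts of an oriented hexagonal cubic map\<close>

text \<open>Integer powers of a permutation of a set D. As \<open>g\<close> is a total function that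
  is invertible only on D, its inverse there is passed as a second function.\<close>

definition zpow :: "('d \<Rightarrow> 'd) \<Rightarrow> ('d \<Rightarrow> 'd) \<Rightarrow> int \<Rightarrow> 'd \<Rightarrow> 'd" where
  "zpow g g' k = (if 0 \<le> k then g ^^ nat k else g' ^^ nat (- k))"

locale mutually_inverse =
  fixes D :: "'d set" and g g' :: "'d \<Rightarrow> 'd"
  assumes in_D: "x \<in> D \<Longrightarrow> g x \<in> D" "x \<in> D \<Longrightarrow> g' x \<in> D"
    and inverse: "x \<in> D \<Longrightarrow> g (g' x) = x" "x \<in> D \<Longrightarrow> g' (g x) = x"
begin

lemma zpow_0 [simp]: "zpow g g' 0 x = x"
  by (simp add: zpow_def)

lemma zpow_in [simp]: "x \<in> D \<Longrightarrow> zpow g g' k x \<in> D"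
proof -
  have "(h ^^ n) x \<in> D" if "x \<in> D" "\<And>x. x \<in> D \<Longrightarrow> h x \<in> D" for h n
    using that by (induction n) auto
  then show "x \<in> D \<Longrightarrow> zpow g g' k x \<in> D" using in_D by (simp add: zpow_def)
qed

lemma zpow_plus_1:
  assumes "x \<in> D"
  shows "zpow g g' (k + 1) x = g (zpow g g' k x)"
proof (cases "0 \<le> k")
  case True
  then show ?thesis by (simp add: zpow_def nat_add_distrib)
next
  case False
  define n where "n = nat (- k - 1)"
  have "nat (- k) = Suc n" using False by (simp add: n_def)
  then have 1: "zpow g g' k x = g' ((g' ^^ n) x)" using False by (simp add: zpow_def)
  have "zpow g g' (k + 1) x = (g' ^^ n) x"
  proof (cases "k = -1")
    case False
    then have "\<not> 0 \<le> k + 1" "nat (- (k + 1)) = n" using \<open>\<not> 0 \<le> k\<close> by (auto simp: n_def)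
    then show ?thesis unfolding zpow_def by (simp only: if_False)
  qed (simp add: n_def)
  moreover have "(g' ^^ n) x \<in> D" using assms in_D by (induction n) auto
  ultimately show ?thesis unfolding 1 by (simp only: inverse(1))
qed

lemma zpow_minus_1:
  assumes "x \<in> D"
  shows "zpow g g' (k - 1) x = g' (zpow g g' k x)"
  using zpow_plus_1[OF assms, of "k - 1"] inverse(2)[of "zpow g g' (k - 1) x"] zpow_in assms by simp

lemma zpow_commute:
  assumes "x \<in> D" and "\<And>y. y \<in> D \<Longrightarrow> h (g y) = g (h y)" "\<And>y. y \<in> D \<Longrightarrow> h (g' y) = g' (h y)"
    "\<And>y. y \<in> D \<Longrightarrow> h y \<in> D"
  shows "h (zpow g g' k x) = zpow g g' k (h x)"
proof (induction k rule: int_induct[where k = 0])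
  case (step1 i)
  then show ?case using assms zpow_plus_1 by simp
next
  case (step2 i)
  then show ?case using assms zpow_minus_1 by simp
qed simp

end

lemma int_pair_induct [case_names zero right left up down]:
  fixes p :: "int \<times> int"
  assumes "P (0, 0)" "\<And>m n. P (m, n) \<Longrightarrow> P (m + 1, n)" "\<And>m n. P (m, n) \<Longrightarrow> P (m - 1, n)"
    "\<And>m n. P (m, n) \<Longrightarrow> P (m, n + 1)" "\<And>m n. P (m, n) \<Longrightarrow> P (m, n - 1)"
  shows "P p"
proof -
  have "P (m, 0)" for m by (induction m rule: int_induct[where k = 0]) (use assms in auto)
  then have "P (m, n)" for m n by (induction n rule: int_induct[where k = 0]) (use assms in auto)
  then show ?thesis by (cases p) simp
qed

text \<open>Multiplication by a primitive sixth root of unity on the Eisenstein lattice.\<close>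

definition rot :: "int \<times> int \<Rightarrow> int \<times> int" where
  "rot p = (fst p - snd p, fst p)"

text \<open>The six units of the Eisenstein lattice in cyclic order, with (0, 1) as a primitive cube
  root of unity. Unit j leads from a face to its neighbour across side j.\<close>

definition hex_unit :: "nat \<Rightarrow> int \<times> int" where
  "hex_unit j = [(1, 0), (1, 1), (0, 1), (-1, 0), (-1, -1), (0, -1)] ! (j mod 6)"

lemma hex_unit_simps:
  "hex_unit 0 = (1, 0)" "hex_unit 1 = (1, 1)" "hex_unit 2 = (0, 1)" "hex_unit 3 = (-1, 0)"
  "hex_unit 4 = (-1, -1)" "hex_unit 5 = (0, -1)"
  by (simp_all add: hex_unit_def)

text \<open>A dart is moved by \<open>f\<close> to the next dart of the face on its left and by \<open>s\<close> to its reverse, so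
  that \<open>f \<circ> s\<close> rotates the darts at a vertex.\<close>

locale hex_darts =
  fixes D :: "'d set" and f s :: "'d \<Rightarrow> 'd"
  assumes f_in [simp]: "x \<in> D \<Longrightarrow> f x \<in> D" and s_in [simp]: "x \<in> D \<Longrightarrow> s x \<in> D"
    and f6 [simp]: "x \<in> D \<Longrightarrow> f (f (f (f (f (f x))))) = x"
    and s2 [simp]: "x \<in> D \<Longrightarrow> s (s x) = x"
    and fs3: "x \<in> D \<Longrightarrow> f (s (f (s (f (s x))))) = x"
    and f_free: "x \<in> D \<Longrightarrow> f x \<noteq> x" "x \<in> D \<Longrightarrow> f (f x) \<noteq> x" "x \<in> D \<Longrightarrow> f (f (f x)) \<noteq> x"
    and s_free: "x \<in> D \<Longrightarrow> s x \<noteq> x"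
    and fs_free: "x \<in> D \<Longrightarrow> f (s x) \<noteq> x"
begin

text \<open>The relation (f s)^3 = 1 solved for s f s, which is f^-1 s f^-1; the inverse of
  \<open>f\<close> is written as its fifth power.\<close>

lemma sfs: "x \<in> D \<Longrightarrow> s (f (s x)) = f (f (f (f (f (s (f (f (f (f (f x))))))))))"
  using fs3[of "f (f (f (f (f x))))"] by (smt (verit) f6 fs3 f_in s2 s_in)

lemma sf5s: "x \<in> D \<Longrightarrow> s (f (f (f (f (f (s x)))))) = f (s (f x))"
  by (metis f6 fs3 f_in s2 s_in)

text \<open>The parallel dart of the face across the edge, and across the edge two steps ahead.\<close>

definition "a x = f (f (f (s x)))"
definition "a' x = s (f (f (f x)))"
definition "b x = f (s (f (f x)))"
definition "b' x = f (f (f (f (s (f (f (f (f (f x)))))))))"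

sublocale A: mutually_inverse D a a'
  by unfold_locales (auto simp: a_def a'_def)

sublocale B: mutually_inverse D b b'
  by unfold_locales (auto simp: b_def b'_def)

text \<open>Together with \<open>ba\<close> this says that the two translations commute, as both
  products reduce to f f s f.\<close>

lemma ab: "x \<in> D \<Longrightarrow> a (b x) = f (f (s (f x)))"
  by (simp add: a_def b_def sfs)

lemma ba: "x \<in> D \<Longrightarrow> b (a x) = f (f (s (f x)))"
  by (simp add: a_def b_def sf5s)

lemma b_a': "x \<in> D \<Longrightarrow> b (a' x) = a' (b x)"
  using ab[of "a' x"] ba[of "a' x"] A.inverse A.in_D B.in_D by metis

lemma b'_a: "x \<in> D \<Longrightarrow> b' (a x) = a (b' x)"
  using ab[of "b' x"] ba[of "b' x"] B.inverse A.in_D B.in_D by metis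

lemma b'_a': "x \<in> D \<Longrightarrow> b' (a' x) = a' (b' x)"
  using b_a'[of "b' x"] B.inverse A.in_D B.in_D by metis

section \<open>The action of the translation lattice on darts\<close>

definition tau :: "int \<times> int \<Rightarrow> 'd \<Rightarrow> 'd" where
  "tau p x = zpow a a' (fst p) (zpow b b' (snd p) x)"

lemma tau_in [simp]: "x \<in> D \<Longrightarrow> tau p x \<in> D"
  by (simp add: tau_def)

lemma tau_0 [simp]: "tau (0, 0) x = x" "tau 0 x = x"
  by (simp_all add: tau_def)

lemma tau_step:
  assumes "x \<in> D"
  shows "tau (m + 1, n) x = a (tau (m, n) x)" "tau (m - 1, n) x = a' (tau (m, n) x)"
    "tau (m, n + 1) x = b (tau (m, n) x)" "tau (m, n - 1) x = b' (tau (m, n) x)"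
  using assms ab ba b_a' b'_a b'_a' A.in_D B.in_D
  by (auto simp: tau_def A.zpow_plus_1 A.zpow_minus_1 B.zpow_plus_1 B.zpow_minus_1
      intro!: A.zpow_commute[symmetric])

lemma tau_add: "x \<in> D \<Longrightarrow> tau (p + q) x = tau p (tau q x)"
proof (induction p rule: int_pair_induct)
  case zero
  then show ?case by (cases q) simp
next
  case (right m n)
  have "(m + 1, n) + q = (fst ((m, n) + q) + 1, snd ((m, n) + q))" by (cases q) simp
  then have "tau ((m + 1, n) + q) x = a (tau ((m, n) + q) x)"
    using tau_step(1)[of x "fst ((m, n) + q)" "snd ((m, n) + q)"] right by (simp only: prod.collapse)
  with right show ?case by (simp add: tau_step)
next
  case (left m n)
  have "(m - 1, n) + q = (fst ((m, n) + q) - 1, snd ((m, n) + q))" by (cases q) simp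
  then have "tau ((m - 1, n) + q) x = a' (tau ((m, n) + q) x)"
    using tau_step(2)[of x "fst ((m, n) + q)" "snd ((m, n) + q)"] left by (simp only: prod.collapse)
  with left show ?case by (simp add: tau_step)
next
  case (up m n)
  have "(m, n + 1) + q = (fst ((m, n) + q), snd ((m, n) + q) + 1)" by (cases q) simp
  then have "tau ((m, n + 1) + q) x = b (tau ((m, n) + q) x)"
    using tau_step(3)[of x "fst ((m, n) + q)" "snd ((m, n) + q)"] up by (simp only: prod.collapse)
  with up show ?case by (simp add: tau_step)
next
  case (down m n)
  have "(m, n - 1) + q = (fst ((m, n) + q), snd ((m, n) + q) - 1)" by (cases q) simp
  then have "tau ((m, n - 1) + q) x = b' (tau ((m, n) + q) x)"
    using tau_step(4)[of x "fst ((m, n) + q)" "snd ((m, n) + q)"] down by (simp only: prod.collapse)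
  with down show ?case by (simp add: tau_step)
qed

lemma tau_uminus [simp]: "x \<in> D \<Longrightarrow> tau (- p) (tau p x) = x" "x \<in> D \<Longrightarrow> tau p (tau (- p) x) = x"
  by (simp_all add: tau_add[symmetric])

lemma tau_unit:
  assumes "x \<in> D"
  shows "tau (1, 0) x = a x" "tau (0, 1) x = b x" "tau (-1, 0) x = a' x" "tau (0, -1) x = b' x"
    "tau (1, 1) x = a (b x)" "tau (-1, -1) x = a' (b' x)"
  using tau_step[OF assms, of 0 0] tau_step[OF assms, of 0 1] tau_step[OF assms, of 0 "-1"] by simp_all

lemma a_f: "x \<in> D \<Longrightarrow> a (f x) = f (a (b x))"
  by (subst ab) (simp_all add: a_def)

lemma a'_f: "x \<in> D \<Longrightarrow> a' (f x) = f (a' (b' x))"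
  using a_f[of "a' (b' x)"] A.inverse B.inverse A.in_D B.in_D b_a' b'_a' f_in by metis

lemma b_f: "x \<in> D \<Longrightarrow> b (f x) = f (a' x)"
  by (simp add: b_def a'_def)

lemma b'_f: "x \<in> D \<Longrightarrow> b' (f x) = f (a x)"
  by (simp add: b'_def a_def)

text \<open>Conjugation by the turn of a face rotates the translation vector. Since s is f^3 after a
  translation, every word in f and s thus reduces to a power of \<open>f\<close> and one
  \<open>tau\<close>.\<close>

lemma tau_f: "x \<in> D \<Longrightarrow> tau p (f x) = f (tau (rot p) x)"
proof (induction p rule: int_pair_induct)
  case (right m n)
  have "rot (m + 1, n) = (1, 1) + rot (m, n)" by (simp add: rot_def)
  then show ?case using right tau_step(1)[of "f x" m n] by (simp add: tau_add tau_unit a_f)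
next
  case (left m n)
  have "rot (m - 1, n) = (-1, -1) + rot (m, n)" by (simp add: rot_def)
  then show ?case using left tau_step(2)[of "f x" m n] by (simp add: tau_add tau_unit a'_f)
next
  case (up m n)
  have "rot (m, n + 1) = (-1, 0) + rot (m, n)" by (simp add: rot_def)
  then show ?case using up tau_step(3)[of "f x" m n] by (simp add: tau_add tau_unit b_f)
next
  case (down m n)
  have "rot (m, n - 1) = (1, 0) + rot (m, n)" by (simp add: rot_def)
  then show ?case using down tau_step(4)[of "f x" m n] by (simp add: tau_add tau_unit b'_f)
qed (simp add: rot_def)

lemma f_pow_in [simp]: "x \<in> D \<Longrightarrow> (f ^^ k) x \<in> D"
  by (induction k) auto

lemma tau_f_pow: "x \<in> D \<Longrightarrow> tau p ((f ^^ k) x) = (f ^^ k) (tau ((rot ^^ k) p) x)"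
  by (induction k arbitrary: p) (simp_all add: tau_f funpow_swap1[of rot])

lemma f_pow_6 [simp]: "x \<in> D \<Longrightarrow> (f ^^ 6) x = x"
  by (simp add: eval_nat_numeral)

lemma f_pow_6_mult: "x \<in> D \<Longrightarrow> (f ^^ (6 * k)) x = x"
  by (induction k) (simp_all add: funpow_add)

lemma f_pow_mod: "x \<in> D \<Longrightarrow> (f ^^ k) x = (f ^^ (k mod 6)) x"
  using funpow_add[of "k mod 6" "6 * (k div 6)" f] f_pow_6_mult[of x "k div 6"] by simp

section \<open>No proper rotation fixes a dart\<close>

lemma rot_add: "rot (p + q) = rot p + rot q" "rot (p - q) = rot p - rot q" "rot (- p) = - rot p"
  by (simp_all add: rot_def)

lemma rot_pow_uminus: "(rot ^^ k) (- p) = - (rot ^^ k) p"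
  by (induction k) (simp_all add: rot_add)

text \<open>Moving the fixed dart by -q changes the translation part of the rotation by q - rot^k q.
  Only the class of p modulo the image of 1 - rot^k matters, so p may be replaced by a small
  representative.\<close>

lemma fixed_point_conjugate:
  assumes x: "x \<in> D" and fixed: "(f ^^ k) (tau p x) = x"
  shows "(f ^^ k) (tau (p + q - (rot ^^ k) q) (tau (- q) x)) = tau (- q) x"
proof -
  have "tau (- q) x = tau (- q) ((f ^^ k) (tau p x))" using fixed by simp
  also have "\<dots> = (f ^^ k) (tau (- (rot ^^ k) q + p) x)"
    using x by (simp only: tau_f_pow tau_in rot_pow_uminus tau_add)
  also have "- (rot ^^ k) q + p = (p + q - (rot ^^ k) q) + - q" by simp
  finally show ?thesis using x by (metis tau_add)
qed

lemma no_fixed_point_60: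
  assumes x: "x \<in> D" shows "f (tau p x) \<noteq> x"
proof
  assume "f (tau p x) = x"
  then have "(f ^^ 1) (tau p x) = x" by simp
  \<comment> \<open>1 - rot is invertible on the lattice, and this q solves p + q - rot q = 0: every
    such rotation is conjugate to the turn \<open>f\<close> of a face.\<close>
  note * = fixed_point_conjugate[OF x this, of "(snd p - fst p, - fst p)"]
  have "p + (snd p - fst p, - fst p) - (rot ^^ 1) (snd p - fst p, - fst p) = (0, 0)"
    by (cases p) (simp add: rot_def zero_prod_def)
  with * show False using f_free x by simp
qed

lemma no_fixed_point_120:
  assumes x: "x \<in> D" shows "f (f (tau p x)) \<noteq> x"
proof
  assume "f (f (tau p x)) = x"
  then have fixed: "(f ^^ 2) (tau p x) = x" by (simp add: eval_nat_numeral)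
  \<comment> \<open>The image of 1 - rot^2 has index 3, with \<open>fst p + snd p\<close> modulo 3
    as the invariant; adding 1 before the division centres the remainder r at 0.\<close>
  define c where "c = (fst p + snd p + 1) div 3"
  define r where "r = fst p + snd p - 3 * c"
  define q where "q = (snd p - 2 * c, - c)"
  have shift: "p + q - (rot ^^ 2) q = (r, 0)"
    by (cases p) (simp add: rot_def q_def r_def eval_nat_numeral)
  define y where "y = tau (- q) x"
  have y: "y \<in> D" "f (f (tau (r, 0) y)) = y"
    using fixed_point_conjugate[OF x fixed, of q, unfolded shift] x by (simp_all add: y_def eval_nat_numeral)
  \<comment> \<open>The value 0 belongs to a rotation about the centre of a face, the values 1 and
    -1 to rotations about the two kinds of vertices.\<close>
  have "r = -1 \<or> r = 0 \<or> r = 1" unfolding r_def c_def by presburger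
  then show False
  proof (elim disjE)
    assume "r = 0"
    then show False using y f_free by simp
  next
    assume "r = 1"
    then have "f (f (f (f (f (s y))))) = y" using y by (simp add: tau_unit a_def)
    then have "s y = f y" using y f6[of "s y"] by simp
    then have "s (f y) = y" using y s2[of y] by simp
    then show False using y fs_free[of "f y"] by simp
  next
    assume "r = -1"
    then have "f (f (s (f (f (f y))))) = y" using y by (simp add: tau_unit a'_def)
    then have "s (f (f (f y))) = f (f (f (f y)))" using y f6[of "s (f (f (f y)))"] by simp
    then have "s (f (f (f (f y)))) = f (f (f y))" using y s2[of "f (f (f y))"] by simp
    then show False using y fs_free[of "f (f (f (f y)))"] by simp
    qed
qed

lemma no_fixed_point_180:
  assumes x: "x \<in> D" shows "f (f (f (tau p x))) \<noteq> x"
proof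
  assume "f (f (f (tau p x))) = x"
  then have fixed: "(f ^^ 3) (tau p x) = x" by (simp add: eval_nat_numeral)
  \<comment> \<open>Since rot^3 = -1, conjugation changes p by 2 q and only parities survive. One
    class consists of half turns about centres of faces, the other three of half turns about
    midpoints of edges.\<close>
  define m where "m = fst p div 2"
  define n where "n = snd p div 2"
  define q where "q = (- m, - n)"
  define r where "r = (fst p - 2 * m, snd p - 2 * n)"
  have "(rot ^^ 3) q = - q" by (simp add: rot_def q_def eval_nat_numeral)
  then have shift: "p + q - (rot ^^ 3) q = r" by (cases p) (simp add: q_def r_def)
  define y where "y = tau (- q) x"
  have y: "y \<in> D" "f (f (f (tau r y))) = y"
    using fixed_point_conjugate[OF x fixed, of q, unfolded shift] x by (simp_all add: y_def eval_nat_numeral)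
  have "fst p - 2 * m = 0 \<or> fst p - 2 * m = 1" "snd p - 2 * n = 0 \<or> snd p - 2 * n = 1"
    unfolding m_def n_def by presburger+
  then have "r \<in> {(0, 0), (1, 0), (0, 1), (1, 1)}" unfolding r_def by auto
  then consider "r = (0, 0)" | "r = (1, 0)" | "r = (0, 1)" | "r = (1, 1)" by blast
  then show False
  proof cases
    case 1
    then show False using y f_free by simp
  next
    case 2
    then have "s y = y" using y by (simp add: tau_unit a_def)
    then show False using y s_free by simp
  next
    case 3
    then have "f (f (f (f (s (f (f y)))))) = y" using y by (simp add: tau_unit b_def)
    then have "s (f (f y)) = f (f y)" using y f6[of "s (f (f y))"] by simp
    then show False using y s_free by simp
  next
    case 4
    then have "f (f (f (f (f (s (f y)))))) = y" using y by (simp add: tau_unit ab)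
    then have "s (f y) = f y" using y f6[of "s (f y)"] by simp
    then show False using y s_free by simp
  qed
qed

text \<open>Rotations by 240 and 300 degrees are inverses of rotations by 120 and 60 degrees, so a
  fixed dart of the former is one of the latter.\<close>

lemma no_fixed_point:
  assumes x: "x \<in> D" and k: "k < 6" and fixed: "(f ^^ k) (tau p x) = x"
  shows "k = 0"
proof (rule ccontr)
  assume "k \<noteq> 0"
  have inv: "(f ^^ (6 - k)) (tau ((rot ^^ (6 - k)) (- p)) x) = x"
  proof -
    have "(f ^^ (6 - k)) x = (f ^^ (6 - k + k)) (tau p x)" using fixed by (simp add: funpow_add)
    also have "\<dots> = tau p x" using k x by simp
    finally have "tau (- p) ((f ^^ (6 - k)) x) = x" using x by simp
    then show ?thesis using x by (simp add: tau_f_pow)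
  qed
  have "k = 1 \<or> k = 2 \<or> k = 3 \<or> k = 4 \<or> k = 5" using k \<open>k \<noteq> 0\<close> by linarith
  then show False
  proof (elim disjE)
    assume "k = 1" then show False using fixed no_fixed_point_60[OF x] by simp
  next
    assume "k = 2" then show False using fixed no_fixed_point_120[OF x] by (simp add: eval_nat_numeral)
  next
    assume "k = 3" then show False using fixed no_fixed_point_180[OF x] by (simp add: eval_nat_numeral)
  next
    assume "k = 4" then have "6 - k = 2" by simp
    then show False using inv no_fixed_point_120[OF x] by (simp add: eval_nat_numeral)
  next
    assume "k = 5" then have "6 - k = 1" by simp
    then show False using inv no_fixed_point_60[OF x] by simp
  qed
qed

end

section \<open>Coordinates for darts and the lattice of periods\<close>

locale based_hex_darts = hex_darts +
  fixes d\<^sub>0 assumes d0_in [simp]: "d\<^sub>0 \<in> D"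
begin

definition period :: "int \<times> int \<Rightarrow> bool" where
  "period p \<longleftrightarrow> tau p d\<^sub>0 = d\<^sub>0"

definition dart :: "int \<times> int \<Rightarrow> nat \<Rightarrow> 'a" where
  "dart p j = (f ^^ j) (tau p d\<^sub>0)"

lemma dart_in [simp]: "dart p j \<in> D"
  by (simp add: dart_def)

lemma f_dart: "f (dart p j) = dart p (Suc j)"
  by (simp add: dart_def)

lemma dart_mod: "dart p (j mod 6) = dart p j"
  unfolding dart_def using f_pow_mod[of "tau p d\<^sub>0" j] by simp

lemma period_0: "period 0"
  by (simp add: period_def)

lemma period_diff: "period p \<Longrightarrow> period q \<Longrightarrow> period (p - q)"
  using tau_uminus(1)[of d\<^sub>0 q] tau_add[of d\<^sub>0 p "- q"] by (simp add: period_def)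

text \<open>Cancelling f^k, written as f^(5 k) on the left since f^6 = 1, turns the equality into a
  fixed dart of f^(j - k) after a translation. By \<open>no_fixed_point\<close> the rotation is
  trivial, and the remaining translation is a period.\<close>

lemma dart_eq_iff: "dart p j = dart q k \<longleftrightarrow> j mod 6 = k mod 6 \<and> period (p - q)"
proof
  assume eq: "dart p j = dart q k"
  define n where "n = (j + 5 * k) mod 6"
  have "(f ^^ (5 * k)) (dart p j) = (f ^^ (5 * k)) (dart q k)" using eq by simp
  moreover have "(f ^^ (5 * k)) (dart q k) = tau q d\<^sub>0"
  proof -
    have "(f ^^ (5 * k)) (dart q k) = (f ^^ (5 * k + k)) (tau q d\<^sub>0)"
      unfolding dart_def funpow_add o_apply ..
    also have "\<dots> = tau q d\<^sub>0" using f_pow_6_mult[of "tau q d\<^sub>0" k] by simp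
    finally show ?thesis .
  qed
  moreover have "(f ^^ (5 * k)) (dart p j) = (f ^^ n) (tau p d\<^sub>0)"
  proof -
    have "(f ^^ (5 * k)) (dart p j) = (f ^^ (5 * k + j)) (tau p d\<^sub>0)"
      unfolding dart_def funpow_add o_apply ..
    also have "\<dots> = (f ^^ n) (tau p d\<^sub>0)"
      unfolding n_def add.commute[of j] by (rule f_pow_mod) simp
    finally show ?thesis .
  qed
  ultimately have n: "(f ^^ n) (tau (p - q) (tau q d\<^sub>0)) = tau q d\<^sub>0"
    by (simp add: tau_add[symmetric])
  from no_fixed_point[OF _ _ this] have "n = 0" by (simp add: n_def)
  have "j mod 6 = (j + k * 6) mod 6" by (simp only: mod_mult_self1)
  also have "j + k * 6 = j + 5 * k + k" by simp
  also have "\<dots> mod 6 = (n + k) mod 6" unfolding n_def by (rule mod_add_left_eq[symmetric])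
  finally have "j mod 6 = k mod 6" using \<open>n = 0\<close> by simp
  moreover have "tau p d\<^sub>0 = tau q d\<^sub>0" using n \<open>n = 0\<close> tau_add[of d\<^sub>0 "p - q" q] by simp
  then have "tau (- q + p) d\<^sub>0 = d\<^sub>0" unfolding tau_add[OF d0_in] by simp
  then have "period (p - q)" by (simp add: period_def)
  ultimately show "j mod 6 = k mod 6 \<and> period (p - q)" ..
next
  assume *: "j mod 6 = k mod 6 \<and> period (p - q)"
  have "tau p d\<^sub>0 = tau q (tau (p - q) d\<^sub>0)" by (simp add: tau_add[symmetric])
  also have "\<dots> = tau q d\<^sub>0" using * by (simp add: period_def)
  finally have "dart p j = dart q j" by (simp add: dart_def)
  also have "\<dots> = dart q k" using * dart_mod by metis
  finally show "dart p j = dart q k" .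
qed

text \<open>Reversal crosses side j into the face in direction \<open>hex_unit j\<close>, where the
  same edge is the opposite side j + 3.\<close>

lemma s_dart: "s (dart p j) = dart (p + hex_unit j) (j + 3)"
proof -
  define x where "x = tau p d\<^sub>0"
  have x: "x \<in> D" by (simp add: x_def)
  have "s ((f ^^ i) x) = (f ^^ (i + 3)) (tau (hex_unit i) x)" if "i < 6" for i
  proof -
    have a'b': "a' (b' x) = f (f (f (f (f (s (f (f (f (f x)))))))))"
      using x by (simp add: a'_def b'_def sfs)
    have "i \<in> {0, 1, 2, 3, 4, 5}" using \<open>i < 6\<close> by auto
    then consider "i = 0" | "i = 1" | "i = 2" | "i = 3" | "i = 4" | "i = 5" by blast
    then show ?thesis
    proof cases
      case 1
      with x show ?thesis by (simp only: hex_unit_simps tau_unit) (simp add: eval_nat_numeral a_def)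
    next
      case 2
      with x show ?thesis by (simp only: hex_unit_simps tau_unit) (simp add: eval_nat_numeral ab)
    next
      case 3
      with x show ?thesis by (simp only: hex_unit_simps tau_unit) (simp add: eval_nat_numeral b_def)
    next
      case 4
      with x show ?thesis by (simp only: hex_unit_simps tau_unit) (simp add: eval_nat_numeral a'_def)
    next
      case 5
      with x show ?thesis by (simp only: hex_unit_simps tau_unit) (simp add: eval_nat_numeral a'b')
    next
      case 6
      with x show ?thesis by (simp only: hex_unit_simps tau_unit) (simp add: eval_nat_numeral b'_def)
    qed
  qed
  from this[of "j mod 6"] have "s (dart p (j mod 6)) = dart (p + hex_unit (j mod 6)) (j mod 6 + 3)"
    by (simp add: dart_def x_def tau_add[symmetric] add.commute)
  moreover have "dart r (j mod 6 + 3) = dart r (j + 3)" for r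
    using dart_mod[of r "j mod 6 + 3"] dart_mod[of r "j + 3"] by (simp add: mod_simps)
  ultimately show ?thesis by (simp add: dart_mod hex_unit_def)
qed

end

section \<open>Quotients of the honeycomb\<close>

lemma graph_isoI_inverse:
  assumes g: "bij_betw g (verts H) (verts G)"
    and adj: "\<And>x y. x \<in> verts H \<Longrightarrow> y \<in> verts H \<Longrightarrow> {g x, g y} \<in> edges G \<longleftrightarrow> {x, y} \<in> edges H"
  shows "graph_iso G H"
  unfolding graph_iso_def
proof (intro exI conjI ballI)
  let ?f = "inv_into (verts H) g"
  show "bij_betw ?f (verts G) (verts H)" using g by (rule bij_betw_inv_into)
  fix u v assume "u \<in> verts G" "v \<in> verts G"
  then have "?f u \<in> verts H" "?f v \<in> verts H" "g (?f u) = u" "g (?f v) = v"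
    using g by (auto simp: bij_betw_def intro: inv_into_into f_inv_into_f)
  then show "{u, v} \<in> edges G \<longleftrightarrow> {?f u, ?f v} \<in> edges H" using adj by metis
qed

lemma edges_cayley_graph:
  "{x, y} \<in> edges (cayley_graph G S) \<longleftrightarrow> x \<in> carrier G \<and> y \<in> carrier G \<and>
    (x \<otimes>\<^bsub>G\<^esub> inv\<^bsub>G\<^esub> y \<in> S \<or> y \<otimes>\<^bsub>G\<^esub> inv\<^bsub>G\<^esub> x \<in> S)"
  unfolding cayley_graph_def by (auto simp: doubleton_eq_iff)

lemma inv_dihedral:
  assumes "n > 0" "(i, c) \<in> carrier (dihedral n)"
  shows "inv\<^bsub>dihedral n\<^esub> (i, c) = (if c then i else - i mod int n, c)"
proof -
  interpret group "dihedral n" by (rule group_dihedral[OF assms(1)])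
  show ?thesis
    by (rule inv_equality) (use assms in \<open>auto simp: carrier_integer_mod_group dihedral_def mod_simps\<close>)
qed

lemma dihedral_mult_inv:
  assumes "n > 0" "(i, c) \<in> carrier (dihedral n)" "(j, d) \<in> carrier (dihedral n)"
  shows "(i, c) \<otimes>\<^bsub>dihedral n\<^esub> inv\<^bsub>dihedral n\<^esub> (j, d) = ((if c = d then i - j else i + j) mod int n, c \<noteq> d)"
  by (subst inv_dihedral[OF assms(1,3)]) (auto simp: dihedral_def mod_simps)

lemma mod_eq_of_nat_iff: "n > 0 \<Longrightarrow> k mod int n = int r mod int n \<longleftrightarrow> int n dvd k - int r"
  by (simp add: mod_eq_dvd_iff)

text \<open>The graph is bipartite on two copies of the integers modulo n with edges given by
  differences. Its translations together with the maps that negate the index and swap the copies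
  form a dihedral group acting regularly on the vertices.\<close>

lemma graph_iso_cayley_dihedral:
  fixes u :: "int \<Rightarrow> bool \<Rightarrow> 'a"
  assumes n: "n > 0"
    and verts: "verts G = {u i c | i c. True}"
    and eq: "\<And>i j c d. u i c = u j d \<longleftrightarrow> c = d \<and> int n dvd i - j"
    and same: "\<And>i j c. {u i c, u j c} \<notin> edges G"
    and adj: "\<And>i j. {u i False, u j True} \<in> edges G \<longleftrightarrow> (\<exists>r\<in>R. int n dvd j - i - int r)"
  shows "graph_iso G (cayley_graph (dihedral n) (dih_refl n ` R))"
proof (rule graph_isoI_inverse)
  \<comment> \<open>Dividing a rotation by a reflection, or conversely, adds the exponents. Negating
    the index of the rotations turns this sum into the difference that decides adjacency.\<close>
  define g where "g x = u (if snd x then fst x else - fst x) (snd x)" for x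
  have carrier: "verts (cayley_graph (dihedral n) (dih_refl n ` R)) = {0..<int n} \<times> UNIV"
    using n by (simp add: cayley_graph_def carrier_dihedral)
  have small: "i = j" if "int n dvd i - j" "i \<in> {0..<int n}" "j \<in> {0..<int n}" for i j
    using that by (metis atLeastLessThan_iff mod_eq_dvd_iff mod_pos_pos_trivial)
  show "bij_betw g (verts (cayley_graph (dihedral n) (dih_refl n ` R))) (verts G)"
    unfolding bij_betw_def
  proof
    show "inj_on g (verts (cayley_graph (dihedral n) (dih_refl n ` R)))"
    proof (rule inj_onI)
      fix x y assume xy: "x \<in> verts (cayley_graph (dihedral n) (dih_refl n ` R))"
        "y \<in> verts (cayley_graph (dihedral n) (dih_refl n ` R))" "g x = g y"
      then have "snd x = snd y \<and> (int n dvd fst x - fst y \<or> int n dvd fst y - fst x)"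
        by (auto simp: g_def eq algebra_simps split: if_splits)
      then have "snd x = snd y" "int n dvd fst x - fst y" by (auto simp: dvd_diff_commute)
      moreover have "fst x \<in> {0..<int n}" "fst y \<in> {0..<int n}"
        using xy(1,2) unfolding carrier by (simp_all add: mem_Times_iff)
      ultimately have "fst x = fst y" "snd x = snd y" using small by blast+
      then show "x = y" by (simp add: prod_eq_iff)
    qed
    show "g ` verts (cayley_graph (dihedral n) (dih_refl n ` R)) = verts G"
    proof
      show "verts G \<subseteq> g ` verts (cayley_graph (dihedral n) (dih_refl n ` R))"
      proof
        fix v assume "v \<in> verts G"
        then obtain i c where v: "v = u i c" using verts by auto
        let ?x = "((if c then i else - i) mod int n, c)"
        have "int n dvd i - i mod int n" "int n dvd - i - (- i mod int n)"
          by (simp_all add: minus_mod_eq_mult_div)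
        then have "int n dvd i - i mod int n" "int n dvd i + (- i mod int n)"
          using dvd_minus_iff[of "int n" "i + (- i mod int n)"] by simp_all
        then have "g ?x = v" using n by (simp add: g_def v eq dvd_diff_commute)
        moreover have "?x \<in> verts (cayley_graph (dihedral n) (dih_refl n ` R))"
          unfolding carrier using n by simp
        ultimately show "v \<in> g ` verts (cayley_graph (dihedral n) (dih_refl n ` R))" by (metis imageI)
      qed
    qed (auto simp: g_def verts)
  qed
  fix x y
  assume "x \<in> verts (cayley_graph (dihedral n) (dih_refl n ` R))" "y \<in> verts (cayley_graph (dihedral n) (dih_refl n ` R))"
  then obtain i c j d where xy: "x = (i, c)" "y = (j, d)"
    and car: "(i, c) \<in> carrier (dihedral n)" "(j, d) \<in> carrier (dihedral n)"
    by (cases x; cases y) (auto simp: cayley_graph_def)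
  have R: "(k mod int n, b) \<in> dih_refl n ` R \<longleftrightarrow> b \<and> (\<exists>r\<in>R. int n dvd k - int r)" for k b
    using n by (auto simp: dih_refl_eq image_iff mod_eq_of_nat_iff)
  show "{g x, g y} \<in> edges G \<longleftrightarrow> {x, y} \<in> edges (cayley_graph (dihedral n) (dih_refl n ` R))"
    unfolding edges_cayley_graph xy dihedral_mult_inv[OF n car] dihedral_mult_inv[OF n car(2,1)] R
    using car same adj[of "- i" j] adj[of "- j" i]
    by (cases c; cases d) (auto simp: g_def insert_commute add.commute)
qed

lemma graph_iso_Sigma_graph:
  fixes u :: "int \<Rightarrow> int \<Rightarrow> bool \<Rightarrow> 'a"
  assumes n: "n > 0"
    and verts: "verts G = {u i z c | i z c. True}"
    and eq: "\<And>i j z w c d. u i z c = u j w d \<longleftrightarrow> c = d \<and> int n dvd i - j \<and> 3 dvd z - w"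
    and same: "\<And>i j z w c. {u i z c, u j w c} \<notin> edges G"
    and adj: "\<And>i j z w. {u i z False, u j w True} \<in> edges G \<longleftrightarrow>
      int n dvd j - i - 1 \<and> 3 dvd w - z \<or> int n dvd j - i \<and> \<not> 3 dvd w - z"
  shows "graph_iso G (Sigma_graph n)"
proof (rule graph_isoI_inverse)
  \<comment> \<open>The first index is negated on rotations, as in the purely dihedral case. The
    sign on the other coordinate turns its difference \<open>w - z\<close> into the
    \<open>z - w\<close> of the quotient of two group elements.\<close>
  define g where "g x = u (if snd (fst x) then fst (fst x) else - fst (fst x)) (- snd x) (snd (fst x))" for x
  let ?Z = "integer_mod_group 3"
  have carrier: "verts (Sigma_graph n) = ({0..<int n} \<times> UNIV) \<times> {0..<3}"
    using n by (simp add: Sigma_graph_def cayley_graph_def carrier_dihedral carrier_integer_mod_group)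
  have small: "i = j" if "m dvd i - j" "i \<in> {0..<m}" "j \<in> {0..<m}" for i j m :: int
    using that by (metis atLeastLessThan_iff mod_eq_dvd_iff mod_pos_pos_trivial)
  show "bij_betw g (verts (Sigma_graph n)) (verts G)"
    unfolding bij_betw_def
  proof
    show "inj_on g (verts (Sigma_graph n))"
    proof (rule inj_onI)
      fix x y assume xy: "x \<in> verts (Sigma_graph n)" "y \<in> verts (Sigma_graph n)" "g x = g y"
      then have "snd (fst x) = snd (fst y) \<and> 3 dvd snd y - snd x \<and>
          (int n dvd fst (fst x) - fst (fst y) \<or> int n dvd fst (fst y) - fst (fst x))"
        by (auto simp: g_def eq algebra_simps split: if_splits)
      then have *: "snd (fst x) = snd (fst y)" "3 dvd snd x - snd y" "int n dvd fst (fst x) - fst (fst y)"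
        by (auto simp: dvd_diff_commute)
      have "fst (fst x) \<in> {0..<int n}" "fst (fst y) \<in> {0..<int n}" "snd x \<in> {0..<3}" "snd y \<in> {0..<3}"
        using xy(1,2) unfolding carrier by (simp_all add: mem_Times_iff)
      then have "fst (fst x) = fst (fst y)" "snd x = snd y" using * small by blast+
      then show "x = y" using * by (simp add: prod_eq_iff)
    qed
    show "g ` verts (Sigma_graph n) = verts G"
    proof
      show "verts G \<subseteq> g ` verts (Sigma_graph n)"
      proof
        fix v assume "v \<in> verts G"
        then obtain i z c where v: "v = u i z c" using verts by auto
        let ?x = "(((if c then i else - i) mod int n, c), - z mod 3)"
        have "int n dvd i - i mod int n" "int n dvd - i - (- i mod int n)" "3 dvd - z - (- z mod 3)"
          by (simp_all add: minus_mod_eq_mult_div)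
        then have "int n dvd i - i mod int n" "int n dvd i + (- i mod int n)" "3 dvd z + (- z mod 3)"
          using dvd_minus_iff[of "int n" "i + (- i mod int n)"] dvd_minus_iff[of 3 "z + (- z mod 3)"]
          by simp_all
        then have "g ?x = v" using n by (simp add: g_def v eq dvd_diff_commute)
        moreover have "?x \<in> verts (Sigma_graph n)" unfolding carrier using n by simp
        ultimately show "v \<in> g ` verts (Sigma_graph n)" by (metis imageI)
      qed
    qed (auto simp: g_def verts)
  qed
  fix x y assume "x \<in> verts (Sigma_graph n)" "y \<in> verts (Sigma_graph n)"
  then obtain i c z j d w where xy: "x = ((i, c), z)" "y = ((j, d), w)"
    and car: "(i, c) \<in> carrier (dihedral n)" "(j, d) \<in> carrier (dihedral n)"
      "z \<in> carrier ?Z" "w \<in> carrier ?Z"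
    by (cases x; cases y) (auto simp: Sigma_graph_def cayley_graph_def)
  have sub: "((i, c), z) \<otimes>\<^bsub>dihedral n \<times>\<times> ?Z\<^esub> inv\<^bsub>dihedral n \<times>\<times> ?Z\<^esub> ((j, d), w)
     = ((i, c) \<otimes>\<^bsub>dihedral n\<^esub> inv\<^bsub>dihedral n\<^esub> (j, d), (z - w) mod 3)"
    if "(i, c) \<in> carrier (dihedral n)" "(j, d) \<in> carrier (dihedral n)"
      "z \<in> carrier ?Z" "w \<in> carrier ?Z" for i c z j d w
    using that group_dihedral[OF n]
    by (simp add: inv_DirProd inv_integer_mod_group mult_integer_mod_group mod_simps)
  have S: "((k mod int n, b), l mod 3) \<in> {(dih_refl n 1, 0), (dih_refl n 0, 1), (dih_refl n 0, 2)} \<longleftrightarrow>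
      b \<and> (int n dvd k - 1 \<and> 3 dvd l \<or> int n dvd k \<and> \<not> 3 dvd l)" for k b and l :: int
  proof -
    have "l mod 3 = 1 \<or> l mod 3 = 2 \<longleftrightarrow> \<not> 3 dvd l" "l mod 3 = 0 \<longleftrightarrow> 3 dvd l" by presburger+
    then show ?thesis
      using n mod_eq_of_nat_iff[of n k 1] mod_eq_of_nat_iff[of n k 0] by (auto simp: dih_refl_eq)
  qed
  show "{g x, g y} \<in> edges G \<longleftrightarrow> {x, y} \<in> edges (Sigma_graph n)"
    unfolding Sigma_graph_def edges_cayley_graph xy sub[OF car] sub[OF car(2,1,4,3)]
      dihedral_mult_inv[OF n car(1,2)] dihedral_mult_inv[OF n car(2,1)] S
    using car same adj[of "- i" "- z" j "- w"] adj[of "- j" "- w" i "- z"]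
      dvd_diff_commute[of 3 z w]
    by (cases c; cases d) (auto simp: g_def insert_commute add.commute)
qed

text \<open>The vertices of the honeycomb are the pairs of a lattice point and a colour, white (\<^const>\<open>False\<close>)
  or black (\<^const>\<open>True\<close>), and \<open>vert\<close> is the covering map onto \<open>G\<close>. The deck transformations are
  the translations by the lattice vectors that satisfy \<open>period\<close>.\<close>

locale honeycomb_quotient =
  fixes G :: "'a graph" and vert :: "int \<times> int \<Rightarrow> bool \<Rightarrow> 'a" and period :: "int \<times> int \<Rightarrow> bool"
  assumes finite_verts: "finite (verts G)"
    and verts_eq: "verts G = {vert p c | p c. True}"
    and vert_eq_iff: "vert p c = vert q d \<longleftrightarrow> c = d \<and> period (p - q)"
    and period_0: "period 0" and period_diff: "period p \<Longrightarrow> period q \<Longrightarrow> period (p - q)"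
    and adj: "{vert p False, vert q True} \<in> edges G \<longleftrightarrow>
      period (q - p) \<or> period (q - p - (1, 0)) \<or> period (q - p - (0, 1))"
    and same: "{vert p c, vert q c} \<notin> edges G"
    and simple: "\<not> period (1, 0)" "\<not> period (0, 1)" "\<not> period (1, -1)"
    and girth: "is_cycle G C \<Longrightarrow> length C \<ge> 6"
begin

lemma period_zero [simp]: "period 0" "period (0, 0)"
  using period_0 by (simp_all add: zero_prod_def)

lemma period_uminus: "period p \<Longrightarrow> period (- p)"
  using period_diff[OF period_0, of p] by simp

lemma period_add: "period p \<Longrightarrow> period q \<Longrightarrow> period (p + q)"
  using period_diff[of p "- q"] period_uminus[of q] by simp

lemma period_uminus_iff: "period (- p) \<longleftrightarrow> period p"
  using period_uminus[of p] period_uminus[of "- p"] by auto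

lemma period_add_iff: "period q \<Longrightarrow> period (p + q) \<longleftrightarrow> period p"
  using period_add[of p q] period_diff[of "p + q" q] by auto

lemma period_mult: "period (m, k) \<Longrightarrow> period (t * m, t * k)"
proof (induction t rule: int_induct[where k = 0])
  case base
  then show ?case using period_0 by (simp add: zero_prod_def)
next
  case (step1 t)
  then show ?case using period_add[of "(t * m, t * k)" "(m, k)"] by (simp add: algebra_simps)
next
  case (step2 t)
  then show ?case using period_diff[of "(t * m, t * k)" "(m, k)"] by (simp add: algebra_simps)
qed

section \<open>Relations between steps that the girth excludes\<close>

abbreviation "steps \<equiv> {(0, 0), (1, 0), (0, 1)} :: (int \<times> int) set"

lemma adj_steps: "{vert p False, vert q True} \<in> edges G \<longleftrightarrow> (\<exists>d\<in>steps. period (q - p - d))"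
  by (simp add: adj flip: zero_prod_def)

lemma steps_eq: "d \<in> steps \<Longrightarrow> d' \<in> steps \<Longrightarrow> period (d - d') \<longleftrightarrow> d = d'"
proof -
  assume d: "d \<in> steps" "d' \<in> steps"
  have "\<not> period (-1, 0)" "\<not> period (0, -1)" "\<not> period (-1, 1)"
    using simple period_uminus[of "(-1, 0)"] period_uminus[of "(0, -1)"] period_uminus[of "(-1, 1)"]
    by auto
  then show "period (d - d') \<longleftrightarrow> d = d'" using d simple by (elim insertE) simp_all
qed

lemma vert_in [simp]: "vert p c \<in> verts G"
  unfolding verts_eq by blast

text \<open>Walks add steps from white to black and subtract them from black to white, so a period
  of this form closes a walk on four vertices. Distinct consecutive steps keep these vertices
  distinct.\<close>

lemma no_4_cycle:
  assumes d: "d1 \<in> steps" "d2 \<in> steps" "d3 \<in> steps" "d4 \<in> steps"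
    and neq: "d1 \<noteq> d2" "d2 \<noteq> d3" "d3 \<noteq> d4" "d4 \<noteq> d1"
  shows "\<not> period (d1 - d2 + d3 - d4)"
proof
  assume per: "period (d1 - d2 + d3 - d4)"
  define C where "C = [vert 0 False, vert d1 True, vert (d1 - d2) False, vert (d1 - d2 + d3) True]"
  have edge: "{vert p False, vert (p + d) True} \<in> edges G" if "d \<in> steps" for p d
    using that period_0 unfolding adj_steps by (intro bexI[of _ d]) auto
  have last: "vert (d1 - d2 + d3) True = vert (0 + d4) True"
    using per unfolding vert_eq_iff by (simp add: algebra_simps)
  have "set (walk_edges C) \<subseteq> edges G"
    using edge[OF d(1), of 0] edge[OF d(2), of "d1 - d2"] edge[OF d(3), of "d1 - d2"] edge[OF d(4), of 0]
    unfolding last[symmetric] by (simp add: walk_edges_def C_def insert_commute upt_rec)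
  moreover have "distinct C"
    using steps_eq[OF d(1,2)] steps_eq[OF d(2,3)] neq period_uminus_iff[of "d2 - d3"] period_uminus_iff[of "d1 - d2"]
    by (auto simp: C_def vert_eq_iff algebra_simps)
  ultimately have "is_cycle G C"
    by (simp add: is_cycle_def closed_walk_def) (simp add: C_def)
  then have "length C \<ge> 6" by (rule girth)
  then show False by (simp add: C_def)
qed

text \<open>For distinct steps x, y, z these are the relations 2 x = 2 y and 2 x = y + z, each of
  them the closing condition of a 4-cycle.\<close>

lemma no_short_period:
  "\<not> period (2, 0)" "\<not> period (0, 2)" "\<not> period (2, -2)" "\<not> period (1, 1)" "\<not> period (2, -1)" "\<not> period (-1, 2)"
  using no_4_cycle[of "(1, 0)" "(0, 0)" "(1, 0)" "(0, 0)"] no_4_cycle[of "(0, 1)" "(0, 0)" "(0, 1)" "(0, 0)"]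
    no_4_cycle[of "(1, 0)" "(0, 1)" "(1, 0)" "(0, 1)"] no_4_cycle[of "(1, 0)" "(0, 0)" "(0, 1)" "(0, 0)"]
    no_4_cycle[of "(1, 0)" "(0, 0)" "(1, 0)" "(0, 1)"] no_4_cycle[of "(0, 1)" "(0, 0)" "(0, 1)" "(1, 0)"]
  by simp_all

text \<open>Two reflections of the honeycomb that generate all permutations of its three directions.\<close>

lemma transpose: "honeycomb_quotient G (\<lambda>p. vert (snd p, fst p)) (\<lambda>p. period (snd p, fst p))"
proof (unfold_locales)
  show "verts G = {vert (snd p, fst p) c |p c. True}" unfolding verts_eq by force
  show "period (snd p, fst p) \<Longrightarrow> period (snd q, fst q) \<Longrightarrow> period (snd (p - q), fst (p - q))" for p q
    using period_diff[of "(snd p, fst p)" "(snd q, fst q)"] by simp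
  show "\<not> period (snd (1, -1), fst (1, -1))"
    using simple(3) period_uminus_iff[of "(1, -1)"] by simp
qed (use finite_verts period_0 simple girth same in \<open>auto simp: vert_eq_iff adj zero_prod_def\<close>)

lemma shear: "honeycomb_quotient G
    (\<lambda>p c. if c then vert (1 - fst p - snd p, snd p) c else vert (- fst p - snd p, snd p) c)
    (\<lambda>p. period (- fst p - snd p, snd p))"
proof (unfold_locales)
  \<comment> \<open>The shift by 1 on black vertices only makes the reflection exchange the steps
    (0, 0) and (1, 0) and fix the step (0, 1).\<close>
  let ?v = "\<lambda>p c. if c then vert (1 - fst p - snd p, snd p) c else vert (- fst p - snd p, snd p) c"
  show "verts G = {?v p c |p c. True}"
  proof
    show "verts G \<subseteq> {?v p c |p c. True}"
    proof
      fix x assume "x \<in> verts G"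
      then obtain m k c where "x = vert (m, k) c" using verts_eq by auto
      then have "x = ?v (if c then (1 - m - k, k) else (- m - k, k)) c" by simp
      then show "x \<in> {?v p c |p c. True}" by blast
    qed
  qed auto
  show "period (- fst p - snd p, snd p) \<Longrightarrow> period (- fst q - snd q, snd q) \<Longrightarrow>
      period (- fst (p - q) - snd (p - q), snd (p - q))" for p q
    using period_diff[of "(- fst p - snd p, snd p)" "(- fst q - snd q, snd q)"] by (simp add: algebra_simps)
  show "{?v p False, ?v q True} \<in> edges G \<longleftrightarrow> period (- fst (q - p) - snd (q - p), snd (q - p)) \<or>
      period (- fst (q - p - (1, 0)) - snd (q - p - (1, 0)), snd (q - p - (1, 0))) \<or>
      period (- fst (q - p - (0, 1)) - snd (q - p - (0, 1)), snd (q - p - (0, 1)))" for p q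
    by (auto simp: adj algebra_simps)
qed (use finite_verts period_0 simple girth same period_uminus_iff[of "(1, 0)"] period_uminus_iff[of "(0, 1)"]
      period_uminus_iff[of "(1, -1)"] in
    \<open>auto simp: vert_eq_iff zero_prod_def algebra_simps\<close>)

section \<open>Recognition of the three families from the lattice of periods\<close>

lemma graph_iso_cyclic:
  assumes N: "N > 0" and period: "\<And>m k. period (m, k) \<longleftrightarrow> int N dvd int \<alpha> * m + int \<beta> * k"
    and unit: "int N dvd int \<alpha> * m\<^sub>0 + int \<beta> * k\<^sub>0 - 1"
  shows "graph_iso G (cayley_graph (dihedral N) {dih_refl N 0, dih_refl N \<alpha>, dih_refl N \<beta>})"
proof -
  \<comment> \<open>The periods are the kernel of the map from (m, k) to \<alpha> m + \<beta> k
    modulo N. The point \<open>(m\<^sub>0, k\<^sub>0)\<close> goes to 1, so its multiples represent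
    all classes; the three steps go to 0, \<alpha> and \<beta>.\<close>
  define u where "u i = vert (i * m\<^sub>0, i * k\<^sub>0)" for i
  have shift: "period (i * m\<^sub>0 - m, i * k\<^sub>0 - k) \<longleftrightarrow> int N dvd i - (int \<alpha> * m + int \<beta> * k)" for i m k
  proof -
    have "int \<alpha> * (i * m\<^sub>0 - m) + int \<beta> * (i * k\<^sub>0 - k)
        = i - (int \<alpha> * m + int \<beta> * k) + i * (int \<alpha> * m\<^sub>0 + int \<beta> * k\<^sub>0 - 1)"
      by (simp add: algebra_simps)
    then show ?thesis unfolding period using unit by (simp add: dvd_add_left_iff)
  qed
  have "graph_iso G (cayley_graph (dihedral N) (dih_refl N ` {0, \<alpha>, \<beta>}))"
  proof (rule graph_iso_cayley_dihedral[OF N, of _ u])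
    show "verts G = {u i c | i c. True}"
    proof
      show "verts G \<subseteq> {u i c | i c. True}"
      proof
        fix x assume "x \<in> verts G"
        then obtain m k c where x: "x = vert (m, k) c" using verts_eq by auto
        have "u (int \<alpha> * m + int \<beta> * k) c = x"
          using shift[of "int \<alpha> * m + int \<beta> * k" m k] unfolding u_def x vert_eq_iff by simp
        then show "x \<in> {u i c | i c. True}" by blast
      qed
    qed (auto simp: u_def)
    show "u i c = u j d \<longleftrightarrow> c = d \<and> int N dvd i - j" for i j c d
      using shift[of "i - j" 0 0] by (simp add: u_def vert_eq_iff algebra_simps)
    show "{u i False, u j True} \<in> edges G \<longleftrightarrow> (\<exists>r\<in>{0, \<alpha>, \<beta>}. int N dvd j - i - int r)" for i j
      using shift[of "j - i" 0 0] shift[of "j - i" 1 0] shift[of "j - i" 0 1]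
      by (simp add: u_def adj algebra_simps)
  qed (simp add: u_def same)
  then show ?thesis by simp
qed

text \<open>Two multiples of the vector reach the same white vertex because there are finitely many,
  so some positive multiple is a period. The least one divides all others by division with
  remainder.\<close>

lemma order_of_translation:
  obtains N :: nat where "N > 0" "\<And>i. period (i * m, i * k) \<longleftrightarrow> int N dvd i"
proof -
  define P where "P n \<longleftrightarrow> n > 0 \<and> period (int n * m, int n * k)" for n :: nat
  have "\<not> inj (\<lambda>n::nat. vert (int n * m, int n * k) False)"
  proof
    assume "inj (\<lambda>n::nat. vert (int n * m, int n * k) False)"
    moreover have "range (\<lambda>n::nat. vert (int n * m, int n * k) False) \<subseteq> verts G" by auto
    ultimately show False
      using finite_verts finite_subset finite_imageD infinite_UNIV_nat by metis
  qed
  then obtain i j :: nat where ij: "i < j" "vert (int i * m, int i * k) False = vert (int j * m, int j * k) False"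
    unfolding inj_def by (metis nat_neq_iff)
  have "period (- ((int i * m, int i * k) - (int j * m, int j * k)))"
    using ij(2) unfolding vert_eq_iff by (intro period_uminus) simp
  also have "- ((int i * m, int i * k) - (int j * m, int j * k)) = (int (j - i) * m, int (j - i) * k)"
    using ij(1) by (simp add: of_nat_diff less_imp_le left_diff_distrib)
  finally have "P (j - i)" using ij(1) by (simp add: P_def)
  then have N: "P (LEAST n. P n)" by (rule LeastI[of P])
  define N where "N = (LEAST n. P n)"
  have N': "N > 0" "period (int N * m, int N * k)" using N by (simp_all add: P_def N_def)
  have "int N dvd i" if per: "period (i * m, i * k)" for i
  proof (rule ccontr)
    assume "\<not> int N dvd i"
    then have "i mod int N \<noteq> 0" by (simp only: mod_eq_0_iff_dvd not_False_eq_True)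
    then have pos: "i mod int N > 0" using N' pos_mod_sign[of "int N" i] by linarith
    have "i mod int N = i - i div int N * int N" by (simp add: minus_div_mult_eq_mod)
    then have "period (i mod int N * m, i mod int N * k)"
      using period_diff[OF per period_mult[OF N'(2), of "i div int N"]]
      by (simp only: left_diff_distrib mult.assoc diff_Pair)
    then have "P (nat (i mod int N))" using pos by (simp add: P_def)
    then have "N \<le> nat (i mod int N)" unfolding N_def by (rule Least_le[of P])
    moreover have "i mod int N < int N" using N' by simp
    ultimately show False using pos by linarith
  qed
  moreover have "period (i * m, i * k)" if "int N dvd i" for i
    using that period_mult[OF N'(2)] by (auto simp: mult_ac elim!: dvdE)
  ultimately show thesis using that[of N] N' by blast
qed

text \<open>Modulo L the step (0, 1) is three times (1, 0). The quotient is therefore cyclic,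
  generated by (1, 0), and the steps become 0, 1 and 3.\<close>

lemma graph_iso_Psi_graph:
  assumes "period (3, -1)"
  shows "\<exists>n\<ge>7. graph_iso G (Psi_graph n)"
proof -
  obtain N :: nat where N: "N > 0" "\<And>i. period (i * 1, i * 0) \<longleftrightarrow> int N dvd i"
    using order_of_translation[of 1 0] by blast
  have red: "period (m, k) \<longleftrightarrow> int N dvd m + 3 * k" for m k
    using N(2)[of "m + 3 * k"] period_add_iff[OF period_mult[OF assms, of k], of "(m, k)"]
    by (simp add: mult.commute)
  \<comment> \<open>The numbers 1 to 6 are the values of m + 3 k at (1, 0), (2, 0), (0, 1), (1, 1),
    (-1, 2) and (0, 2), none of which is a period.\<close>
  have "\<not> int N dvd 1" "\<not> int N dvd 2" "\<not> int N dvd 3" "\<not> int N dvd 4" "\<not> int N dvd 5" "\<not> int N dvd 6"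
    using simple no_short_period by (simp_all add: red)
  then have "N \<noteq> 1" "N \<noteq> 2" "N \<noteq> 3" "N \<noteq> 4" "N \<noteq> 5" "N \<noteq> 6" by fastforce+
  then have "N \<ge> 7" using N(1) by linarith
  moreover have "graph_iso G (Psi_graph N)"
    unfolding Psi_graph_def
    using graph_iso_cyclic[OF N(1), of 1 3 1 0] red by simp
  ultimately show ?thesis by blast
qed

text \<open>The normal form of the lattice with basis (3, 0) and (-e, n), where n is the least
  positive second coordinate of a period.\<close>

lemma order_3_translation:
  assumes "period (3, 0)"
  obtains n :: nat and e :: int where "n > 0" "\<And>m k. period (m, k) \<longleftrightarrow> (\<exists>t. k = int n * t \<and> 3 dvd m + t * e)"
proof -
  define P where "P n \<longleftrightarrow> n > 0 \<and> (\<exists>e. period (- e, int n))" for n :: nat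
  obtain M :: nat where "M > 0" "\<And>i. period (i * 0, i * 1) \<longleftrightarrow> int M dvd i"
    using order_of_translation[of 0 1] by blast
  then have "P M" unfolding P_def by (metis add.inverse_neutral dvd_refl mult.right_neutral mult_zero_right)
  then have "P (LEAST n. P n)" by (rule LeastI[of P])
  then obtain e where n: "(LEAST n. P n) > 0" "period (- e, int (LEAST n. P n))" unfolding P_def by blast
  define n where "n = (LEAST n. P n)"
  note n = n[folded n_def]
  \<comment> \<open>The vector (1, 0) has order exactly 3, because (1, 0) and (2, 0) are not
    periods.\<close>
  have row: "period (m, 0) \<longleftrightarrow> 3 dvd m" for m
  proof
    assume per: "period (m, 0)"
    have "period (m mod 3, 0)"
      using period_diff[OF per period_mult[OF assms, of "m div 3"]] by (simp add: minus_div_mult_eq_mod)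
    moreover have "m mod 3 = 0 \<or> m mod 3 = 1 \<or> m mod 3 = 2" by presburger
    ultimately show "3 dvd m" using simple no_short_period by auto
  next
    assume "3 dvd m"
    then show "period (m, 0)" using period_mult[OF assms] by (auto simp: mult.commute elim!: dvdE)
  qed
  have shift: "period (m, int n * t) \<longleftrightarrow> 3 dvd m + t * e" for m t
    using row[of "m + t * e"] period_add_iff[OF period_mult[OF n(2), of "- t"], of "(m, int n * t)"]
    by (simp add: algebra_simps)
  have "period (m, k) \<longleftrightarrow> (\<exists>t. k = int n * t \<and> 3 dvd m + t * e)" for m k
  proof
    assume per: "period (m, k)"
    have "k mod int n = 0"
    proof (rule ccontr)
      assume "k mod int n \<noteq> 0"
      then have pos: "k mod int n > 0" using n(1) pos_mod_sign[of "int n" k] by linarith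
      have "k mod int n = k - k div int n * int n" by (simp add: minus_div_mult_eq_mod)
      then have "period (- (- m - k div int n * e), int (nat (k mod int n)))"
        using period_diff[OF per period_mult[OF n(2), of "k div int n"]] pos
        by (simp add: add.commute)
      then have "\<exists>e. period (- e, int (nat (k mod int n)))" by (rule exI)
      then have "P (nat (k mod int n))" using pos by (simp add: P_def)
      then have "n \<le> nat (k mod int n)" unfolding n_def by (rule Least_le[of P])
      moreover have "k mod int n < int n" using n by simp
      ultimately show False using pos by linarith
    qed
    then obtain t where "k = int n * t" by (auto simp: mod_eq_0_iff_dvd elim!: dvdE)
    then show "\<exists>t. k = int n * t \<and> 3 dvd m + t * e" using per shift by blast
  qed (use shift in blast)
  then show thesis using that n(1) by blast
qed

text \<open>Modulo (3, 0) the second basis vector of L is (n, n). In the basis (1, 1), (1, 0) the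
  lattice is a product, and the quotient splits into cyclic factors of order n and 3.\<close>

lemma graph_iso_Sigma_graph_of_period:
  assumes n: "n > 0" and per: "\<And>m k. period (m, k) \<longleftrightarrow> (\<exists>t. k = int n * t \<and> 3 dvd m + t * e)"
    and e: "3 dvd int n + e"
  shows "graph_iso G (Sigma_graph n)"
proof (rule graph_iso_Sigma_graph[OF n])
  \<comment> \<open>The shift by -1 on black vertices gives the steps (0, 0), (1, 0), (0, 1) the
    coordinates (0, 1), (0, 2), (1, 0), which match the connection set of \<Sigma>.\<close>
  define u where "u i z c = (if c then vert (i + z - 1, i) c else vert (i + z, i) c)" for i z c
  have per': "period (i + z, i) \<longleftrightarrow> int n dvd i \<and> 3 dvd z" for i z
  proof -
    have "3 dvd int n * t + z + t * e \<longleftrightarrow> 3 dvd z" for t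
    proof -
      have "int n * t + z + t * e = z + t * (int n + e)" by (simp add: algebra_simps)
      also have "3 dvd \<dots> \<longleftrightarrow> 3 dvd z" using e by (intro dvd_add_left_iff dvd_mult)
      finally show ?thesis .
    qed
    then show ?thesis unfolding per dvd_def[of "int n" i] by auto
  qed
  show "verts G = {u i z c | i z c. True}"
  proof
    show "verts G \<subseteq> {u i z c | i z c. True}"
    proof
      fix x assume "x \<in> verts G"
      then obtain m k c where "x = vert (m, k) c" using verts_eq by auto
      then have "x = u k (if c then m - k + 1 else m - k) c" by (simp add: u_def)
      then show "x \<in> {u i z c | i z c. True}" by blast
    qed
  qed (auto simp: u_def)
  show "u i z c = u j w d \<longleftrightarrow> c = d \<and> int n dvd i - j \<and> 3 dvd z - w" for i j z w c d
    using per'[of "i - j" "z - w"] by (auto simp: u_def vert_eq_iff algebra_simps)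
  show "{u i z c, u j w c} \<notin> edges G" for i j z w c
    using same by (simp add: u_def)
  show "{u i z False, u j w True} \<in> edges G \<longleftrightarrow>
      int n dvd j - i - 1 \<and> 3 dvd w - z \<or> int n dvd j - i \<and> \<not> 3 dvd w - z" for i j z w
  proof -
    have "\<not> 3 dvd w - z \<longleftrightarrow> 3 dvd w - z - 1 \<or> 3 dvd w - z - 2" by presburger
    then show ?thesis
      using per'[of "j - i" "w - z - 1"] per'[of "j - i" "w - z - 2"] per'[of "j - i - 1" "w - z"]
      by (auto simp: u_def adj algebra_simps)
  qed
qed

text \<open>Here L is generated by (3, 0) and (0, n). As 3 and n are coprime, the quotient is cyclic
  by the Chinese remainder theorem, via n m + 3 k modulo 3 n.\<close>

lemma graph_iso_Delta_graph_0:
  assumes n: "n > 0" and per: "\<And>m k. period (m, k) \<longleftrightarrow> (\<exists>t. k = int n * t \<and> 3 dvd m + t * e)"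
    and e: "3 dvd e" "\<not> 3 dvd n"
  shows "graph_iso G (Delta_graph n)"
proof -
  have coprime: "coprime (3::int) (int n)" "coprime (3::nat) n"
    using e(2) by (auto simp: prime_imp_coprime prime_int_numeral_eq coprime_int_iff[of 3 n, simplified])
  obtain x y where xy: "int n * x + 3 * y = 1"
    using coprime(1) by (metis add.commute bezout_int coprime_iff_gcd_eq_1 mult.commute)
  have "period (m, k) \<longleftrightarrow> int (3 * n) dvd int n * m + int 3 * k" for m k
  proof
    assume "period (m, k)"
    then obtain t where "k = int n * t" "3 dvd m + t * e" unfolding per by blast
    then have "3 dvd m" using e(1) by (simp add: dvd_add_left_iff)
    then show "int (3 * n) dvd int n * m + int 3 * k" using \<open>k = int n * t\<close> by (auto elim!: dvdE)
  next
    assume *: "int (3 * n) dvd int n * m + int 3 * k"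
    then have "3 dvd int n * m + 3 * k" "int n dvd int n * m + 3 * k"
      by (auto intro: dvd_trans[rotated])
    then have "3 dvd int n * m" "int n dvd 3 * k" by (simp_all add: dvd_add_left_iff dvd_add_right_iff)
    then have "3 dvd m" "int n dvd k"
      using coprime(1) by (simp_all add: coprime_dvd_mult_right_iff coprime_commute)
    then show "period (m, k)" unfolding per using e(1) by (auto elim!: dvdE)
  qed
  from graph_iso_cyclic[OF _ this, of x y] xy n
  have "graph_iso G (cayley_graph (dihedral (3 * n)) {dih_refl (3 * n) 0, dih_refl (3 * n) n, dih_refl (3 * n) 3})"
    by simp
  moreover have "3 div gcd 3 n = 3" using coprime(2) by simp
  ultimately show ?thesis unfolding Delta_graph_def by (simp add: insert_commute)
qed

text \<open>Now n times (0, 1) equals (1, 0) modulo L, so (0, 1) generates a cyclic quotient of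
  order 3 n in which (1, 0) is n.\<close>

lemma graph_iso_Delta_graph_1:
  assumes n: "n > 0" and per: "\<And>m k. period (m, k) \<longleftrightarrow> (\<exists>t. k = int n * t \<and> 3 dvd m + t * e)"
    and e: "3 dvd e - 1" "3 dvd n"
  shows "graph_iso G (Delta_graph n)"
proof -
  have "period (m, k) \<longleftrightarrow> int (3 * n) dvd int n * m + int 1 * k" for m k
  proof
    assume "period (m, k)"
    then obtain t where t: "k = int n * t" "3 dvd m + t * e" unfolding per by blast
    have "m + t = m + t * e - t * (e - 1)" by (simp add: algebra_simps)
    then have "3 dvd m + t" using t e(1) by (metis dvd_diff dvd_mult)
    then have "int n * 3 dvd int n * (m + t)" by (rule mult_dvd_mono[OF dvd_refl])
    then show "int (3 * n) dvd int n * m + int 1 * k" using t by (simp add: algebra_simps)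
  next
    assume *: "int (3 * n) dvd int n * m + int 1 * k"
    then have "int n dvd int n * m + k" by (auto intro: dvd_trans[rotated])
    then obtain t where t: "k = int n * t" by (auto simp: dvd_add_right_iff elim!: dvdE)
    with * have "int n * 3 dvd int n * (m + t)" by (simp add: algebra_simps)
    then have "3 dvd m + t" using n by simp
    moreover have "m + t * e = m + t + t * (e - 1)" by (simp add: algebra_simps)
    ultimately have "3 dvd m + t * e" using e(1) by (metis dvd_add dvd_mult)
    then show "period (m, k)" unfolding per using t by blast
  qed
  from graph_iso_cyclic[OF _ this, of 0 1] n
  have "graph_iso G (cayley_graph (dihedral (3 * n)) {dih_refl (3 * n) 0, dih_refl (3 * n) n, dih_refl (3 * n) 1})"
    by simp
  moreover have "3 div gcd 3 n = 1" using e(2) by (simp add: gcd_nat.absorb1)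
  ultimately show ?thesis unfolding Delta_graph_def by (simp add: insert_commute)
qed

end

section \<open>Every exceptional period leads to one of the families\<close>

definition in_families :: "'a graph \<Rightarrow> bool" where
  "in_families G \<longleftrightarrow> (\<exists>n\<ge>7. graph_iso G (Psi_graph n)) \<or> (\<exists>n\<ge>3. graph_iso G (Sigma_graph n)) \<or>
    (\<exists>n\<ge>4. graph_iso G (Delta_graph n))"

context honeycomb_quotient begin

lemma in_families_Delta:
  assumes n: "n \<ge> 3" and per: "\<And>m k. period (m, k) \<longleftrightarrow> (\<exists>t. k = int n * t \<and> 3 dvd m + t * e)"
    and e: "3 dvd n \<and> 3 dvd e - 1 \<or> \<not> 3 dvd n \<and> 3 dvd e"
  shows "in_families G"
proof (cases "n = 3")
  case True
  interpret T: honeycomb_quotient G "\<lambda>p. vert (snd p, fst p)" "\<lambda>p. period (snd p, fst p)"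
    by (rule transpose)
  \<comment> \<open>For n = 3 the assumption forces e = 1 modulo 3, and after exchanging coordinates
    this period is the defining relation of \<Psi>.\<close>
  have "period (-1, 3)" unfolding per using e True by (intro exI[of _ 1]) auto
  then have "\<exists>n\<ge>7. graph_iso G (Psi_graph n)" using T.graph_iso_Psi_graph by simp
  then show ?thesis unfolding in_families_def by blast
next
  case False
  then have "n \<ge> 4" "n > 0" using n by auto
  moreover have "graph_iso G (Delta_graph n)"
    using e graph_iso_Delta_graph_0[OF \<open>n > 0\<close> per] graph_iso_Delta_graph_1[OF \<open>n > 0\<close> per] by blast
  ultimately show ?thesis unfolding in_families_def by blast
qed

text \<open>The reflection \<open>shear\<close> keeps n and replaces e by n - e. If n is not
  divisible by 3, then e is -n, 0 or n modulo 3; otherwise e is 0, 1 or 2. In both cases the first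
  value gives \<Sigma>, the second \<Delta>, and the third becomes the second after the
  reflection.\<close>

lemma in_families_of_order_3:
  assumes "period (3, 0)"
  shows "in_families G"
proof -
  obtain n :: nat and e :: int where n: "n > 0"
    and per: "\<And>m k. period (m, k) \<longleftrightarrow> (\<exists>t. k = int n * t \<and> 3 dvd m + t * e)"
    using order_3_translation[OF assms] by blast
  have perI: "3 dvd m + e \<Longrightarrow> period (m, int n)" for m
    unfolding per by (rule exI[of _ 1]) simp
  have e3: "3 dvd e \<or> 3 dvd e - 1 \<or> 3 dvd e - 2" by presburger
  \<comment> \<open>For n = 1 and n = 2, each residue of e modulo 3 would produce a period excluded
    by the girth.\<close>
  have "n \<noteq> 1"
    using perI[of 0] perI[of "-1"] perI[of 1] e3 simple no_short_period(4) period_uminus[of "(-1, 1)"]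
    by auto presburger
  moreover have "n \<noteq> 2"
    using perI[of 0] perI[of "-1"] perI[of "-2"] e3 no_short_period period_uminus[of "(-2, 2)"] by auto
  ultimately have n3: "n \<ge> 3" using n by simp
  interpret S: honeycomb_quotient G
    "\<lambda>p c. if c then vert (1 - fst p - snd p, snd p) c else vert (- fst p - snd p, snd p) c"
    "\<lambda>p. period (- fst p - snd p, snd p)"
    by (rule shear)
  have per': "period (- fst (m, k) - snd (m, k), snd (m, k)) \<longleftrightarrow>
      (\<exists>t. k = int n * t \<and> 3 dvd m + t * (int n - e))" for m k
  proof -
    have "3 dvd - m - int n * t + t * e \<longleftrightarrow> 3 dvd m + t * (int n - e)" for t
      using dvd_minus_iff[of 3 "m + t * (int n - e)"] by (simp add: algebra_simps)
    then show ?thesis unfolding per by auto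
  qed
  have "3 dvd n \<longleftrightarrow> 3 dvd int n" by presburger
  moreover have "3 dvd N + e \<or> (3 dvd N \<and> 3 dvd e - 1 \<or> \<not> 3 dvd N \<and> 3 dvd e) \<or>
      (3 dvd N \<and> 3 dvd (N - e) - 1 \<or> \<not> 3 dvd N \<and> 3 dvd N - e)" for N
    by presburger
  ultimately consider "3 dvd int n + e" | "3 dvd n \<and> 3 dvd e - 1 \<or> \<not> 3 dvd n \<and> 3 dvd e"
    | "3 dvd n \<and> 3 dvd (int n - e) - 1 \<or> \<not> 3 dvd n \<and> 3 dvd int n - e"
    by metis
  then show ?thesis
  proof cases
    case 1
    then have "graph_iso G (Sigma_graph n)" using graph_iso_Sigma_graph_of_period[OF n per] by blast
    then show ?thesis using n3 unfolding in_families_def by blast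
  next
    case 2
    then show ?thesis using in_families_Delta[OF n3 per] by blast
  next
    case 3
    then show ?thesis using S.in_families_Delta[OF n3 per'] by blast
  qed
qed

text \<open>The orbits of the two basic relations under permuting the steps: three relations 3 x = 3
  y and six relations 3 x = 2 y + z. Composites of the two reflections reduce each to (3, 0) or (3,
  -1).\<close>

lemma in_families_of_period:
  assumes "period (3, 0) \<or> period (0, 3) \<or> period (3, -3) \<or> period (3, -1) \<or> period (3, -2) \<or> period (-1, 3) \<or>
    period (-2, 3) \<or> period (-2, -1) \<or> period (-1, -2)"
  shows "in_families G"
proof -
  interpret T: honeycomb_quotient G "\<lambda>p. vert (snd p, fst p)" "\<lambda>p. period (snd p, fst p)"
    by (rule transpose)
  interpret S: honeycomb_quotient G
    "\<lambda>p c. if c then vert (1 - fst p - snd p, snd p) c else vert (- fst p - snd p, snd p) c"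
    "\<lambda>p. period (- fst p - snd p, snd p)"
    by (rule shear)
  note shears = S.transpose T.shear honeycomb_quotient.transpose[OF T.shear]
  have three: "period (3, 0) \<Longrightarrow> in_families G" "period (0, 3) \<Longrightarrow> in_families G"
    "period (-3, 3) \<Longrightarrow> in_families G"
    using in_families_of_order_3 T.in_families_of_order_3
      honeycomb_quotient.in_families_of_order_3[OF S.transpose] by simp_all
  have Psi: "period (3, -1) \<Longrightarrow> in_families G" "period (-1, 3) \<Longrightarrow> in_families G"
    "period (-2, -1) \<Longrightarrow> in_families G" "period (-2, 3) \<Longrightarrow> in_families G"
    "period (-1, -2) \<Longrightarrow> in_families G" "period (3, -2) \<Longrightarrow> in_families G"
    using graph_iso_Psi_graph T.graph_iso_Psi_graph S.graph_iso_Psi_graph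
      shears[THEN honeycomb_quotient.graph_iso_Psi_graph]
    by (simp_all add: in_families_def)
  have "period (3, -3) \<Longrightarrow> period (-3, 3)" using period_uminus[of "(3, -3)"] by simp
  with three Psi assms show ?thesis by blast
qed

text \<open>Cancel steps common to s1, s3, s5 and s2, s4, s6. A nonempty remainder is a relation x =
  y, a relation of a 4-cycle, or one of the nine that lead to a family. If everything cancels,
  distinctness of neighbours forces s1, s3, s5 to be all different, and each of s2, s4, s6 is the
  step that its two neighbours omit.\<close>

lemma hexagon_steps:
  assumes none: "\<not> in_families G"
    and s: "s1 \<in> steps" "s2 \<in> steps" "s3 \<in> steps" "s4 \<in> steps" "s5 \<in> steps" "s6 \<in> steps"
    and neq: "s1 \<noteq> s2" "s2 \<noteq> s3" "s3 \<noteq> s4" "s4 \<noteq> s5" "s5 \<noteq> s6" "s6 \<noteq> s1"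
    and per: "period (s1 - s2 + s3 - s4 + s5 - s6)"
  shows "s4 = s1 \<and> s5 = s2 \<and> s6 = s3 \<and> s1 \<noteq> s3"
proof -
  have bad: "\<not> period (3, 0)" "\<not> period (0, 3)" "\<not> period (3, -3)" "\<not> period (3, -1)"
    "\<not> period (3, -2)" "\<not> period (-1, 3)" "\<not> period (-2, 3)" "\<not> period (-2, -1)" "\<not> period (-1, -2)"
    using in_families_of_period none by blast+
  have bad': "\<not> period (-3, 0)" "\<not> period (0, -3)" "\<not> period (-3, 3)" "\<not> period (-3, 1)"
    "\<not> period (-3, 2)" "\<not> period (1, -3)" "\<not> period (2, -3)" "\<not> period (2, 1)" "\<not> period (1, 2)"
    "\<not> period (-2, 0)" "\<not> period (0, -2)" "\<not> period (-2, 2)"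
    using bad no_short_period period_uminus[of "(-3, 0)"] period_uminus[of "(0, -3)"]
      period_uminus[of "(-3, 3)"] period_uminus[of "(-3, 1)"] period_uminus[of "(-3, 2)"]
      period_uminus[of "(1, -3)"] period_uminus[of "(2, -3)"] period_uminus[of "(2, 1)"]
      period_uminus[of "(1, 2)"] period_uminus[of "(-2, 0)"] period_uminus[of "(0, -2)"]
      period_uminus[of "(-2, 2)"] by auto
  show ?thesis
    using s(1)
  proof (elim insertE emptyE)
    assume 1: "s1 = (0, 0)"
    show ?thesis using s(2-6) neq per bad bad' no_short_period unfolding 1
      by (elim insertE emptyE) simp_all
  next
    assume 1: "s1 = (1, 0)"
    show ?thesis using s(2-6) neq per bad bad' no_short_period unfolding 1
      by (elim insertE emptyE) simp_all
  next
    assume 1: "s1 = (0, 1)"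
    show ?thesis using s(2-6) neq per bad bad' no_short_period unfolding 1
      by (elim insertE emptyE) simp_all
  qed
qed

section \<open>Six-cycles in the quotient of the honeycomb\<close>

lemma white_neighbour:
  assumes "{vert p False, v} \<in> edges G" "v \<in> verts G"
  obtains d where "d \<in> steps" "v = vert (p + d) True"
proof -
  obtain q c where v: "v = vert q c" using assms(2) unfolding verts_eq by blast
  then have c: "c = True" using assms(1) same[of p False q] by (cases c) simp_all
  then obtain d where "d \<in> steps" "period (q - p - d)" using assms(1) unfolding v c adj_steps by blast
  then show thesis using that[of d] by (simp add: v c vert_eq_iff algebra_simps)
qed

lemma black_neighbour:
  assumes "{vert q True, v} \<in> edges G" "v \<in> verts G"
  obtains d where "d \<in> steps" "v = vert (q - d) False"
proof -
  obtain p c where v: "v = vert p c" using assms(2) unfolding verts_eq by blast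
  then have c: "c = False" using assms(1) same[of q True p] by (cases c) simp_all
  then obtain d where d: "d \<in> steps" "period (q - p - d)"
    using assms(1) adj_steps[of p q] unfolding v c by (auto simp: insert_commute)
  have "p - (q - d) = - (q - p - d)" by simp
  then show thesis using that[of d] d period_uminus[OF d(2)] by (simp only: v c vert_eq_iff)
qed

lemma six_cycle:
  assumes none: "\<not> in_families G" and C: "is_cycle G C" "length C = 6" "C ! 0 = vert p False"
  obtains x y z where "x \<in> steps" "y \<in> steps" "z \<in> steps" "x \<noteq> y" "y \<noteq> z" "x \<noteq> z"
    "C = [vert p False, vert (p + x) True, vert (p + x - y) False, vert (p + x - y + z) True,
      vert (p - y + z) False, vert (p + z) True]"
proof -
  have "length C = Suc (Suc (Suc (Suc (Suc (Suc 0)))))" using C(2) by simp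
  then obtain v0 v1 v2 v3 v4 v5 where C_eq: "C = [v0, v1, v2, v3, v4, v5]"
    by (auto simp: length_Suc_conv)
  have "distinct C" "set C \<subseteq> verts G" "set (walk_edges C) \<subseteq> edges G"
    using C by (auto simp: is_cycle_def closed_walk_def)
  then have dist: "distinct [v0, v1, v2, v3, v4, v5]" and verts: "v0 \<in> verts G" "v1 \<in> verts G" "v2 \<in> verts G"
    "v3 \<in> verts G" "v4 \<in> verts G" "v5 \<in> verts G"
    and edges: "{v0, v1} \<in> edges G" "{v1, v2} \<in> edges G" "{v2, v3} \<in> edges G" "{v3, v4} \<in> edges G"
      "{v4, v5} \<in> edges G" "{v5, v0} \<in> edges G"
    by (simp_all add: C_eq walk_edges_def upt_rec)
  have v0: "v0 = vert p False" using C(3) by (simp add: C_eq)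
  obtain s1 where s1: "s1 \<in> steps" "v1 = vert (p + s1) True"
    using white_neighbour edges(1) verts v0 by metis
  obtain s2 where s2: "s2 \<in> steps" "v2 = vert (p + s1 - s2) False"
    using black_neighbour edges(2) verts s1 by metis
  obtain s3 where s3: "s3 \<in> steps" "v3 = vert (p + s1 - s2 + s3) True"
    using white_neighbour edges(3) verts s2 by metis
  obtain s4 where s4: "s4 \<in> steps" "v4 = vert (p + s1 - s2 + s3 - s4) False"
    using black_neighbour edges(4) verts s3 by metis
  obtain s5 where s5: "s5 \<in> steps" "v5 = vert (p + s1 - s2 + s3 - s4 + s5) True"
    using white_neighbour edges(5) verts s4 by metis
  obtain s6 where s6: "s6 \<in> steps" "v0 = vert (p + s1 - s2 + s3 - s4 + s5 - s6) False"
    using black_neighbour edges(6) verts s5 by metis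
  have per: "period (s1 - s2 + s3 - s4 + s5 - s6)"
    using s6(2) unfolding v0 vert_eq_iff
    using period_uminus_iff[of "s1 - s2 + s3 - s4 + s5 - s6"] by (simp add: algebra_simps)
  \<comment> \<open>If s6 were s1, the closing relation would identify v5 with v1; the closing turn
    of the cycle thus also has two different steps.\<close>
  have "period (s1 - s2 + s3 - s4 + s5 - s6 + (s6 - s1))" if "s6 = s1"
    using per that by simp
  then have "v5 = v1" if "s6 = s1"
    using per that unfolding s1 s5 vert_eq_iff by (simp add: algebra_simps)
  then have neq: "s1 \<noteq> s2" "s2 \<noteq> s3" "s3 \<noteq> s4" "s4 \<noteq> s5" "s5 \<noteq> s6" "s6 \<noteq> s1"
    using dist s6(2) unfolding v0 s1(2) s2(2) s3(2) s4(2) s5(2) by auto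
  from hexagon_steps[OF none s1(1) s2(1) s3(1) s4(1) s5(1) s6(1) this per]
  have eq: "s4 = s1" "s5 = s2" "s6 = s3" "s1 \<noteq> s3" by auto
  show thesis
    by (rule that[of s1 s2 s3])
      (use s1 s2 s3 s4 s5 neq eq in \<open>simp_all add: C_eq v0 algebra_simps\<close>)
qed

text \<open>The two neighbours of the first vertex determine the steps x and z, and y is the
  remaining one. A 6-cycle is thus identified by a path of length 2 centred at a white
  vertex.\<close>

lemma six_cycle_unique:
  assumes none: "\<not> in_families G" and C: "is_cycle G C" "length C = 6"
    and D: "is_cycle G D" "length D = 6"
    and p: "C ! 0 = vert p False" and eq: "D ! 0 = C ! 0" "D ! 1 = C ! 1" "D ! 5 = C ! 5"
  shows "D = C"
proof -
  obtain x y z where x: "x \<in> steps" "y \<in> steps" "z \<in> steps" "x \<noteq> y" "y \<noteq> z" "x \<noteq> z"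
    "C = [vert p False, vert (p + x) True, vert (p + x - y) False, vert (p + x - y + z) True,
      vert (p - y + z) False, vert (p + z) True]"
    using six_cycle[OF none C p] by blast
  obtain x' y' z' where x': "x' \<in> steps" "y' \<in> steps" "z' \<in> steps" "x' \<noteq> y'" "y' \<noteq> z'" "x' \<noteq> z'"
    "D = [vert p False, vert (p + x') True, vert (p + x' - y') False, vert (p + x' - y' + z') True,
      vert (p - y' + z') False, vert (p + z') True]"
    using six_cycle[OF none D eq(1)[unfolded p]] by blast
  have "vert (p + x') True = vert (p + x) True" "vert (p + z') True = vert (p + z) True"
    using eq(2,3) unfolding x(7) x'(7) by simp_all
  then have "period (x' - x)" "period (z' - z)" unfolding vert_eq_iff by simp_all
  then have "x' = x" "z' = z" using steps_eq x x' by blast+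
  moreover from this have "y' = y" using x x' by auto
  ultimately show ?thesis using x(7) x'(7) by simp
qed

lemma white_or_black: "v \<in> verts G \<Longrightarrow> (\<exists>p. v = vert p False) \<or> (\<exists>q. v = vert q True)"
  unfolding verts_eq by (auto) (metis (full_types))

lemma black_neighbour_white: "{vert q True, v} \<in> edges G \<Longrightarrow> v \<in> verts G \<Longrightarrow> \<exists>p. v = vert p False"
  using black_neighbour by metis

end

section \<open>The honeycomb covers the map\<close>

text \<open>A 2-cycle would leave only one further element, which would have to be fixed; hence the
  permutation is a 3-cycle.\<close>

lemma fixed_point_free_3:
  assumes N: "card N = 3" and \<pi>: "\<pi> ` N \<subseteq> N" "inj_on \<pi> N" "\<And>x. x \<in> N \<Longrightarrow> \<pi> x \<noteq> x" and x: "x \<in> N"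
  shows "\<pi> (\<pi> (\<pi> x)) = x" "N = {x, \<pi> x, \<pi> (\<pi> x)}"
proof -
  have fin: "finite N" using N by (metis card.infinite zero_neq_numeral)
  have in_N: "\<pi> y \<in> N" if "y \<in> N" for y using \<pi>(1) that by blast
  have inj: "y = z" if "\<pi> y = \<pi> z" "y \<in> N" "z \<in> N" for y z using \<pi>(2) that by (auto dest: inj_onD)
  have "\<pi> (\<pi> x) \<noteq> x"
  proof
    assume 2: "\<pi> (\<pi> x) = x"
    have "card {x, \<pi> x} \<noteq> card N" using N by (simp add: card_insert_if)
    moreover have "{x, \<pi> x} \<subseteq> N" using x in_N by blast
    ultimately have "\<exists>y\<in>N. y \<noteq> x \<and> y \<noteq> \<pi> x" by (metis insert_iff singletonD subsetI subset_antisym)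
    then obtain y where y: "y \<in> N" "y \<noteq> x" "y \<noteq> \<pi> x" by blast
    have "\<pi> y \<noteq> x" "\<pi> y \<noteq> \<pi> x" "\<pi> y \<noteq> y" using y x 2 inj[of y x] inj[of y "\<pi> x"] in_N \<pi>(3) by auto
    then have "card {x, \<pi> x, y, \<pi> y} = 4" using y \<pi>(3)[OF x] by auto
    moreover have "{x, \<pi> x, y, \<pi> y} \<subseteq> N" using x y in_N by blast
    ultimately show False using N card_mono[OF fin, of "{x, \<pi> x, y, \<pi> y}"] by simp
  qed
  then have "card {x, \<pi> x, \<pi> (\<pi> x)} = 3"
    using \<pi>(3)[OF x] \<pi>(3)[OF in_N[OF x]] by (auto simp: card_insert_if)
  then show eq: "N = {x, \<pi> x, \<pi> (\<pi> x)}"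
    using card_subset_eq[OF fin, of "{x, \<pi> x, \<pi> (\<pi> x)}"] N x in_N by auto
  have "\<pi> (\<pi> (\<pi> x)) \<in> {x, \<pi> x, \<pi> (\<pi> x)}" using x in_N eq by blast
  moreover have "\<pi> (\<pi> (\<pi> x)) \<noteq> \<pi> (\<pi> x)" "\<pi> (\<pi> (\<pi> x)) \<noteq> \<pi> x"
    using \<pi>(3)[OF in_N[OF in_N[OF x]]] in_N x inj[of "\<pi> (\<pi> x)" x] \<open>\<pi> (\<pi> x) \<noteq> x\<close> by auto
  ultimately show "\<pi> (\<pi> (\<pi> x)) = x" by blast
qed

locale dart_system = based_hex_darts D f prod.swap d\<^sub>0
  for D :: "('a \<times> 'a) set" and f and d\<^sub>0 +
  fixes G :: "'a graph"
  assumes D_eq: "D = {(u, v). {u, v} \<in> edges G}"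
    and graph: "finite_connected_graph G" and cubic: "regular_graph 3 G"
    and girth: "is_cycle G C \<Longrightarrow> length C \<ge> 6"
    and fst_f: "d \<in> D \<Longrightarrow> fst (f d) = snd d"
    and vertex_orbit: "d \<in> D \<Longrightarrow> d' \<in> D \<Longrightarrow> fst d' = fst d \<Longrightarrow>
      d' \<in> {d, f (prod.swap d), f (prod.swap (f (prod.swap d)))}"
begin

lemma fst_rot: "d \<in> D \<Longrightarrow> fst (f (prod.swap d)) = fst d"
  by (simp add: fst_f)

lemma fst_in_verts: "d \<in> D \<Longrightarrow> fst d \<in> verts G"
  using graph unfolding D_eq finite_connected_graph_def by auto

text \<open>The darts with coordinates are closed under f and reversal, hence contain all darts at a
  vertex as soon as they contain one. Connectedness of the graph carries this to every
  vertex.\<close>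

lemma dart_surj:
  assumes "d \<in> D"
  obtains p j where "d = dart p j"
proof -
  define R where "R = {dart p j | p j. True}"
  have R_I: "dart p j \<in> R" for p j unfolding R_def by blast
  have R_f: "f x \<in> R" if "x \<in> R" for x
  proof -
    obtain p j where "x = dart p j" using \<open>x \<in> R\<close> unfolding R_def by blast
    then show ?thesis using f_dart[of p j] R_I[of p "Suc j"] by simp
  qed
  have R_s: "prod.swap x \<in> R" if "x \<in> R" for x
  proof -
    obtain p j where "x = dart p j" using \<open>x \<in> R\<close> unfolding R_def by blast
    then show ?thesis using s_dart[of p j] R_I[of "p + hex_unit j" "j + 3"] by simp
  qed
  have R_orbit: "d' \<in> R" if "x \<in> R" "d' \<in> D" "fst d' = fst x" for x d'
  proof -
    have "x \<in> D" using that(1) by (auto simp: R_def)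
    then have "d' \<in> {x, f (prod.swap x), f (prod.swap (f (prod.swap x)))}"
      using vertex_orbit that by blast
    then show ?thesis using that(1) R_f R_s by blast
  qed
  have "d\<^sub>0 = dart 0 0" by (simp add: dart_def)
  then have d0: "d\<^sub>0 \<in> R" using R_I by metis
  have "(fst d\<^sub>0, fst d) \<in> {(x, y). {x, y} \<in> edges G}\<^sup>*"
    using graph fst_in_verts[OF assms] fst_in_verts[OF d0_in] unfolding finite_connected_graph_def by blast
  then have "\<forall>d'\<in>D. fst d' = fst d \<longrightarrow> d' \<in> R"
  proof (induction rule: rtrancl_induct)
    case base
    then show ?case using R_orbit[OF d0] by blast
  next
    case (step u v)
    then have "(u, v) \<in> R" by (auto simp: D_eq)
    then have "(v, u) \<in> R" using R_s by fastforce
    then show ?case using R_orbit by auto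
  qed
  then have "d \<in> R" using assms by blast
  then show thesis using that by (auto simp: R_def)
qed

lemma dart_rot: "f (prod.swap (dart p j)) = dart (p + hex_unit j) (j + 4)"
  by (simp add: s_dart f_dart eval_nat_numeral)

lemma fst_dart_rot: "fst (dart p j) = fst (dart (p + hex_unit j) (j + 4))"
  using fst_rot[OF dart_in[of p j]] by (simp add: dart_rot)

lemma snd_dart: "snd (dart p j) = fst (dart p (Suc j))"
  using fst_f[OF dart_in[of p j]] by (simp add: f_dart)

text \<open>A face of the honeycomb has six corners and a vertex lies on three faces, so two corners
  per face suffice to name all vertices.\<close>

definition white where "white p = fst (dart p 0)"
definition black where "black p = fst (dart p 1)"

text \<open>Turning at the vertex adds \<open>hex_unit j\<close> to the face and 4 to the index j;
  this is repeated until the index is 0 or 1 modulo 6.\<close>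

lemma fst_dart:
  "fst (dart p 0) = white p" "fst (dart p 1) = black p" "fst (dart p 2) = white (p + (0, 1))"
  "fst (dart p 3) = black (p + (-1, 0))" "fst (dart p 4) = white (p + (-1, 0))"
  "fst (dart p 5) = black (p + (-1, -1))" "fst (dart p 6) = white p"
proof -
  have mod: "dart q (j + 6) = dart q j" for q j using dart_mod[of q "j + 6"] dart_mod[of q j] by simp
  show 2: "fst (dart p 2) = white (p + (0, 1))" for p
    using fst_dart_rot[of p 2] mod[of _ 0] by (simp add: white_def hex_unit_simps)
  show 3: "fst (dart p 3) = black (p + (-1, 0))" for p
    using fst_dart_rot[of p 3] mod[of _ 1] by (simp add: black_def hex_unit_simps)
  show "fst (dart p 4) = white (p + (-1, 0))"
    using fst_dart_rot[of p 4] mod[of _ 2] 2[of "p + (-1, -1)"] by (simp add: hex_unit_simps add.assoc)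
  show "fst (dart p 5) = black (p + (-1, -1))"
    using fst_dart_rot[of p 5] mod[of _ 3] 3[of "p + (0, -1)"] by (simp add: hex_unit_simps add.assoc)
  show "fst (dart p 6) = white p"
    using mod[of p 0] by (simp add: white_def)
qed (simp_all add: white_def black_def)

lemma orbit_dart:
  assumes "d \<in> D" "fst d = fst (dart p j)"
  shows "d \<in> {dart p j, dart (p + hex_unit j) (j + 4), dart (p + hex_unit j + hex_unit (j + 4)) (j + 8)}"
  using vertex_orbit[OF dart_in assms] by (simp add: dart_rot add.commute)

text \<open>The three darts at a vertex have indices that differ by multiples of 4 modulo 6, so
  exactly one of them has index 0 or 1.\<close>

lemma fst_dart_eq_iff:
  assumes "j < 2" "k < 2"
  shows "fst (dart p j) = fst (dart q k) \<longleftrightarrow> j = k \<and> period (p - q)"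
proof
  assume "fst (dart p j) = fst (dart q k)"
  from orbit_dart[OF dart_in this] have "j mod 6 = k mod 6 \<and> period (p - q) \<or> j mod 6 = (k + 4) mod 6 \<or> j mod 6 = (k + 8) mod 6"
    by (auto simp: dart_eq_iff)
  moreover have "j mod 6 \<noteq> (k + 4) mod 6" "j mod 6 \<noteq> (k + 8) mod 6" "j mod 6 = k mod 6 \<longleftrightarrow> j = k"
    using assms by (auto simp: less_2_cases_iff)
  ultimately show "j = k \<and> period (p - q)" by blast
next
  assume "j = k \<and> period (p - q)"
  then have "dart p j = dart q k" by (simp add: dart_eq_iff)
  then show "fst (dart p j) = fst (dart q k)" by simp
qed

lemma white_black_eq_iff:
  "white p = white q \<longleftrightarrow> period (p - q)" "black p = black q \<longleftrightarrow> period (p - q)" "white p \<noteq> black q"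
  using fst_dart_eq_iff[of 0 0 p q] fst_dart_eq_iff[of 1 1 p q] fst_dart_eq_iff[of 0 1 p q]
  by (simp_all add: white_def black_def)

lemma white_neighbours:
  "{v. {white p, v} \<in> edges G} = {black p, black (p + (0, -1)), black (p + (-1, -1))}"
proof -
  have "{v. {white p, v} \<in> edges G} = snd ` {d \<in> D. fst d = fst (dart p 0)}"
    by (force simp: D_eq white_def)
  also have "{d \<in> D. fst d = fst (dart p 0)} = {dart p 0, dart (p + (1, 0)) 4, dart (p + (0, -1)) 2}"
    using orbit_dart[of _ p 0] fst_dart_rot[of p 0] fst_dart_rot[of "p + (1, 0)" 4] dart_mod[of _ 8] dart_mod[of _ 2]
    by (auto simp: hex_unit_simps add.assoc)
  also have "snd ` \<dots> = {black p, black (p + (0, -1)), black (p + (-1, -1))}"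
    using fst_dart[of p] fst_dart[of "p + (1, 0)"] fst_dart[of "p + (0, -1)"]
    by (simp add: snd_dart add.assoc eval_nat_numeral)
  finally show ?thesis .
qed

lemma black_neighbours: "{black p, v} \<in> edges G \<Longrightarrow> \<exists>q. v = white q"
proof -
  assume "{black p, v} \<in> edges G"
  then have "(black p, v) \<in> {dart p 1, dart (p + hex_unit 1) 5, dart (p + hex_unit 1 + hex_unit 5) 9}"
    using orbit_dart[of "(black p, v)" p 1] by (simp add: D_eq black_def)
  then have "v \<in> {snd (dart p 1), snd (dart (p + hex_unit 1) 5), snd (dart (p + hex_unit 1 + hex_unit 5) 3)}"
    using dart_mod[of _ 9] dart_mod[of _ 3] by (auto dest: arg_cong[of _ _ snd])
  moreover have "snd (dart q 1) = white (q + (0, 1))" "snd (dart q 3) = white (q + (-1, 0))"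
    "snd (dart q 5) = white q" for q
    using fst_dart(3,5,7)[of q] by (simp_all add: snd_dart eval_nat_numeral)
  ultimately show "\<exists>q. v = white q" by blast
qed

lemma vertex_cases:
  assumes "v \<in> verts G"
  obtains p where "v = white p" | p where "v = black p"
proof -
  have "card {w. {v, w} \<in> edges G} = 3" using cubic assms by (simp add: regular_graph_def)
  then have "{w. {v, w} \<in> edges G} \<noteq> {}" by (metis card.empty zero_neq_numeral)
  then obtain w where "(v, w) \<in> D" by (auto simp: D_eq)
  then obtain p j where "(v, w) = dart p j" using dart_surj by blast
  then have v: "v = fst (dart p (j mod 6))" by (metis dart_mod fst_conv)
  have "j mod 6 \<in> {0, 1, 2, 3, 4, 5}" by auto
  then show thesis using v fst_dart[of p] that by (elim insertE emptyE) simp_all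
qed

text \<open>The basis \<open>(0, -1)\<close>, \<open>(-1, -1)\<close> of the lattice brings the neighbourhoods into the form
  used in \<^locale>\<open>honeycomb_quotient\<close>.\<close>

lemma covered_by_honeycomb:
  "honeycomb_quotient G (\<lambda>p c. (if c then black else white) (- snd p, - fst p - snd p))
    (\<lambda>p. period (- snd p, - fst p - snd p))"
proof
  let ?v = "\<lambda>p c. (if c then black else white) (- snd p, - fst p - snd p)"
  have in_verts: "white p \<in> verts G" "black p \<in> verts G" for p
    unfolding white_def black_def by (intro fst_in_verts dart_in)+
  show "finite (verts G)" using graph by (simp add: finite_connected_graph_def)
  show "verts G = {?v p c | p c. True}"
  proof
    show "verts G \<subseteq> {?v p c | p c. True}"
    proof
      fix v assume "v \<in> verts G"
      then obtain m k c where "v = (if c then black else white) (m, k)"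
        by (metis vertex_cases prod.collapse)
      then have "v = ?v (m - k, - m) c" by simp
      then show "v \<in> {?v p c | p c. True}" by blast
    qed
  qed (use in_verts in auto)
  show "?v p c = ?v q d \<longleftrightarrow> c = d \<and> period (- snd (p - q), - fst (p - q) - snd (p - q))" for p c q d
    using white_black_eq_iff white_black_eq_iff(3)[symmetric] by (simp add: algebra_simps)
  show "period (- snd 0, - fst 0 - snd 0)" using period_0 by (simp add: zero_prod_def)
  show "period (- snd (p - q), - fst (p - q) - snd (p - q))"
    if "period (- snd p, - fst p - snd p)" "period (- snd q, - fst q - snd q)" for p q
    using period_diff[OF that] by (simp add: algebra_simps)
  have adj: "{white p, black q} \<in> edges G \<longleftrightarrow> period (q - p) \<or> period (q - p + (0, 1)) \<or> period (q - p + (1, 1))" for p q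
  proof -
    have eq: "q - (p + (0, -1)) = q - p + (0, 1)" "q - (p + (-1, -1)) = q - p + (1, 1)"
      by (simp_all add: prod_eq_iff)
    have "{white p, black q} \<in> edges G \<longleftrightarrow> black q \<in> {v. {white p, v} \<in> edges G}" by simp
    then show ?thesis
      unfolding white_neighbours insert_iff empty_iff white_black_eq_iff eq by simp
  qed
  show "{?v p False, ?v q True} \<in> edges G \<longleftrightarrow> period (- snd (q - p), - fst (q - p) - snd (q - p)) \<or>
      period (- snd (q - p - (1, 0)), - fst (q - p - (1, 0)) - snd (q - p - (1, 0))) \<or>
      period (- snd (q - p - (0, 1)), - fst (q - p - (0, 1)) - snd (q - p - (0, 1)))" for p q
    by (simp add: adj algebra_simps)
  show "{?v p c, ?v q c} \<notin> edges G" for p q c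
    using black_neighbours white_neighbours white_black_eq_iff(3)
    by (cases c) (auto simp: set_eq_iff, metis)
  \<comment> \<open>The three steps are pairwise incongruent because a vertex of the cubic graph has
    three different neighbours.\<close>
  have "card {black 0, black (0, -1), black (-1, -1)} = 3"
    using cubic[unfolded regular_graph_def, rule_format, OF in_verts(1)[of 0]]
    unfolding white_neighbours by simp
  then have "black 0 \<noteq> black (0, -1)" "black 0 \<noteq> black (-1, -1)" "black (0, -1) \<noteq> black (-1, -1)"
    by (auto simp: card_insert_if split: if_splits)
  then have *: "\<not> period (0, 1)" "\<not> period (1, 1)" "\<not> period (1, 0)"
    by (simp_all add: white_black_eq_iff zero_prod_def)
  have neg: "period (- p) \<longleftrightarrow> period p" for p
    using period_diff[OF period_0, of p] period_diff[OF period_0, of "- p"] by auto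
  show "\<not> period (- snd (1, 0), - fst (1, 0) - snd (1, 0))" "\<not> period (- snd (0, 1), - fst (0, 1) - snd (0, 1))"
    "\<not> period (- snd (1, -1), - fst (1, -1) - snd (1, -1))"
    using * neg[of "(0, 1)"] neg[of "(1, 1)"] by simp_all
qed (rule girth)

end

section \<open>From a coherently oriented map to its darts\<close>

lemma mem_walk_edges_iff:
  "e \<in> set (walk_edges W) \<longleftrightarrow> (\<exists>i<length W. e = {W ! i, W ! (Suc i mod length W)})"
  by (auto simp: walk_edges_def)

lemma list6_cases:
  assumes "length W = 6"
  obtains a b c d e f where "W = [a, b, c, d, e, f]"
proof -
  have "length W = Suc (Suc (Suc (Suc (Suc (Suc 0)))))" using assms by simp
  then show thesis using that by (auto simp: length_Suc_conv)
qed

text \<open>Equal vertices at distance 1 along the walk would be a loop, at distance 2 a repeated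
  edge, and at distance 3 would close a triangle.\<close>

lemma distinct_face_walk:
  assumes G: "finite_connected_graph G" and W: "closed_walk G W" "length W = 6" "distinct (walk_edges W)"
    and girth: "\<And>C. is_cycle G C \<Longrightarrow> length C \<ge> 6"
  shows "distinct W"
proof -
  obtain a b c d e f where eq: "W = [a, b, c, d, e, f]" using list6_cases[OF W(2)] by blast
  have walk_edges: "walk_edges W = [{a, b}, {b, c}, {c, d}, {d, e}, {e, f}, {f, a}]"
    by (simp add: eq walk_edges_def upt_rec)
  have edges: "{a, b} \<in> edges G" "{b, c} \<in> edges G" "{c, d} \<in> edges G" "{d, e} \<in> edges G" "{e, f} \<in> edges G"
    "{f, a} \<in> edges G"
    and verts: "a \<in> verts G" "b \<in> verts G" "c \<in> verts G" "d \<in> verts G" "e \<in> verts G" "f \<in> verts G"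
    using W(1) unfolding closed_walk_def walk_edges by (simp_all add: eq)
  have loop: "x \<noteq> y" if "{x, y} \<in> edges G" for x y
    using that G unfolding finite_connected_graph_def by force
  have 1: "a \<noteq> b" "b \<noteq> c" "c \<noteq> d" "d \<noteq> e" "e \<noteq> f" "f \<noteq> a"
    using edges[THEN loop] by simp_all
  have "{a, b} \<noteq> {b, c}" "{b, c} \<noteq> {c, d}" "{c, d} \<noteq> {d, e}" "{d, e} \<noteq> {e, f}" "{e, f} \<noteq> {f, a}" "{a, b} \<noteq> {f, a}"
    using W(3) by (simp_all only: walk_edges distinct.simps list.set insert_iff de_Morgan_disj simp_thms)
  then have 2: "a \<noteq> c" "b \<noteq> d" "c \<noteq> e" "d \<noteq> f" "e \<noteq> a" "f \<noteq> b"
    by (metis insert_commute)+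
  have triangle: False if "{x, y} \<in> edges G" "{y, z} \<in> edges G" "{z, x} \<in> edges G" "x \<noteq> y" "y \<noteq> z" "x \<noteq> z"
    "x \<in> verts G" "y \<in> verts G" "z \<in> verts G" for x y z
  proof -
    have "is_cycle G [x, y, z]"
      using that by (simp add: is_cycle_def closed_walk_def walk_edges_def upt_rec)
    then show False using girth by fastforce
  qed
  have 3: "a \<noteq> d" "b \<noteq> e" "c \<noteq> f"
    using triangle[of a b c] triangle[of b c d] triangle[of c d e] edges verts 1 2 by auto
  show ?thesis using 1 2 3 by (auto simp: eq)
qed

locale oriented_hexagonal_map =
  fixes G :: "'a graph" and T :: "'a list set" and \<sigma> :: "'a list \<Rightarrow> bool"
  assumes map: "is_map G T" and type: "has_type G T 6 3"
    and girth: "is_cycle G C \<Longrightarrow> length C \<ge> 6"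
    and same_direction: "\<lbrakk>W \<in> T; W' \<in> T; W \<noteq> W'; i < 6; j < 6; W ! i = W' ! j;
        W ! (Suc i mod 6) = W' ! (Suc j mod 6)\<rbrakk> \<Longrightarrow> \<sigma> W \<noteq> \<sigma> W'"
    and opposite_direction: "\<lbrakk>W \<in> T; W' \<in> T; W \<noteq> W'; i < 6; j < 6; W ! i = W' ! (Suc j mod 6);
        W ! (Suc i mod 6) = W' ! j\<rbrakk> \<Longrightarrow> \<sigma> W = \<sigma> W'"
begin

lemma graph: "finite_connected_graph G"
  using map by (simp add: is_map_def)

lemma length_face: "W \<in> T \<Longrightarrow> length W = 6"
  using type by (simp add: has_type_def)

lemma distinct_face: "W \<in> T \<Longrightarrow> distinct W"
  using distinct_face_walk[OF graph _ length_face _ girth] map by (auto simp: is_map_def)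

text \<open>Reversing the walks of negative sign makes the orientation coherent: the two faces at an
  edge run through it in opposite directions.\<close>

definition face :: "'a list \<Rightarrow> 'a list" where
  "face W = (if \<sigma> W then W else rev W)"

definition corner :: "'a list \<Rightarrow> nat \<Rightarrow> 'a" where
  "corner W i = face W ! (i mod 6)"

lemma corner_eq_iff: "W \<in> T \<Longrightarrow> corner W i = corner W j \<longleftrightarrow> i mod 6 = j mod 6"
  using distinct_face length_face by (simp add: corner_def face_def nth_eq_iff_index_eq)

lemma corner_6: "corner W (Suc (Suc (Suc (Suc (Suc (Suc i)))))) = corner W i"
  by (simp add: corner_def)

lemma corner_side:
  assumes W: "W \<in> T"
  shows "(\<exists>i. corner W i = u \<and> corner W (Suc i) = v) \<longleftrightarrow>
    (\<exists>i<6. if \<sigma> W then W ! i = u \<and> W ! (Suc i mod 6) = v else W ! i = v \<and> W ! (Suc i mod 6) = u)"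
proof (cases "\<sigma> W")
  case True
  show ?thesis
  proof
    assume "\<exists>i. corner W i = u \<and> corner W (Suc i) = v"
    then obtain i where "W ! (i mod 6) = u" "W ! (Suc (i mod 6) mod 6) = v"
      using True by (auto simp: corner_def face_def mod_Suc_eq)
    then show "\<exists>i<6. if \<sigma> W then W ! i = u \<and> W ! (Suc i mod 6) = v else W ! i = v \<and> W ! (Suc i mod 6) = u"
      using True by (intro exI[of _ "i mod 6"]) simp
  next
    assume "\<exists>i<6. if \<sigma> W then W ! i = u \<and> W ! (Suc i mod 6) = v else W ! i = v \<and> W ! (Suc i mod 6) = u"
    then obtain i where "i < 6" "W ! i = u" "W ! (Suc i mod 6) = v" using True by auto
    then show "\<exists>i. corner W i = u \<and> corner W (Suc i) = v"
      using True by (intro exI[of _ i]) (simp add: corner_def face_def)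
  qed
next
  case False
  have nth: "corner W i = W ! (5 - i mod 6)" for i
    using False length_face[OF W] by (simp add: corner_def face_def rev_nth)
  show ?thesis
  proof
    assume "\<exists>i. corner W i = u \<and> corner W (Suc i) = v"
    then obtain i where i: "W ! (5 - i mod 6) = u" "W ! (5 - Suc i mod 6) = v" unfolding nth by auto
    have "i mod 6 \<in> {0, 1, 2, 3, 4, 5}" by auto
    then have "Suc (5 - Suc i mod 6) mod 6 = 5 - i mod 6" by (auto simp: mod_Suc)
    then show "\<exists>i<6. if \<sigma> W then W ! i = u \<and> W ! (Suc i mod 6) = v else W ! i = v \<and> W ! (Suc i mod 6) = u"
      using False i by (intro exI[of _ "5 - Suc i mod 6"]) simp
  next
    assume "\<exists>i<6. if \<sigma> W then W ! i = u \<and> W ! (Suc i mod 6) = v else W ! i = v \<and> W ! (Suc i mod 6) = u"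
    then obtain i where i: "i < 6" "W ! i = v" "W ! (Suc i mod 6) = u" using False by auto
    have "i \<in> {0, 1, 2, 3, 4, 5}" using i(1) by auto
    \<comment> \<open>Position i + 1 of the list is corner 4 - i of its reversal; 10 replaces 4 to
      keep the subtraction exact for i = 5.\<close>
    then have "5 - (10 - i) mod 6 = Suc i mod 6" "5 - Suc (10 - i) mod 6 = i" by auto
    then show "\<exists>i. corner W i = u \<and> corner W (Suc i) = v"
      using i unfolding nth by (intro exI[of _ "10 - i"]) simp
  qed
qed

lemma corner_edge: "W \<in> T \<Longrightarrow> {corner W i, corner W (Suc i)} \<in> edges G"
proof -
  assume W: "W \<in> T"
  have "{W ! j, W ! (Suc j mod 6)} \<in> edges G" if "j < 6" for j
    using map W that length_face[OF W] mem_walk_edges_iff[of "{W ! j, W ! (Suc j mod 6)}" W]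
    unfolding is_map_def closed_walk_def by auto
  moreover obtain j where "j < 6" "if \<sigma> W then W ! j = corner W i \<and> W ! (Suc j mod 6) = corner W (Suc i)
      else W ! j = corner W (Suc i) \<and> W ! (Suc j mod 6) = corner W i"
    using corner_side[OF W, of "corner W i" "corner W (Suc i)"] by blast
  ultimately show ?thesis by (metis insert_commute)
qed

text \<open>Two different faces with the same oriented side would contradict one of the two sign
  rules, depending on whether their signs agree.\<close>

lemma dart_face_unique:
  assumes W: "W \<in> T" "W' \<in> T" and eq: "corner W i = corner W' j" "corner W (Suc i) = corner W' (Suc j)"
  shows "W = W'" "i mod 6 = j mod 6"
proof -
  show "W = W'"
  proof (rule ccontr)
    assume neq: "W \<noteq> W'"
    obtain k where k: "k < 6" "if \<sigma> W then W ! k = corner W i \<and> W ! (Suc k mod 6) = corner W (Suc i)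
        else W ! k = corner W (Suc i) \<and> W ! (Suc k mod 6) = corner W i"
      using corner_side[OF W(1), of "corner W i" "corner W (Suc i)"] by blast
    obtain l where l: "l < 6" "if \<sigma> W' then W' ! l = corner W i \<and> W' ! (Suc l mod 6) = corner W (Suc i)
        else W' ! l = corner W (Suc i) \<and> W' ! (Suc l mod 6) = corner W i"
      using corner_side[OF W(2), of "corner W' j" "corner W' (Suc j)"] unfolding eq by blast
    show False
    proof (cases "\<sigma> W = \<sigma> W'")
      case True
      then have "W ! k = W' ! l" "W ! (Suc k mod 6) = W' ! (Suc l mod 6)" using k(2) l(2) by metis+
      from same_direction[OF W neq k(1) l(1) this] True show False by contradiction
    next
      case False
      then have "W ! k = W' ! (Suc l mod 6)" "W ! (Suc k mod 6) = W' ! l" using k(2) l(2) by metis+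
      from opposite_direction[OF W neq k(1) l(1) this] False show False by contradiction
    qed
  qed
  then show "i mod 6 = j mod 6" using eq(1) corner_eq_iff W by simp
qed

text \<open>Of the two faces at the edge, not both can run through it from v to u by
  \<open>dart_face_unique\<close>, so one of them has the wanted direction.\<close>

lemma dart_face_exists:
  assumes "{u, v} \<in> edges G"
  obtains W i where "W \<in> T" "corner W i = u" "corner W (Suc i) = v"
proof -
  have "card {W \<in> T. {u, v} \<in> set (walk_edges W)} = 2" using map assms by (simp add: is_map_def)
  then obtain W W' where WW': "{W \<in> T. {u, v} \<in> set (walk_edges W)} = {W, W'}" "W \<noteq> W'"
    by (auto simp: card_2_iff)
  have side: "(\<exists>i. corner W i = u \<and> corner W (Suc i) = v) \<or> (\<exists>i. corner W i = v \<and> corner W (Suc i) = u)"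
    if W: "W \<in> T" "{u, v} \<in> set (walk_edges W)" for W
  proof -
    obtain i where "i < 6" "{u, v} = {W ! i, W ! (Suc i mod 6)}"
      using W(2) length_face[OF W(1)] unfolding mem_walk_edges_iff by auto
    then show ?thesis
      unfolding corner_side[OF W(1)] by (cases "\<sigma> W") (auto simp: doubleton_eq_iff)
  qed
  have "W \<in> T" "W' \<in> T" using WW' by auto
  moreover have "{u, v} \<in> set (walk_edges W)" "{u, v} \<in> set (walk_edges W')" using WW' by auto
  ultimately show thesis
    using side[of W] side[of W'] dart_face_unique(1)[of W W'] WW'(2) that by metis
qed

definition D :: "('a \<times> 'a) set" where "D = {(u, v). {u, v} \<in> edges G}"

text \<open>On darts of the graph the description is unique: the face and the position in it are
  determined by \<open>dart_face_unique\<close>.\<close>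

definition succ :: "'a \<times> 'a \<Rightarrow> 'a \<times> 'a" where
  "succ d = (snd d, THE w. \<exists>W\<in>T. \<exists>i. fst d = corner W i \<and> snd d = corner W (Suc i) \<and> w = corner W (Suc (Suc i)))"

lemma succ_corner:
  assumes "W \<in> T"
  shows "succ (corner W i, corner W (Suc i)) = (corner W (Suc i), corner W (Suc (Suc i)))"
proof -
  have "w = corner W (Suc (Suc i))"
    if "W' \<in> T" "corner W i = corner W' j" "corner W (Suc i) = corner W' (Suc j)" "w = corner W' (Suc (Suc j))"
    for W' j w
  proof -
    have "W' = W" "j mod 6 = i mod 6" using dart_face_unique[OF assms that(1-3)] by auto
    moreover from this have "Suc (Suc j) mod 6 = Suc (Suc i) mod 6" by (simp add: mod_Suc)
    ultimately show ?thesis using that(4) corner_eq_iff[OF assms] by simp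
  qed
  then have "(THE w. \<exists>W'\<in>T. \<exists>j. corner W i = corner W' j \<and> corner W (Suc i) = corner W' (Suc j) \<and>
      w = corner W' (Suc (Suc j))) = corner W (Suc (Suc i))"
    using assms by (intro the_equality) blast+
  then show ?thesis by (simp add: succ_def)
qed

lemma D_cases:
  assumes "d \<in> D"
  obtains W i where "W \<in> T" "d = (corner W i, corner W (Suc i))"
proof -
  obtain u v where d: "d = (u, v)" "{u, v} \<in> edges G" using assms by (auto simp: D_def)
  then show thesis using dart_face_exists[of u v] that by metis
qed

lemma corner_in_D: "W \<in> T \<Longrightarrow> (corner W i, corner W (Suc i)) \<in> D"
  using corner_edge by (simp add: D_def)

lemma succ_in_D: "d \<in> D \<Longrightarrow> succ d \<in> D"
  using succ_corner corner_in_D by (metis D_cases)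

lemma fst_succ: "fst (succ d) = snd d"
  by (simp add: succ_def)

lemma succ_6: "d \<in> D \<Longrightarrow> succ (succ (succ (succ (succ (succ d))))) = d"
proof (erule D_cases)
  fix W i assume W: "W \<in> T" "d = (corner W i, corner W (Suc i))"
  have "succ (corner W (Suc (Suc (Suc (Suc (Suc i))))), corner W i) = (corner W i, corner W (Suc i))"
    using succ_corner[OF W(1), of "Suc (Suc (Suc (Suc (Suc i))))"] by (simp add: corner_6)
  then show "succ (succ (succ (succ (succ (succ d))))) = d"
    using W by (simp add: succ_corner corner_6)
qed

lemma corner_neq:
  assumes "W \<in> T"
  shows "corner W (Suc i) \<noteq> corner W i" "corner W (Suc (Suc i)) \<noteq> corner W i" "corner W (Suc (Suc (Suc i))) \<noteq> corner W i"
proof -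
  have "Suc i mod 6 \<noteq> i mod 6" "Suc (Suc i) mod 6 \<noteq> i mod 6" "Suc (Suc (Suc i)) mod 6 \<noteq> i mod 6"
    by (auto simp: mod_Suc)
  then show "corner W (Suc i) \<noteq> corner W i" "corner W (Suc (Suc i)) \<noteq> corner W i" "corner W (Suc (Suc (Suc i))) \<noteq> corner W i"
    by (simp_all add: corner_eq_iff[OF assms])
qed

definition rotate_at :: "'a \<Rightarrow> 'a \<Rightarrow> 'a" where
  "rotate_at u w = snd (succ (w, u))"

lemma succ_eq_rotate_at: "succ (w, u) = (u, rotate_at u w)"
  by (simp add: rotate_at_def prod_eq_iff fst_succ)

text \<open>Turning at u permutes its three neighbours injectively, since \<open>succ\<close> is
  invertible, and without fixed points, since corners of a face two apart differ. Hence it is a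
  3-cycle.\<close>

lemma
  assumes w: "{u, w} \<in> edges G"
  shows rotate_at_3: "rotate_at u (rotate_at u (rotate_at u w)) = w"
    and neighbours: "{v. {u, v} \<in> edges G} = {w, rotate_at u w, rotate_at u (rotate_at u w)}"
proof -
  let ?N = "{v. {u, v} \<in> edges G}"
  have "u \<in> verts G" using w graph unfolding finite_connected_graph_def by auto
  then have N: "card ?N = 3" using type by (simp add: has_type_def regular_graph_def)
  have "rotate_at u ` ?N \<subseteq> ?N"
    using succ_in_D by (fastforce simp: D_def succ_eq_rotate_at insert_commute)
  moreover have "inj_on (rotate_at u) ?N"
  proof (rule inj_onI)
    fix x y assume xy: "x \<in> ?N" "y \<in> ?N" "rotate_at u x = rotate_at u y"
    then have "succ (x, u) = succ (y, u)" by (simp add: succ_eq_rotate_at)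
    moreover have "(x, u) \<in> D" "(y, u) \<in> D" using xy by (simp_all add: D_def insert_commute)
    ultimately show "x = y" using succ_6 by (metis prod.inject)
  qed
  moreover have "rotate_at u x \<noteq> x" if x: "x \<in> ?N" for x
  proof -
    have "(x, u) \<in> D" using x by (simp add: D_def insert_commute)
    then obtain W i where W: "W \<in> T" "(x, u) = (corner W i, corner W (Suc i))" by (rule D_cases)
    then show ?thesis using corner_neq(2)[OF W(1)] succ_corner[OF W(1), of i] by (simp add: rotate_at_def)
  qed
  moreover have "w \<in> ?N" using w by simp
  ultimately show "rotate_at u (rotate_at u (rotate_at u w)) = w" "?N = {w, rotate_at u w, rotate_at u (rotate_at u w)}"
    using fixed_point_free_3[OF N] by blast+
qed

lemma dart_system: "\<exists>d\<^sub>0. dart_system D succ d\<^sub>0 G"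
proof -
  obtain u where u: "u \<in> verts G" using graph by (auto simp: finite_connected_graph_def)
  then have "card {w. {u, w} \<in> edges G} = 3" using type by (simp add: has_type_def regular_graph_def)
  then have "{w. {u, w} \<in> edges G} \<noteq> {}" by (metis card.empty zero_neq_numeral)
  then obtain w where "(u, w) \<in> D" by (auto simp: D_def)
  moreover have "dart_system D succ d G" if d: "d \<in> D" for d
  proof
    show "succ (prod.swap (succ (prod.swap (succ (prod.swap x))))) = x" if "x \<in> D" for x
      using that rotate_at_3 by (auto simp: D_def succ_eq_rotate_at)
    show "succ x \<noteq> x" "succ (succ x) \<noteq> x" "succ (succ (succ x)) \<noteq> x" "succ (prod.swap x) \<noteq> x" "prod.swap x \<noteq> x"
      if "x \<in> D" for x
    proof -
      obtain W i where W: "W \<in> T" "x = (corner W i, corner W (Suc i))" using \<open>x \<in> D\<close> by (rule D_cases)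
      then show "succ x \<noteq> x" "succ (succ x) \<noteq> x" "succ (succ (succ x)) \<noteq> x" "prod.swap x \<noteq> x"
        using corner_neq[OF W(1)] by (auto simp: succ_corner)
      have "prod.swap x \<in> D" using \<open>x \<in> D\<close> by (auto simp: D_def insert_commute)
      then obtain W' j where W': "W' \<in> T" "prod.swap x = (corner W' j, corner W' (Suc j))" by (rule D_cases)
      then have "snd (succ (prod.swap x)) \<noteq> snd x"
        using corner_neq(2)[OF W'(1), of j] by (cases x) (simp add: succ_corner)
      then show "succ (prod.swap x) \<noteq> x" by auto
    qed
    show "d' \<in> {x, succ (prod.swap x), succ (prod.swap (succ (prod.swap x)))}"
      if x: "x \<in> D" "d' \<in> D" "fst d' = fst x" for x d'
    proof -
      obtain u w v where eq: "x = (u, w)" "d' = (u, v)" using x by (cases x; cases d') auto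
      then have "{u, w} \<in> edges G" "v \<in> {v. {u, v} \<in> edges G}" using x by (auto simp: D_def)
      then show ?thesis using neighbours by (auto simp: eq succ_eq_rotate_at)
    qed
    show "regular_graph 3 G" using type by (simp add: has_type_def)
  qed (use d graph girth fst_succ succ_6 succ_in_D in \<open>auto simp: D_def insert_commute\<close>)
  ultimately show ?thesis by blast
qed

lemma honeycomb:
  obtains vert period where "honeycomb_quotient G vert period"
  using dart_system dart_system.covered_by_honeycomb by blast

end

section \<open>Closed walks up to rotation and reversal\<close>

lemma rev_rotate: "\<exists>j. rev (rotate k xs) = rotate j (rev xs)"
proof (induction k)
  case 0
  have "rev (rotate 0 xs) = rotate 0 (rev xs)" by simp
  then show ?case by blast
next
  case (Suc k)
  have "\<exists>j. rev (rotate1 ys) = rotate j (rev ys)" for ys :: "'a list"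
  proof (cases ys)
    case (Cons y zs)
    then have "rev (rotate1 ys) = rotate (length (rev zs)) (rev ys)" by (simp only: rotate1.simps rev.simps rev_append rotate_append) simp
    then show ?thesis by blast
  qed simp
  with Suc show ?case by (metis rotate_Suc rotate_rotate)
qed

lemma same_closed_walk_rotate: "same_closed_walk W C \<Longrightarrow> same_closed_walk W (rotate j C)"
  unfolding same_closed_walk_def by (auto simp: rotate_rotate)

lemma same_closed_walk_rev: "same_closed_walk W C \<Longrightarrow> same_closed_walk W (rev C)"
  unfolding same_closed_walk_def by (metis rev_rotate rev_rev_ident)

lemma same_closed_walk_refl: "same_closed_walk W W"
  unfolding same_closed_walk_def by (rule exI[of _ 0]) simp

lemma same_closed_walk_of_rotate1:
  assumes "same_closed_walk W (rotate1 C)"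
  shows "same_closed_walk W C"
proof (cases "C = []")
  case False
  have "rotate (length C - 1) (rotate1 C) = rotate (length C - 1 + 1) C" by (simp add: rotate1_rotate_swap)
  also have "\<dots> = C" using False by simp
  finally show ?thesis using same_closed_walk_rotate[OF assms] by metis
qed (use assms in simp)

lemma is_cycle_rotate1_rev:
  assumes "is_cycle G C" "length C = 6"
  shows "is_cycle G (rotate1 C)" "is_cycle G (rev C)"
proof -
  obtain a b c d e f where C: "C = [a, b, c, d, e, f]" using list6_cases[OF assms(2)] by blast
  show "is_cycle G (rotate1 C)" "is_cycle G (rev C)"
    using assms(1) unfolding is_cycle_def closed_walk_def C
    by (auto simp: walk_edges_def upt_rec insert_commute)
qed

lemma is_cycle_same_closed_walk:
  assumes C: "is_cycle G C" "length C = 6" and same: "same_closed_walk C D"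
  shows "is_cycle G D \<and> length D = 6"
proof -
  have rot: "is_cycle G (rotate k E) \<and> length (rotate k E) = 6" if "is_cycle G E" "length E = 6" for k E
    by (induction k) (simp_all add: that is_cycle_rotate1_rev)
  have "is_cycle G (rev C)" "length (rev C) = 6" using is_cycle_rotate1_rev(2)[OF C] C by simp_all
  then show ?thesis using same rot C unfolding same_closed_walk_def by blast
qed

section \<open>Identification of the 6-cycles with the faces\<close>

context oriented_hexagonal_map begin

lemma face_is_cycle: "W \<in> T \<Longrightarrow> is_cycle G W"
  using map distinct_face length_face by (auto simp: is_map_def is_cycle_def)

lemma same_closed_walk_face: "same_closed_walk W (face W)"
  using same_closed_walk_refl[of W] same_closed_walk_rev[OF same_closed_walk_refl[of W]]
  by (simp add: face_def)

text \<open>At a cubic vertex any two neighbours are consecutive in the rotation, so every path of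
  length 2 lies on a face, in one of the two directions.\<close>

lemma consecutive_corners:
  assumes "{u, v} \<in> edges G" "{u, w} \<in> edges G" "v \<noteq> w"
  obtains W i where "W \<in> T" "corner W i = v" "corner W (Suc i) = u" "corner W (Suc (Suc i)) = w"
    | W i where "W \<in> T" "corner W i = w" "corner W (Suc i) = u" "corner W (Suc (Suc i)) = v"
proof -
  have "w = rotate_at u v \<or> v = rotate_at u w"
    using neighbours[OF assms(1)] rotate_at_3[OF assms(1)] assms(2,3) by auto
  then show thesis
  proof
    assume w: "w = rotate_at u v"
    have "(v, u) \<in> D" using assms by (simp add: D_def insert_commute)
    then obtain W i where "W \<in> T" "(v, u) = (corner W i, corner W (Suc i))" by (rule D_cases)
    then show thesis using that(1)[of W i] succ_corner[of W i] w by (simp add: rotate_at_def)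
  next
    assume v: "v = rotate_at u w"
    have "(w, u) \<in> D" using assms by (simp add: D_def insert_commute)
    then obtain W i where "W \<in> T" "(w, u) = (corner W i, corner W (Suc i))" by (rule D_cases)
    then show thesis using that(2)[of W i] succ_corner[of W i] v by (simp add: rotate_at_def)
  qed
qed

lemma face_at_corner:
  assumes "W \<in> T"
  obtains D where "same_closed_walk W D" "D ! 0 = corner W (Suc i)" "D ! 1 = corner W (Suc (Suc i))"
    "D ! 5 = corner W i"
proof
  have len: "length (face W) = 6" using length_face[OF assms] by (simp add: face_def)
  \<comment> \<open>Rotating by i + 1 puts the middle corner first; its predecessor i becomes entry
    5, as i + 6 and i name the same corner.\<close>
  have nth: "rotate (Suc i) (face W) ! k = corner W (Suc i + k)" if "k < 6" for k
    using that len by (simp add: nth_rotate corner_def del: rotate_Suc)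
  show "same_closed_walk W (rotate (Suc i) (face W))"
    by (rule same_closed_walk_rotate[OF same_closed_walk_face])
  show "rotate (Suc i) (face W) ! 0 = corner W (Suc i)" "rotate (Suc i) (face W) ! 1 = corner W (Suc (Suc i))"
    "rotate (Suc i) (face W) ! 5 = corner W i"
    using nth[of 0] nth[of 1] nth[of 5] corner_6[of W i] by (simp_all add: eval_nat_numeral del: rotate_Suc)
qed

lemma face_through:
  assumes "{u, v} \<in> edges G" "{u, w} \<in> edges G" "v \<noteq> w"
  obtains W D where "W \<in> T" "same_closed_walk W D" "D ! 0 = u" "D ! 1 = v" "D ! 5 = w"
  using assms
proof (cases rule: consecutive_corners)
  case (2 W i)
  then show thesis using face_at_corner[OF 2(1), of i] that by metis
next
  case (1 W i)
  obtain D where D: "same_closed_walk W D" "D ! 0 = u" "D ! 1 = w" "D ! 5 = v"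
    using face_at_corner[OF 1(1), of i] 1 by metis
  have "length D = 6" using is_cycle_same_closed_walk[OF face_is_cycle length_face D(1)] 1 by simp
  then obtain a b c d e f where eq: "D = [a, b, c, d, e, f]" by (rule list6_cases)
  \<comment> \<open>Reversing and then rotating by 5 keeps entry 0 and exchanges entries 1 and 5,
    which corrects the direction of the face.\<close>
  have "rotate 5 (rev D) ! 0 = u" "rotate 5 (rev D) ! 1 = v" "rotate 5 (rev D) ! 5 = w"
    using D unfolding eq by (simp_all add: eval_nat_numeral)
  then show thesis using that 1(1) D(1) same_closed_walk_rotate same_closed_walk_rev by metis
qed

text \<open>A 6-cycle shares the path around a white vertex with some face by
  \<open>face_through\<close>, and \<open>six_cycle_unique\<close> makes the two equal.\<close>

theorem six_cycles:
  assumes none: "\<not> in_families G"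
  shows "{C. is_cycle G C \<and> length C = 6} = {C. \<exists>W\<in>T. same_closed_walk W C}"
proof (intro equalityI subsetI)
  fix C assume "C \<in> {C. \<exists>W\<in>T. same_closed_walk W C}"
  then show "C \<in> {C. is_cycle G C \<and> length C = 6}"
    using is_cycle_same_closed_walk face_is_cycle length_face by blast
next
  fix C assume "C \<in> {C. is_cycle G C \<and> length C = 6}"
  then have C: "is_cycle G C" "length C = 6" by auto
  obtain vert period where "honeycomb_quotient G vert period" using honeycomb .
  then interpret honeycomb_quotient G vert period .
  have white: "\<exists>W\<in>T. same_closed_walk W C" if C: "is_cycle G C" "length C = 6" "C ! 0 = vert p False" for C p
  proof -
    obtain a b c d e f where eq: "C = [a, b, c, d, e, f]" using list6_cases[OF C(2)] by blast
    have "{a, b} \<in> edges G" "{a, f} \<in> edges G" "b \<noteq> f"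
      using C(1) by (auto simp: eq is_cycle_def closed_walk_def walk_edges_def upt_rec insert_commute)
    then obtain W D where W: "W \<in> T" "same_closed_walk W D" "D ! 0 = a" "D ! 1 = b" "D ! 5 = f"
      by (rule face_through)
    have "is_cycle G D" "length D = 6"
      using is_cycle_same_closed_walk[OF face_is_cycle length_face W(2)] W(1) by auto
    then have "D = C" using six_cycle_unique[OF none C(1,2) _ _ C(3)] W by (simp add: eq)
    then show ?thesis using W by blast
  qed
  have "\<exists>W\<in>T. same_closed_walk W C"
  proof -
    obtain a b c d e f where eq: "C = [a, b, c, d, e, f]" using list6_cases[OF C(2)] by blast
    have ab: "{a, b} \<in> edges G" "a \<in> verts G" "b \<in> verts G"
      using C(1) by (auto simp: eq is_cycle_def closed_walk_def walk_edges_def upt_rec)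
    show ?thesis
    proof (cases "\<exists>p. a = vert p False")
      case True
      then show ?thesis using white[OF C] by (auto simp: eq)
    next
      case False
      then obtain q where "a = vert q True" using white_or_black ab(2) by blast
      \<comment> \<open>A cycle that starts at a black vertex is rotated by one, so that it starts
        at a white one.\<close>
      then obtain p where "b = vert p False" using black_neighbour_white ab by blast
      then have "\<exists>W\<in>T. same_closed_walk W (rotate1 C)"
        using white[OF is_cycle_rotate1_rev(1)[OF C]] C(2) by (simp add: eq)
      then show ?thesis using same_closed_walk_of_rotate1 by blast
    qed
  qed
  then show "C \<in> {C. \<exists>W\<in>T. same_closed_walk W C}" by blast
qed

end

theorem corollary2:
  fixes \<Gamma> :: "'a graph" and T :: "'a list set"
  assumes "is_map \<Gamma> T"
    and "has_type \<Gamma> T 6 3"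
    and "on_torus \<Gamma> T"
    and "\<nexists>C. is_cycle \<Gamma> C \<and> length C < 6"
  shows "(\<exists>n\<ge>7. graph_iso \<Gamma> (Psi_graph n)) \<or>
         (\<exists>n\<ge>3. graph_iso \<Gamma> (Sigma_graph n)) \<or>
         (\<exists>n\<ge>4. graph_iso \<Gamma> (Delta_graph n)) \<or>
         {C. is_cycle \<Gamma> C \<and> length C = 6} = {C. \<exists>W\<in>T. same_closed_walk W C}"
proof -
  have girth: "length C \<ge> 6" if "is_cycle \<Gamma> C" for C
    using assms(4) that not_le by blast
  have len: "length W = 6" if "W \<in> T" for W
    using assms(2) that by (simp add: has_type_def)
  have "distinct W" if "W \<in> T" for W
    using distinct_face_walk[of \<Gamma> W, OF _ _ len[OF that] _ girth] assms(1) that by (simp add: is_map_def)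
  then have face: "distinct W \<and> length W = 6" if "W \<in> T" for W
    using that len by blast
  have "(3::nat) \<le> 6" by simp
  from assms(1,3) face this show ?thesis
  proof (rule torus_orientation)
    fix \<sigma> :: "'a list \<Rightarrow> bool"
    assume \<sigma>: "\<And>W W' i j. \<lbrakk>W \<in> T; W' \<in> T; W \<noteq> W'; i < 6; j < 6; W ! i = W' ! j;
        W ! (Suc i mod 6) = W' ! (Suc j mod 6)\<rbrakk> \<Longrightarrow> \<sigma> W \<noteq> \<sigma> W'"
      "\<And>W W' i j. \<lbrakk>W \<in> T; W' \<in> T; W \<noteq> W'; i < 6; j < 6; W ! i = W' ! (Suc j mod 6);
        W ! (Suc i mod 6) = W' ! j\<rbrakk> \<Longrightarrow> \<sigma> W = \<sigma> W'"
    interpret oriented_hexagonal_map \<Gamma> T \<sigma>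
      by unfold_locales (fact assms(1) assms(2) girth \<sigma>)+
    show ?thesis
      using six_cycles unfolding in_families_def by blast
  qed
qed

end
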